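(* Let $F_1,\dots,F_n:\mathcal{H}\rightrightarrows\mathcal{H}$ be maximally monotone, and let $B_i:\mathcal{H}\to\mathcal{H}$ be $\frac{1}{L_i}$-cocoercive with $L_i>0$ for $i=1,\dots,m$, with $\operatorname{zer}\left(\sum_{i=1}^nF_i+\sum_{i=1}^mB_i\right)\neq\emptyset$. Suppose that the parameters $\theta,\{\gamma_k\},\{\xi_k\}$ satisfy the parameter conditions (i)–(iii) of the context and that the matrices $M,S,C,Q$ satisfy the matrix conditions (a)–(c) of the context. Let $\{\mathbf{x}^k\}\subseteq\mathcal{H}^n$ and $\{\mathbf{z}^k\}\subseteq\mathcal{H}^{n-1}$ be generated by the deviation algorithm described in the context, where the deviations $\{\mathbf{u}^k\}\subseteq\mathcal{H}^m$ and $\{\mathbf{v}^k\}\subseteq\mathcal{H}^{n-1}$ satisfy, for all $k\in\mathbb{N}$, $$\frac{\gamma_{k+1}}{1-\gamma_{k+1}}\|\mathbf{v}^{k+1}\|^2+\frac{\gamma_{k+1}(1+\theta)}{2}\|\mathbf{u}^{k+1}\|_{\mathbf{L}^{-1}}^2\le\xi_k l_k^2,\qquad l_k^2=\frac{1-\gamma_k}{\gamma_k}\left\|\mathbf{z}^{k+1}-\mathbf{z}^k+\frac{\gamma_k}{1-\gamma_k}\mathbf{v}^k\right\|^2 .$$ Let $T$ be the operator on $\mathcal{H}^{n-1}$ defined in the context. Then the following assertions hold: (i) The sequence $\{l_k^2\}$ is summable and the sequences $\{\mathbf{u}^k\}$ and $\{\mathbf{v}^k\}$ converge (in norm) to zero.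 (ii) For all $\mathbf{z}\in\operatorname{Fix}T$, the sequence $\{\|\mathbf{z}^k-\mathbf{z}\|\}$ converges. (iii) As $k\to\infty$, $\mathbf{z}^{k+1}-\mathbf{z}^k\to0$ and $\sum_{i=1}^ns_ix_i^k\to0$ for all $s\in\mathbb{R}^n$ with $\sum_{i=1}^ns_i=0$. (iv) The sequence $\{\mathbf{z}^k\}$ converges weakly to a point in $\operatorname{Fix}T$. (v) The sequence $\{\mathbf{x}^k\}$ converges weakly to a point $(\bar{x},\dots,\bar{x})\in\mathcal{H}^n$ such that $\bar{x}\in\operatorname{zer}\left(\sum_{i=1}^nF_i+\sum_{i=1}^mB_i\right)$.
   Context: **General notation.** $\mathcal{H}$ is a real Hilbert space; $\mathcal{H}^p$ carries the product Hilbert structure. $\mathbb{N}=\{0,1,2,\dots\}$, $\mathbb{N}_+=\{1,2,\dots\}$; $n\in\mathbb{N}_+$, $m\in\mathbb{N}$ (if $m=0$, all terms involving $B_j$, $C$, $Q$, $\mathbf{u}^k$ are absent). An operator $B:\mathcal{H}\to\mathcal{H}$ is $\frac1\beta$-cocoercive ($\beta>0$) if $\langle B(x)-B(y),x-y\rangle\ge\frac1\beta\|B(x)-B(y)\|^2$ for all $x,y$. For a set-valued operator $F$, $\operatorname{zer}F=\{x:0\in F(x)\}$; for $\lambda>0$, $J_{\lambda F}=(\mathrm{Id}+\lambda F)^{-1}$ is the resolvent. $\operatorname{Fix}T$ is the set of fixed points of $T$. For a real matrix $P\in\mathbb{R}^{p\times q}$, the bold letter $\mathbf{P}=P\otimes\mathrm{Id}$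 denotes the bounded linear operator $\mathcal{H}^q\to\mathcal{H}^p$, $(\mathbf{P}\mathbf{x})_i=\sum_{j}P_{ij}x_j$, and $\mathbf{P}^*=P^\top\otimes\mathrm{Id}$ is its adjoint. $\succeq0$ means positive semidefinite. $e_p=(1,\dots,1)^\top\in\mathbb{R}^p$. $L=\operatorname{diag}(\frac1{L_1},\dots,\frac1{L_m})$, so $L^{-1}=\operatorname{diag}(L_1,\dots,L_m)$ and $\|\mathbf{u}\|_{\mathbf{L}^{-1}}^2=\sum_{i=1}^mL_i\|u_i\|^2$. $\mathbf{F}(\mathbf{x})=(F_1(x_1),\dots,F_n(x_n))$ (product of sets) for $\mathbf{x}\in\mathcal{H}^n$, and $\mathbf{B}(\mathbf{y})=(B_1(y_1),\dots,B_m(y_m))$ for $\mathbf{y}\in\mathcal{H}^m$. **Causal pair.** An $(m,n)$-nondecreasing vector is $A=(A_1,\dots,A_n)\in\{0,1,\dots,m\}^n$ with $A_1=0$, $A_n=m$ and $A_i\le A_{i+1}$ for $i=1,\dots,n-1$. A pair $C,Q^\top\in\mathbb{R}^{n\times m}$ is causal if there is an $(m,n)$-nondecreasing vector $A$ such that $C_{ij}=0$ for all $i$ and all $j>A_i$, and $(Q^\top)_{ij}=0$ for all $i$ and all $j\le A_i$. **Parameter conditions.** With $\epsilon>0$ a fixed sufficiently small constant, for all $k\in\mathbb{N}$: (i) $\theta\in(0,+\infty)$; (ii) $\epsilon\le\gamma_k\le1-\epsilon$; (iii) $0\le\xi_k\le1-\epsilon$. **Matrix conditions.** $M\in\mathbb{R}^{n\times(n-1)}$,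 $S\in\mathbb{R}^{n\times n}$, $C\in\mathbb{R}^{n\times m}$, $Q\in\mathbb{R}^{m\times n}$ satisfy: (a) $\ker M^\top\subseteq\mathbb{R}e_n$; (b) $C,Q^\top$ are causal and $C^\top e_n=Qe_n=e_m$; (c) $S$ is symmetric with $e_n^\top Se_n=0$ and $S-MM^\top-\frac12\left(1+\frac1\theta\right)(C^\top-Q)^\top L^{-1}(C^\top-Q)\succeq0$. **Stepsizes.** $d_i=2/S_{ii}$, $i=1,\dots,n$ (this notation presupposes that the diagonal entries of $S$ are nonzero). **Deviation algorithm.** Start from any $\mathbf{z}^0=(z_1^0,\dots,z_{n-1}^0)\in\mathcal{H}^{n-1}$, with $\mathbf{u}^0=0\in\mathcal{H}^m$ and $\mathbf{v}^0=0\in\mathcal{H}^{n-1}$. For $k=0,1,2,\dots$: compute successively for $i=1,\dots,n$ $$x_i^k=J_{d_iF_i}\left(-d_i\sum_{j=1}^{i-1}S_{ij}x_j^k+d_i\sum_{j=1}^{n-1}M_{ij}(z_j^k+v_j^k)-d_i\sum_{j=1}^mC_{ij}B_j\left(\sum_{h=1}^{i-1}Q_{jh}x_h^k+u_j^k\right)\right);$$ then set $z_j^{k+1}=z_j^k-\gamma_k\sum_{i=1}^nM_{ij}x_i^k$ for $j=1,\dots,n-1$; then choose $\mathbf{u}^{k+1}\in\mathcal{H}^m$ and $\mathbf{v}^{k+1}\in\mathcal{H}^{n-1}$ satisfying the deviation inequality displayed in the claim. Here $\mathbf{x}^k=(x_1^k,\dots,x_n^k)$, $\mathbf{z}^k=(z_1^k,\dots,z_{n-1}^k)$.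 **Operator $T$.** Let $N=-\operatorname{slt}(S)$, where $\operatorname{slt}(S)$ is the strictly lower triangular part of $S$, and $D=\operatorname{diag}(d_1,\dots,d_n)$. For a fixed constant $\gamma\in(0,1)$, $T:\mathcal{H}^{n-1}\to\mathcal{H}^{n-1}$ is $$T(\mathbf{z})=\mathbf{z}-\gamma\mathbf{M}^*\mathbf{x},\qquad\text{where }\mathbf{x}=J_{\mathbf{D}\mathbf{F}}\left(\mathbf{D}\mathbf{N}\mathbf{x}+\mathbf{D}\mathbf{M}\mathbf{z}-\mathbf{D}\mathbf{C}\mathbf{B}(\mathbf{Q}\mathbf{x})\right),$$ with $J_{\mathbf{D}\mathbf{F}}=(J_{d_1F_1},\dots,J_{d_nF_n})$ acting componentwise; $\mathbf{x}$ is determined by $\mathbf{z}$ by forward substitution, since $N$ and $\mathbf{C}\mathbf{B}(\mathbf{Q}\,\cdot)$ are strictly lower triangular. *)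

theory Defs
  imports
    "HOL-Analysis.Inner_Product"
    "HOL-Library.Set_Algebras"
    "Jordan_Normal_Form.Matrix_Kernel"
begin

text \<open>
  Conventions. The Hilbert space is a type \<open>'h\<close> of sort \<open>{real_inner, complete_space}\<close>; the product
  space of \<open>p\<close> copies of it is \<open>carrier_vec p :: 'h vec set\<close>. All indices are shifted to start from
  \<open>0\<close>: components run over \<open>i < n\<close>, \<open>j < m\<close> and so on. A set-valued operator has type
  \<open>'h \<Rightarrow> 'h set\<close>.
\<close>

section \<open>Operators on a Hilbert space\<close>

definition monotone_operator :: "('h::real_inner \<Rightarrow> 'h set) \<Rightarrow> bool" where
  "monotone_operator F \<longleftrightarrow>
     (\<forall>x y. \<forall>a\<in>F x. \<forall>b\<in>F y. 0 \<le> inner (a - b) (x - y))"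

definition maximally_monotone :: "('h::real_inner \<Rightarrow> 'h set) \<Rightarrow> bool" where
  "maximally_monotone F \<longleftrightarrow> monotone_operator F \<and>
     (\<forall>G. monotone_operator G \<and> (\<forall>x. F x \<subseteq> G x) \<longrightarrow> G = F)"

definition cocoercive :: "real \<Rightarrow> ('h::real_inner \<Rightarrow> 'h) \<Rightarrow> bool" where
  "cocoercive c B \<longleftrightarrow>
     (\<forall>x y. inner (B x - B y) (x - y) \<ge> c * (norm (B x - B y))\<^sup>2)"

definition zer :: "('h::real_vector \<Rightarrow> 'h set) \<Rightarrow> 'h set" where
  "zer F = {x. 0 \<in> F x}"

text \<open>The addition and the sums are those of sets (Minkowski), from \<open>Set_Algebras\<close>.\<close>

definition operator_sum ::
  "nat \<Rightarrow> (nat \<Rightarrow> 'h \<Rightarrow> 'h set) \<Rightarrow> nat \<Rightarrow> (nat \<Rightarrow> 'h \<Rightarrow> 'h) \<Rightarrow> 'h::real_vector \<Rightarrow> 'h set" where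
  "operator_sum n F m B x = (\<Sum>i<n. F i x) + (\<Sum>j<m. {B j x})"

text \<open>
  \<open>(Id + \<lambda> F)\<^sup>-\<^sup>1\<close> as a function: \<open>y\<close> is the point with \<open>x \<in> y + \<lambda> F y\<close>. For maximally monotone
  \<open>F\<close> and \<open>\<lambda> > 0\<close> this point exists and is unique for every \<open>x\<close> (Minty).
\<close>

definition resolvent :: "real \<Rightarrow> ('h::real_vector \<Rightarrow> 'h set) \<Rightarrow> 'h \<Rightarrow> 'h" where
  "resolvent lam F x = (THE y. x \<in> {y} + (\<lambda>a. lam *\<^sub>R a) ` F y)"

section \<open>Product Hilbert spaces\<close>

definition prod_inner :: "'h::real_inner vec \<Rightarrow> 'h vec \<Rightarrow> real" where
  "prod_inner x y = (\<Sum>i<dim_vec x. inner (x $ i) (y $ i))"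

definition prod_norm :: "'h::real_inner vec \<Rightarrow> real" where
  "prod_norm x = sqrt (prod_inner x x)"

definition weighted_norm_sq :: "(nat \<Rightarrow> real) \<Rightarrow> 'h::real_inner vec \<Rightarrow> real" where
  "weighted_norm_sq w u = (\<Sum>i<dim_vec u. w i * (norm (u $ i))\<^sup>2)"

definition scale_vec :: "real \<Rightarrow> 'h::real_vector vec \<Rightarrow> 'h vec" where
  "scale_vec c x = map_vec (\<lambda>a. c *\<^sub>R a) x"

text \<open>The bounded operator \<open>P \<otimes> Id\<close> given by a real matrix \<open>P\<close>.\<close>

definition lift_mat :: "real mat \<Rightarrow> 'h::real_vector vec \<Rightarrow> 'h vec" where
  "lift_mat P x = vec (dim_row P) (\<lambda>i. \<Sum>j<dim_col P. (P $$ (i, j)) *\<^sub>R (x $ j))"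

definition weakly_converges :: "nat \<Rightarrow> (nat \<Rightarrow> 'h::real_inner vec) \<Rightarrow> 'h vec \<Rightarrow> bool" where
  "weakly_converges p X a \<longleftrightarrow> a \<in> carrier_vec p \<and>
     (\<forall>y\<in>carrier_vec p. (\<lambda>k. prod_inner (X k) y) \<longlonglongrightarrow> prod_inner a y)"

definition fixed_points :: "nat \<Rightarrow> ('h vec \<Rightarrow> 'h vec) \<Rightarrow> 'h vec set" where
  "fixed_points p T = {z \<in> carrier_vec p. T z = z}"

section \<open>Conditions on the matrices\<close>

definition ones_vec :: "nat \<Rightarrow> real vec" where
  "ones_vec p = vec p (\<lambda>_. 1)"

definition pos_semidef :: "real mat \<Rightarrow> bool" where
  "pos_semidef A \<longleftrightarrow> square_mat A \<and> A\<^sup>T = A \<and>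
     (\<forall>w\<in>carrier_vec (dim_row A). 0 \<le> scalar_prod w (A *\<^sub>v w))"

definition nondecreasing_vector :: "nat \<Rightarrow> nat \<Rightarrow> (nat \<Rightarrow> nat) \<Rightarrow> bool" where
  "nondecreasing_vector m n A \<longleftrightarrow>
     (\<forall>i<n. A i \<le> m) \<and> A 0 = 0 \<and> A (n - 1) = m \<and> (\<forall>i. i + 1 < n \<longrightarrow> A i \<le> A (i + 1))"

text \<open>
  The values \<open>A i \<in> {0..m}\<close> count columns and are not shifted, so the first \<open>A i\<close> columns are the
  ones with (shifted) index \<open>j < A i\<close>.
\<close>

definition causal_pair :: "nat \<Rightarrow> nat \<Rightarrow> real mat \<Rightarrow> real mat \<Rightarrow> bool" where
  "causal_pair n m C R \<longleftrightarrow> C \<in> carrier_mat n m \<and> R \<in> carrier_mat n m \<and>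
     (\<exists>A. nondecreasing_vector m n A \<and>
        (\<forall>i<n. \<forall>j<m. A i \<le> j \<longrightarrow> C $$ (i, j) = 0) \<and>
        (\<forall>i<n. \<forall>j<m. j < A i \<longrightarrow> R $$ (i, j) = 0))"

definition matrix_conditions ::
  "nat \<Rightarrow> nat \<Rightarrow> real \<Rightarrow> (nat \<Rightarrow> real) \<Rightarrow> real mat \<Rightarrow> real mat \<Rightarrow> real mat \<Rightarrow> real mat \<Rightarrow> bool" where
  "matrix_conditions n m \<theta> L M S C Q \<longleftrightarrow>
     M \<in> carrier_mat n (n - 1) \<and> S \<in> carrier_mat n n \<and>
     C \<in> carrier_mat n m \<and> Q \<in> carrier_mat m n \<and>
     mat_kernel (M\<^sup>T) \<subseteq> {c \<cdot>\<^sub>v ones_vec n | c. True} \<and>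
     causal_pair n m C (Q\<^sup>T) \<and> C\<^sup>T *\<^sub>v ones_vec n = ones_vec m \<and> Q *\<^sub>v ones_vec n = ones_vec m \<and>
     S\<^sup>T = S \<and> scalar_prod (ones_vec n) (S *\<^sub>v ones_vec n) = 0 \<and>
     pos_semidef (S - M * M\<^sup>T
       - (1 / 2 * (1 + 1 / \<theta>)) \<cdot>\<^sub>m ((C\<^sup>T - Q)\<^sup>T * mat_diag m L * (C\<^sup>T - Q)))"

definition stepsize :: "real mat \<Rightarrow> nat \<Rightarrow> real" where
  "stepsize S i = 2 / S $$ (i, i)"

section \<open>The deviation algorithm and the operator \<open>T\<close>\<close>

text \<open>
  One run of the algorithm apart from the inequality restricting the choice of the deviations
  \<open>u (k + 1)\<close>, \<open>v (k + 1)\<close>. The right-hand side for \<open>x k $ i\<close> involves only \<open>x k $ j\<close> with \<open>j < i\<close>.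
\<close>

definition deviation_algorithm ::
  "nat \<Rightarrow> nat \<Rightarrow> (nat \<Rightarrow> 'h \<Rightarrow> 'h set) \<Rightarrow> (nat \<Rightarrow> 'h \<Rightarrow> 'h) \<Rightarrow>
   real mat \<Rightarrow> real mat \<Rightarrow> real mat \<Rightarrow> real mat \<Rightarrow> (nat \<Rightarrow> real) \<Rightarrow>
   (nat \<Rightarrow> 'h::real_inner vec) \<Rightarrow> (nat \<Rightarrow> 'h vec) \<Rightarrow> (nat \<Rightarrow> 'h vec) \<Rightarrow> (nat \<Rightarrow> 'h vec) \<Rightarrow> bool" where
  "deviation_algorithm n m F B M S C Q \<gamma> x z u v \<longleftrightarrow>
     (\<forall>k. x k \<in> carrier_vec n \<and> z k \<in> carrier_vec (n - 1) \<and>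
          u k \<in> carrier_vec m \<and> v k \<in> carrier_vec (n - 1)) \<and>
     u 0 = 0\<^sub>v m \<and> v 0 = 0\<^sub>v (n - 1) \<and>
     (\<forall>k. \<forall>i<n. x k $ i = resolvent (stepsize S i) (F i)
        (- (stepsize S i *\<^sub>R (\<Sum>j<i. (S $$ (i, j)) *\<^sub>R (x k $ j)))
         + stepsize S i *\<^sub>R (\<Sum>j<n - 1. (M $$ (i, j)) *\<^sub>R (z k $ j + v k $ j))
         - stepsize S i *\<^sub>R (\<Sum>j<m. (C $$ (i, j)) *\<^sub>R
             B j ((\<Sum>h<i. (Q $$ (j, h)) *\<^sub>R (x k $ h)) + u k $ j)))) \<and>
     (\<forall>k. \<forall>j<n - 1. z (Suc k) $ j = z k $ j - \<gamma> k *\<^sub>R (\<Sum>i<n. (M $$ (i, j)) *\<^sub>R (x k $ i)))"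

definition strict_lower :: "real mat \<Rightarrow> real mat" where
  "strict_lower S = mat (dim_row S) (dim_col S) (\<lambda>(i, j). if j < i then S $$ (i, j) else 0)"

definition diag_resolvent ::
  "(nat \<Rightarrow> real) \<Rightarrow> (nat \<Rightarrow> 'h \<Rightarrow> 'h set) \<Rightarrow> 'h::real_vector vec \<Rightarrow> 'h vec" where
  "diag_resolvent d F y = vec (dim_vec y) (\<lambda>i. resolvent (d i) (F i) (y $ i))"

definition diag_apply :: "(nat \<Rightarrow> 'h \<Rightarrow> 'h) \<Rightarrow> 'h vec \<Rightarrow> 'h vec" where
  "diag_apply B y = vec (dim_vec y) (\<lambda>j. B j (y $ j))"

text \<open>
  The vector \<open>x\<close> in the definition of \<open>T z\<close>. The equation is triangular for causal \<open>C\<close>, \<open>Q\<^sup>T\<close>, hence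
  has exactly one solution, obtained by forward substitution.
\<close>

definition T_inner ::
  "(nat \<Rightarrow> 'h \<Rightarrow> 'h set) \<Rightarrow> (nat \<Rightarrow> 'h \<Rightarrow> 'h) \<Rightarrow>
   real mat \<Rightarrow> real mat \<Rightarrow> real mat \<Rightarrow> real mat \<Rightarrow> 'h::real_vector vec \<Rightarrow> 'h vec" where
  "T_inner F B M S C Q z =
     (let n = dim_row S; D = mat_diag n (stepsize S); N = - strict_lower S in
      THE x. x \<in> carrier_vec n \<and>
        x = diag_resolvent (stepsize S) F
              (lift_mat D (lift_mat N x) + lift_mat D (lift_mat M z)
               - lift_mat D (lift_mat C (diag_apply B (lift_mat Q x)))))"

definition T_op ::
  "(nat \<Rightarrow> 'h \<Rightarrow> 'h set) \<Rightarrow> (nat \<Rightarrow> 'h \<Rightarrow> 'h) \<Rightarrow>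
   real mat \<Rightarrow> real mat \<Rightarrow> real mat \<Rightarrow> real mat \<Rightarrow> real \<Rightarrow> 'h::real_vector vec \<Rightarrow> 'h vec" where
  "T_op F B M S C Q g z = z - scale_vec g (lift_mat (M\<^sup>T) (T_inner F B M S C Q z))"

end

theory Submission
  imports Defs "HOL-Analysis.Convex" "HOL-Analysis.Elementary_Metric_Spaces"
    "HOL-Library.Diagonal_Subsequence"
begin

text \<open>
  One step of the algorithm says that the point \<open>x\<close> it produces solves the inclusions
  \<open>f\<^sub>i \<in> F\<^sub>i (x\<^sub>i)\<close> with \<open>f = M (z + v) - \<Lambda> x - C b\<close> and \<open>b = B (Q x + u)\<close>, where \<open>\<Lambda>\<close> consists of
  the part of \<open>S\<close> below the diagonal and half of the diagonal, so that \<open>\<Lambda> + \<Lambda>\<^sup>T = S\<close>. A fixed point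
  of \<open>T\<close> is a \<open>w\<close> for which the solution with \<open>u = v = 0\<close> satisfies \<open>M\<^sup>T x = 0\<close>, which by the
  kernel condition means that all components of \<open>x\<close> equal one point \<open>c\<close>. Such a \<open>w\<close> is called
  stationary below. Adding up the inclusions shows that \<open>c\<close> is a zero of the sum of the operators;
  conversely each zero \<open>c\<close> has such a \<open>w\<close>, because the range of \<open>M\<close> consists of all vectors whose
  components sum to zero.

  Comparing a step with a stationary point, monotonicity of the \<open>F\<^sub>i\<close>, cocoercivity of the \<open>B\<^sub>j\<close>
  and the positive semidefiniteness condition combine to the bound \<open>M_adj_bound\<close> on \<open>M\<^sup>T x\<close>, which
  amounts to \<open>fejer_step\<close>: the squared distance of \<open>z\<^sup>k\<close> to \<open>w\<close> falls by \<open>l\<^sub>k\<^sup>2\<close> up to an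
  error made by the deviations. Each error costs at most the fraction \<open>1 - \<epsilon>\<close> of the preceding
  decrease, so the \<open>l\<^sub>k\<^sup>2\<close> are summable, the deviations vanish and the distances converge. Then
  \<open>M\<^sup>T x\<^sup>k\<close> tends to zero, and so does each combination of the \<open>x\<^sub>i\<^sup>k\<close> whose coefficients sum to
  zero.

  The sequences are bounded, hence have weak cluster points. Every weak cluster point is stationary
  (\<open>weak_limit_stationary\<close>): in the sum of all monotonicity inequalities the products of two weakly
  convergent sequences add up to a null sequence, so the inequalities pass to the limit and
  maximality applies. Two stationary cluster points coincide because the distances to both
  converge (Opial's argument), which gives weak convergence of the whole sequences.

  Two facts about Hilbert spaces enter: Minty's theorem, without which a resolvent says nothing, and
  the weak sequential compactness of bounded sets. Both are derived from a single minimisation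
  lemma, \<open>convex_parabola_minimiser\<close>; for the second the intermediate step is the Riesz
  representation theorem.
\<close>

section \<open>Minimising a parabola over a convex set\<close>

lemma nonneg_of_nonneg_perturbation:
  fixes a b :: real
  assumes "\<And>t. 0 < t \<Longrightarrow> t \<le> 1 \<Longrightarrow> 0 \<le> t * a + t\<^sup>2 * b"
  shows "0 \<le> a"
proof -
  have "(\<lambda>k. a + inverse (real (Suc k)) * b) \<longlonglongrightarrow> a + 0 * b"
    by (intro tendsto_intros LIMSEQ_inverse_real_of_nat)
  moreover have "0 \<le> a + inverse (real (Suc k)) * b" for k
  proof -
    let ?t = "inverse (real (Suc k))"
    have t: "0 < ?t" "?t \<le> 1"
      by (auto simp: divide_simps)
    have "0 \<le> ?t * (a + ?t * b)"
      using assms[OF t] by (simp add: algebra_simps power2_eq_square)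
    then show ?thesis
      using t(1) zero_le_mult_iff by (metis less_le_not_le)
  qed
  ultimately show ?thesis
    using LIMSEQ_le_const by fastforce
qed

text \<open>
  The function \<open>s + \<parallel>c\<parallel>\<^sup>2\<close> need not attain its infimum \<open>I\<close> on \<open>K\<close>, since \<open>K\<close> may be neither closed nor
  bounded in the direction of \<open>s\<close>. But it is strongly convex in \<open>c\<close>, so the first components of a
  minimising sequence are Cauchy. Their limit \<open>y\<close> satisfies the first-order optimality condition,
  obtained by moving a little from the minimising sequence towards an arbitrary point of \<open>K\<close>.
\<close>

lemma convex_parabola_minimiser:
  fixes K :: "('h::{real_inner, complete_space} \<times> real) set"
  assumes "convex K" and "K \<noteq> {}" and lb: "\<And>c s. (c, s) \<in> K \<Longrightarrow> b \<le> s + inner c c"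
  obtains y where "y \<in> closure (fst ` K)"
    and "\<And>c s. (c, s) \<in> K \<Longrightarrow> b \<le> s + 2 * inner y c - inner y y"
proof -
  define \<psi> where "\<psi> q = snd q + inner (fst q) (fst q)" for q :: "'h \<times> real"
  define I where "I = Inf (\<psi> ` K)"
  have bdd: "bdd_below (\<psi> ` K)"
    using lb by (intro bdd_belowI[of _ b]) (auto simp: \<psi>_def)
  have I_le: "I \<le> \<psi> q" if "q \<in> K" for q
    unfolding I_def using that bdd by (intro cInf_lower) auto
  have b_le: "b \<le> I"
    unfolding I_def using \<open>K \<noteq> {}\<close> lb by (intro cInf_greatest) (auto simp: \<psi>_def)
  have "\<exists>q\<in>K. \<psi> q < I + inverse (real (Suc k))" for k
  proof -
    have "I < I + inverse (real (Suc k))" by simp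
    then show ?thesis
      using cInf_lessD[of "\<psi> ` K"] \<open>K \<noteq> {}\<close> unfolding I_def by blast
  qed
  then obtain q where qK: "\<And>k. q k \<in> K" and q: "\<And>k. \<psi> (q k) < I + inverse (real (Suc k))"
    by metis
  define c where "c k = fst (q k)" for k
  have conv: "(1 - t) *\<^sub>R p + t *\<^sub>R p' \<in> K" if "p \<in> K" "p' \<in> K" "0 \<le> t" "t \<le> 1" for p p' t
    using convexD[OF \<open>convex K\<close>, of p p' "1 - t" t] that by auto
  have gap: "(norm (c j - c k))\<^sup>2 \<le> 2 * inverse (real (Suc j)) + 2 * inverse (real (Suc k))" for j k
  proof -
    have "I \<le> \<psi> ((1 - 1/2) *\<^sub>R q j + (1/2) *\<^sub>R q k)"
      by (intro I_le conv qK) auto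
    also have "\<dots> = (\<psi> (q j) + \<psi> (q k)) / 2 - (norm (c j - c k))\<^sup>2 / 4"
      unfolding \<psi>_def c_def power2_norm_eq_inner
      by (simp add: inner_add_left inner_add_right inner_diff_left inner_diff_right inner_commute field_simps)
    finally show ?thesis using q[of j] q[of k] by argo
  qed
  have "Cauchy c"
  proof (rule metric_CauchyI)
    fix e :: real assume "0 < e"
    then obtain N where N: "inverse (real (Suc N)) < e\<^sup>2 / 4"
      using reals_Archimedean[of "e\<^sup>2 / 4"] by auto
    have inv: "inverse (real (Suc i)) \<le> inverse (real (Suc N))" if "N \<le> i" for i :: nat
      using that by (intro le_imp_inverse_le) auto
    have "dist (c j) (c k) < e" if "N \<le> j" "N \<le> k" for j k
    proof -
      have "(norm (c j - c k))\<^sup>2 < e\<^sup>2"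
        using gap[of j k] N inv[OF that(1)] inv[OF that(2)] by argo
      then show ?thesis
        unfolding dist_norm using \<open>0 < e\<close> by (intro power2_less_imp_less[of _ e]) auto
    qed
    then show "\<exists>N. \<forall>j\<ge>N. \<forall>k\<ge>N. dist (c j) (c k) < e" by blast
  qed
  then obtain y where y: "c \<longlonglongrightarrow> y"
    using Cauchy_convergent_iff convergent_def by blast
  have \<psi>q: "(\<lambda>k. \<psi> (q k)) \<longlonglongrightarrow> I"
  proof (rule tendsto_sandwich[where f = "\<lambda>_. I" and h = "\<lambda>k. I + inverse (real (Suc k))"])
    show "(\<lambda>k. I + inverse (real (Suc k))) \<longlonglongrightarrow> I"
      using tendsto_add[OF tendsto_const LIMSEQ_inverse_real_of_nat, of I] by simp
    show "\<forall>\<^sub>F k in sequentially. I \<le> \<psi> (q k)"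
      using I_le qK by auto
    show "\<forall>\<^sub>F k in sequentially. \<psi> (q k) \<le> I + inverse (real (Suc k))"
      using q less_imp_le by (auto intro!: always_eventually)
  qed simp
  have "b \<le> s' + 2 * inner y c' - inner y y" if cs: "(c', s') \<in> K" for c' s'
  proof -
    have step: "I \<le> \<psi> (q k) + t * (s' - \<psi> (q k) + inner (c k) (c k) + 2 * inner (c k) (c' - c k))
              + t\<^sup>2 * inner (c' - c k) (c' - c k)" if "0 < t" "t \<le> 1" for t k
    proof -
      have "I \<le> \<psi> ((1 - t) *\<^sub>R q k + t *\<^sub>R (c', s'))"
        using that qK cs by (intro I_le conv) auto
      also have "\<dots> = \<psi> (q k) + t * (s' - \<psi> (q k) + inner (c k) (c k) + 2 * inner (c k) (c' - c k))
              + t\<^sup>2 * inner (c' - c k) (c' - c k)"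
        unfolding \<psi>_def c_def
        by (simp add: inner_add_left inner_add_right inner_diff_left inner_diff_right inner_commute
            algebra_simps power2_eq_square)
      finally show ?thesis .
    qed
    have "0 \<le> t * (s' - I + inner y y + 2 * inner y (c' - y)) + t\<^sup>2 * inner (c' - y) (c' - y)"
      if t: "0 < t" "t \<le> 1" for t
    proof -
      have "(\<lambda>k. \<psi> (q k) + t * (s' - \<psi> (q k) + inner (c k) (c k) + 2 * inner (c k) (c' - c k))
              + t\<^sup>2 * inner (c' - c k) (c' - c k))
           \<longlonglongrightarrow> I + t * (s' - I + inner y y + 2 * inner y (c' - y)) + t\<^sup>2 * inner (c' - y) (c' - y)"
        by (intro tendsto_intros \<psi>q y)
      from LIMSEQ_le_const[OF this, of I] step[OF t] show ?thesis by auto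
    qed
    from nonneg_of_nonneg_perturbation[OF this]
    show ?thesis using b_le by (simp add: inner_diff_right)
  qed
  moreover have "y \<in> closure (fst ` K)"
    unfolding closure_sequential using y qK by (intro exI[of _ c]) (auto simp: c_def)
  ultimately show thesis using that by blast
qed

lemma real_multiples_bounded_below:
  fixes a b :: real
  assumes "\<And>t. b \<le> t * a"
  shows "a = 0"
proof (rule ccontr)
  assume "a \<noteq> 0"
  then show False
    using assms[of "(b - 1) / a"] by simp
qed

text \<open>
  Minimising \<open>\<parallel>x\<parallel>\<^sup>2 - 2 l(x)\<close> over \<open>D\<close>: the optimality condition bounds a multiple of
  \<open>\<langle>p, x\<rangle> - l(x)\<close> from below along the whole line through \<open>x\<close>, so this difference vanishes.
  With \<open>l = \<langle>y, _\<rangle>\<close> the point \<open>p\<close> is the orthogonal projection of \<open>y\<close> to \<open>D\<close>.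
\<close>

lemma riesz_on_closed_subspace:
  fixes D :: "'h::{real_inner, complete_space} set"
  assumes D: "Real_Vector_Spaces.subspace D" "closed D"
    and add: "\<And>x y. x \<in> D \<Longrightarrow> y \<in> D \<Longrightarrow> l (x + y) = l x + l y"
    and scale: "\<And>c x. x \<in> D \<Longrightarrow> l (c *\<^sub>R x) = c * l x"
    and bound: "\<And>x. x \<in> D \<Longrightarrow> \<bar>l x\<bar> \<le> k * norm x"
  obtains p where "p \<in> D" and "\<And>x. x \<in> D \<Longrightarrow> inner p x = l x"
proof -
  let ?K = "(\<lambda>x. (x, - 2 * l x)) ` D"
  have cv: "convex ?K"
  proof (rule convexI)
    fix x y and u v :: real assume xy: "x \<in> ?K" "y \<in> ?K" "0 \<le> u" "0 \<le> v" "u + v = 1"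
    then obtain x' y' where "x' \<in> D" "y' \<in> D" "x = (x', - 2 * l x')" "y = (y', - 2 * l y')"
      by auto
    then show "u *\<^sub>R x + v *\<^sub>R y \<in> ?K"
      using D(1) by (intro image_eqI[of _ _ "u *\<^sub>R x' + v *\<^sub>R y'"])
        (auto simp: add scale Real_Vector_Spaces.subspace_add Real_Vector_Spaces.subspace_scale algebra_simps)
  qed
  have ne: "?K \<noteq> {}" using D(1) Real_Vector_Spaces.subspace_0 by auto
  have lb: "- k\<^sup>2 \<le> s + inner c c" if "(c, s) \<in> ?K" for c s
  proof -
    have "0 \<le> (norm c - k)\<^sup>2" by simp
    moreover have "l c \<le> k * norm c" using that bound[of c] by auto
    ultimately show ?thesis
      using that by (auto simp: power2_eq_square dot_square_norm algebra_simps)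
  qed
  obtain p where p: "p \<in> closure (fst ` ?K)"
    and le: "\<And>c s. (c, s) \<in> ?K \<Longrightarrow> - k\<^sup>2 \<le> s + 2 * inner p c - inner p p"
    using convex_parabola_minimiser[OF cv ne lb] by blast
  have "p \<in> D" using p D(2) by (simp add: image_image)
  moreover have "inner p x = l x" if "x \<in> D" for x
  proof -
    have "(inner p p - k\<^sup>2) / 2 \<le> t * (inner p x - l x)" for t
    proof -
      have "(t *\<^sub>R x, - 2 * l (t *\<^sub>R x)) \<in> ?K"
        using that D(1) Real_Vector_Spaces.subspace_scale by blast
      from le[OF this] show ?thesis
        unfolding scale[OF that] inner_scaleR_right by argo
    qed
    from real_multiples_bounded_below[OF this] show ?thesis by simp
  qed
  ultimately show thesis using that by blast
qed

section \<open>Resolvents of maximally monotone operators\<close>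

text \<open>
  The heart of Minty's theorem: every monotone graph is monotonically related to some pair
  \<open>(y, - y)\<close>. With \<open>c = (a - b) / 2\<close> and \<open>s = \<langle>a, b\<rangle>\<close> the claim \<open>0 \<le> \<langle>a - y, b + y\<rangle>\<close> reads
  \<open>0 \<le> s + 2 \<langle>y, c\<rangle> - \<parallel>y\<parallel>\<^sup>2\<close>, which is what minimising \<open>s + \<parallel>c\<parallel>\<^sup>2\<close> over the convex hull of these
  pairs provides. The minimised function is nonnegative on the hull because monotonicity keeps
  \<open>\<langle>a, b\<rangle> \<le> s\<close> true under convex combinations, and \<open>\<langle>a, b\<rangle> + \<parallel>(a - b) / 2\<parallel>\<^sup>2 = \<parallel>(a + b) / 2\<parallel>\<^sup>2\<close>.
\<close>

lemma monotone_graph_related_point: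
  fixes G :: "('h::{real_inner, complete_space} \<times> 'h) set"
  assumes mono: "\<And>a b a' b'. (a, b) \<in> G \<Longrightarrow> (a', b') \<in> G \<Longrightarrow> 0 \<le> inner (a - a') (b - b')"
  obtains y where "\<And>a b. (a, b) \<in> G \<Longrightarrow> 0 \<le> inner (a - y) (b + y)"
proof (cases "G = {}")
  case False
  define V where "V = (\<lambda>(a, b). (a, b, inner a b)) ` G"
  define f :: "'h \<times> 'h \<times> real \<Rightarrow> 'h \<times> real" where "f = (\<lambda>(a, b, s). ((1/2) *\<^sub>R (a - b), s))"
  have "linear f"
    unfolding f_def by (rule linearI) (auto simp: algebra_simps)
  then have cv: "convex (f ` (convex hull V))"
    by (simp add: convex_linear_image)
  have ne: "f ` (convex hull V) \<noteq> {}"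
    using False hull_subset[where s = V] unfolding V_def by blast
  \<comment> \<open>For points of the graph, \<open>E\<close> is the monotonicity relation written with \<open>s\<close> for \<open>\<langle>a, b\<rangle>\<close>. It is
    symmetric and its sections are convex, so it extends to the hull in one argument after the
    other; on the diagonal it says \<open>\<langle>a, b\<rangle> \<le> s\<close>.\<close>
  define E where "E = (\<lambda>(a, b, s). {w :: 'h \<times> 'h \<times> real. 0 \<le> s + snd (snd w) - inner a (fst (snd w)) - inner (fst w) b})"
  have E_convex: "convex (E p)" for p :: "'h \<times> 'h \<times> real"
  proof -
    obtain a b s where p: "p = (a, b, s)" by (cases p) auto
    show ?thesis
    proof (rule convexI)
      fix w w' and u v :: real
      assume "w \<in> E p" "w' \<in> E p" "0 \<le> u" "0 \<le> v" "u + v = 1"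
      moreover obtain a1 b1 s1 a2 b2 s2 where w: "w = (a1, b1, s1)" "w' = (a2, b2, s2)"
        by (cases w; cases w') auto
      ultimately have "0 \<le> u * (s + s1 - inner a b1 - inner a1 b) + v * (s + s2 - inner a b2 - inner a2 b)"
        by (intro add_nonneg_nonneg mult_nonneg_nonneg) (auto simp: E_def p)
      also have "\<dots> = (u + v) * s + (u * s1 + v * s2) - inner a (u *\<^sub>R b1 + v *\<^sub>R b2) - inner (u *\<^sub>R a1 + v *\<^sub>R a2) b"
        by (simp add: algebra_simps inner_add_left inner_add_right)
      finally show "u *\<^sub>R w + v *\<^sub>R w' \<in> E p"
        using \<open>u + v = 1\<close> by (simp add: E_def p w)
    qed
  qed
  have E_sym: "p \<in> E q \<longleftrightarrow> q \<in> E p" for p q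
    by (auto simp: E_def algebra_simps split: prod.splits)
  have "V \<subseteq> E p" if "p \<in> V" for p
    using that mono by (fastforce simp: V_def E_def algebra_simps inner_diff_left inner_diff_right)
  then have "convex hull V \<subseteq> E p" if "p \<in> V" for p
    using that E_convex by (simp add: hull_minimal)
  then have "V \<subseteq> E p" if "p \<in> convex hull V" for p
    using that E_sym by blast
  then have E: "convex hull V \<subseteq> E p" if "p \<in> convex hull V" for p
    using that E_convex by (simp add: hull_minimal)
  have lb: "0 \<le> s + inner c c" if cs: "(c, s) \<in> f ` (convex hull V)" for c s
  proof -
    obtain a b where ab: "(a, b, s) \<in> convex hull V" and c: "c = (1/2) *\<^sub>R (a - b)"
      using cs by (auto simp: f_def)
    have "inner a b \<le> s" using E[OF ab] ab by (auto simp: E_def)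
    moreover have "0 \<le> inner (a + b) (a + b)" by simp
    then have "0 \<le> 4 * inner a b + inner (a - b) (a - b)"
      by (simp add: inner_add_left inner_add_right inner_diff_left inner_diff_right inner_commute)
    ultimately show ?thesis by (simp add: c)
  qed
  obtain y where y: "\<And>c s. (c, s) \<in> f ` (convex hull V) \<Longrightarrow> 0 \<le> s + 2 * inner y c - inner y y"
    using convex_parabola_minimiser[OF cv ne lb] by blast
  have "0 \<le> inner (a - y) (b + y)" if "(a, b) \<in> G" for a b
  proof -
    have "(a, b, inner a b) \<in> convex hull V"
      using that by (intro hull_inc) (auto simp: V_def)
    then have "((1/2) *\<^sub>R (a - b), inner a b) \<in> f ` (convex hull V)"
      by (force simp: f_def)
    from y[OF this] show ?thesis
      by (simp add: inner_add_left inner_add_right inner_diff_left inner_diff_right inner_commute field_simps)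
  qed
  then show thesis using that by blast
qed (use that in blast)

lemma maximally_monotone_monotoneD:
  "maximally_monotone F \<Longrightarrow> a \<in> F x \<Longrightarrow> b \<in> F y \<Longrightarrow> 0 \<le> inner (a - b) (x - y)"
  unfolding maximally_monotone_def monotone_operator_def by blast

text \<open>
  Otherwise adjoining \<open>(y, b)\<close> to the graph would give a larger monotone operator.
\<close>

lemma maximally_monotoneD:
  assumes F: "maximally_monotone F" and rel: "\<And>x a. a \<in> F x \<Longrightarrow> 0 \<le> inner (a - b) (x - y)"
  shows "b \<in> F y"
proof -
  define G where "G x = (if x = y then insert b (F x) else F x)" for x
  have *: "0 \<le> inner (b - a) (y - x)" if "a \<in> F x" for x a
    using rel[OF that] by (simp add: inner_diff_left inner_diff_right)
  have "monotone_operator G"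
    unfolding monotone_operator_def G_def
    using rel * maximally_monotone_monotoneD[OF F] by (auto split: if_splits)
  moreover have "\<forall>x. F x \<subseteq> G x" by (auto simp: G_def)
  ultimately have "G = F" using F unfolding maximally_monotone_def by blast
  then show ?thesis by (metis G_def insertI1)
qed

text \<open>
  Existence comes from a pair related to the graph of \<open>\<lambda> F - x\<close>, which lies in the graph by
  maximality; uniqueness from monotonicity.
\<close>

lemma minty:
  fixes F :: "'h::{real_inner, complete_space} \<Rightarrow> 'h set"
  assumes F: "maximally_monotone F" and lam: "0 < lam"
  shows "\<exists>!y. (1 / lam) *\<^sub>R (x - y) \<in> F y"
proof (rule ex_ex1I)
  define G where "G = {(a, lam *\<^sub>R b - x) | a b. b \<in> F a}"
  have "0 \<le> inner (a - a') (b - b')" if ab: "(a, b) \<in> G" "(a', b') \<in> G" for a b a' b'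
  proof -
    obtain c where "b = lam *\<^sub>R c - x" "c \<in> F a"
      using ab(1) by (auto simp: G_def)
    moreover obtain c' where "b' = lam *\<^sub>R c' - x" "c' \<in> F a'"
      using ab(2) by (auto simp: G_def)
    ultimately have c: "b = lam *\<^sub>R c - x" "b' = lam *\<^sub>R c' - x" "c \<in> F a" "c' \<in> F a'"
      by auto
    then have "0 \<le> lam * inner (c - c') (a - a')"
      using maximally_monotone_monotoneD[OF F] lam by simp
    also have "\<dots> = inner (a - a') (b - b')"
      by (simp add: c inner_diff_left inner_diff_right inner_commute algebra_simps)
    finally show ?thesis .
  qed
  then obtain y where y: "\<And>a b. (a, b) \<in> G \<Longrightarrow> 0 \<le> inner (a - y) (b + y)"
    by (metis (no_types, lifting) monotone_graph_related_point)
  have "0 \<le> inner (b - (1 / lam) *\<^sub>R (x - y)) (a - y)" if "b \<in> F a" for a b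
  proof -
    have "(a, lam *\<^sub>R b - x) \<in> G" using that by (auto simp: G_def)
    from y[OF this] have "0 \<le> inner (a - y) (lam *\<^sub>R b - x + y)" .
    also have "lam *\<^sub>R b - x + y = lam *\<^sub>R (b - (1 / lam) *\<^sub>R (x - y))"
      using lam by (simp add: algebra_simps)
    finally have "0 \<le> lam * inner (b - (1 / lam) *\<^sub>R (x - y)) (a - y)"
      by (simp add: inner_commute)
    then show ?thesis using lam by (simp add: zero_le_mult_iff)
  qed
  then have "(1 / lam) *\<^sub>R (x - y) \<in> F y"
    by (rule maximally_monotoneD[OF F])
  then show "\<exists>y. (1 / lam) *\<^sub>R (x - y) \<in> F y" ..
next
  fix y y' assume "(1 / lam) *\<^sub>R (x - y) \<in> F y" "(1 / lam) *\<^sub>R (x - y') \<in> F y'"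
  from maximally_monotone_monotoneD[OF F this]
  have "0 \<le> inner ((1 / lam) *\<^sub>R (y' - y)) (y - y')"
    by (simp flip: scaleR_diff_right)
  then have "0 \<le> - ((1 / lam) * inner (y - y') (y - y'))"
    by (simp add: inner_diff_left inner_diff_right inner_commute algebra_simps)
  then have "inner (y - y') (y - y') \<le> 0"
    using lam by (simp add: divide_simps split: if_splits)
  then have "y - y' = 0" by (metis inner_gt_zero_iff not_le)
  then show "y = y'" by simp
qed

lemma resolvent_eq_iff:
  fixes F :: "'h::{real_inner, complete_space} \<Rightarrow> 'h set"
  assumes F: "maximally_monotone F" and lam: "0 < lam"
  shows "resolvent lam F x = y \<longleftrightarrow> (1 / lam) *\<^sub>R (x - y) \<in> F y"
proof -
  have "x \<in> {y} + (\<lambda>a. lam *\<^sub>R a) ` F y \<longleftrightarrow> (1 / lam) *\<^sub>R (x - y) \<in> F y" for y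
  proof
    assume "x \<in> {y} + (\<lambda>a. lam *\<^sub>R a) ` F y"
    then show "(1 / lam) *\<^sub>R (x - y) \<in> F y" using lam by (auto elim!: set_plus_elim)
  next
    assume *: "(1 / lam) *\<^sub>R (x - y) \<in> F y"
    have "x = y + lam *\<^sub>R ((1 / lam) *\<^sub>R (x - y))" using lam by simp
    then show "x \<in> {y} + (\<lambda>a. lam *\<^sub>R a) ` F y"
      using * by (metis imageI set_plus_intro singletonI)
  qed
  then have "resolvent lam F x = (THE y. (1 / lam) *\<^sub>R (x - y) \<in> F y)"
    by (simp add: resolvent_def)
  then show ?thesis
    using minty[OF F lam, of x] by (metis (mono_tags, lifting) theI')
qed

section \<open>Weak convergence and null sequences in a Hilbert space\<close>

definition weakly_tendsto :: "(nat \<Rightarrow> 'h::real_inner) \<Rightarrow> 'h \<Rightarrow> bool" where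
  "weakly_tendsto X a \<longleftrightarrow> (\<forall>y. (\<lambda>k. inner (X k) y) \<longlonglongrightarrow> inner a y)"

text \<open>
  A diagonal subsequence \<open>Y\<close> makes \<open>\<langle>Y\<^sub>k, X\<^sub>j\<rangle>\<close> converge for every \<open>j\<close>. The directions \<open>y\<close> in which
  \<open>\<langle>Y\<^sub>k, y\<rangle>\<close> converges form a closed subspace \<open>D\<close> that contains all \<open>X\<^sub>j\<close>; a direction and its
  projection to \<open>D\<close> have the same inner products with the sequence, so \<open>D\<close> is everything. The
  limit functional is then represented by a point.
\<close>

lemma bounded_weakly_convergent_subsequence:
  fixes X :: "nat \<Rightarrow> 'h::{real_inner, complete_space}"
  assumes "Bseq X"
  shows "\<exists>r a. strict_mono (r :: nat \<Rightarrow> nat) \<and> weakly_tendsto (X \<circ> r) a"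
proof -
  obtain K where "0 < K" and K: "\<And>k. norm (X k) \<le> K"
    using assms by (auto simp: Bseq_def)
  interpret subseqs "\<lambda>j s. convergent (\<lambda>k. inner (X (s k)) (X j))"
  proof
    fix j and s :: "nat \<Rightarrow> nat"
    obtain r :: "nat \<Rightarrow> nat" where r: "strict_mono r" "monoseq (\<lambda>k. inner (X (s (r k))) (X j))"
      using seq_monosub[of "\<lambda>k. inner (X (s k)) (X j)"] by auto
    have "norm (inner (X (s (r k))) (X j)) \<le> K * K" for k
      using Cauchy_Schwarz_ineq2[of "X (s (r k))" "X j"] mult_mono[OF K[of "s (r k)"] K[of j]] \<open>0 < K\<close>
      by simp
    then have "Bseq (\<lambda>k. inner (X (s (r k))) (X j))" by (rule BseqI')
    then show "\<exists>r. strict_mono r \<and> convergent (\<lambda>k. inner (X ((s \<circ> r) k)) (X j))"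
      using r Bseq_monoseq_convergent by auto
  qed
  define Y where "Y = X \<circ> diagseq"
  define D where "D = {y. convergent (\<lambda>k. inner (Y k) y)}"
  have Y_bound: "norm (Y k) \<le> K" for k by (simp add: Y_def K)
  have Y_inner: "\<bar>inner (Y k) y\<bar> \<le> K * norm y" for k y
    using Cauchy_Schwarz_ineq2[of "Y k" y] mult_right_mono[OF Y_bound[of k] norm_ge_zero[of y]] by linarith
  have X_in_D: "X j \<in> D" for j
  proof -
    have "convergent (\<lambda>k. inner (X ((diagseq \<circ> (+) (Suc j)) k)) (X j))"
    proof (rule diagseq_holds)
      fix r s i
      assume "strict_mono (r :: nat \<Rightarrow> nat)" and "convergent (\<lambda>k. inner (X (s k)) (X i))"
      then show "convergent (\<lambda>k. inner (X ((s \<circ> r) k)) (X i))"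
        using convergent_subseq_convergent[of "\<lambda>k. inner (X (s k)) (X i)" r] by (simp add: o_def)
    qed
    then have "convergent (\<lambda>k. inner (Y (k + Suc j)) (X j))"
      by (simp add: Y_def o_def add.commute)
    then show ?thesis unfolding D_def mem_Collect_eq
      by (rule iffD1[OF convergent_ignore_initial_segment[where f = "\<lambda>k. inner (Y k) (X j)"]])
  qed
  have D_subspace: "Real_Vector_Spaces.subspace D"
    unfolding Real_Vector_Spaces.subspace_def D_def
    by (auto simp: inner_add_right intro: convergent_add convergent_mult convergent_const)
  have D_closed: "closed D"
  proof -
    have "y \<in> D" if y: "y \<in> closure D" for y
    proof -
      have "Cauchy (\<lambda>k. inner (Y k) y)"
      proof (rule metric_CauchyI)
        fix e :: real assume "0 < e"
        then have "0 < e / (4 * K)" using \<open>0 < K\<close> by simp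
        then obtain y' where "y' \<in> D" and y': "dist y' y < e / (4 * K)"
          using y closure_approachable by blast
        then have "Cauchy (\<lambda>k. inner (Y k) y')"
          by (simp add: D_def convergent_Cauchy)
        then obtain N where N: "\<And>j k. N \<le> j \<Longrightarrow> N \<le> k \<Longrightarrow> dist (inner (Y j) y') (inner (Y k) y') < e / 2"
          using metric_CauchyD[of "\<lambda>k. inner (Y k) y'" "e / 2"] \<open>0 < e\<close> by (auto simp del: dist_real_def)
        have near: "\<bar>inner (Y k) (y' - y)\<bar> < e / 4" for k
        proof -
          have "\<bar>inner (Y k) (y' - y)\<bar> \<le> K * norm (y' - y)" by (rule Y_inner)
          also have "\<dots> < K * (e / (4 * K))"
            using y' \<open>0 < K\<close> by (intro mult_strict_left_mono) (auto simp: dist_norm)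
          finally show ?thesis using \<open>0 < K\<close> by simp
        qed
        have "dist (inner (Y j) y) (inner (Y k) y) < e" if "N \<le> j" "N \<le> k" for j k
          using N[OF that] near[of j] near[of k] unfolding dist_real_def inner_diff_right by linarith
        then show "\<exists>N. \<forall>j\<ge>N. \<forall>k\<ge>N. dist (inner (Y j) y) (inner (Y k) y) < e" by blast
      qed
      then show ?thesis by (simp add: D_def Cauchy_convergent)
    qed
    then show ?thesis using closure_subset_eq by blast
  qed
  have "y \<in> D" for y
  proof -
    have "\<bar>inner y x\<bar> \<le> norm y * norm x" for x by (rule Cauchy_Schwarz_ineq2)
    then obtain d where "d \<in> D" and d: "\<And>x. x \<in> D \<Longrightarrow> inner d x = inner y x"
      using riesz_on_closed_subspace[OF D_subspace D_closed, of "inner y" "norm y"]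
      by (auto simp: inner_add_right)
    have "inner (Y k) y = inner (Y k) d" for k
      using d[OF X_in_D] by (simp add: Y_def inner_commute)
    then show ?thesis using \<open>d \<in> D\<close> by (simp add: D_def)
  qed
  then have lim: "(\<lambda>k. inner (Y k) y) \<longlonglongrightarrow> lim (\<lambda>k. inner (Y k) y)" for y
    by (simp add: D_def convergent_LIMSEQ_iff)
  have lim_bound: "\<bar>lim (\<lambda>k. inner (Y k) y)\<bar> \<le> K * norm y" for y
    by (rule LIMSEQ_le_const2[OF tendsto_rabs[OF lim]]) (use Y_inner in blast)
  have lim_add: "lim (\<lambda>k. inner (Y k) (x + y)) = lim (\<lambda>k. inner (Y k) x) + lim (\<lambda>k. inner (Y k) y)" for x y
    using tendsto_add[OF lim lim, of x y] by (intro limI) (simp add: inner_add_right)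
  have lim_scale: "lim (\<lambda>k. inner (Y k) (c *\<^sub>R x)) = c * lim (\<lambda>k. inner (Y k) x)" for c x
    using tendsto_mult_left[OF lim, of c x] by (intro limI) simp
  obtain a where "\<And>y. inner a y = lim (\<lambda>k. inner (Y k) y)"
    by (rule riesz_on_closed_subspace[OF Real_Vector_Spaces.subspace_UNIV closed_UNIV lim_add lim_scale lim_bound]) auto
  then have "weakly_tendsto Y a"
    using lim by (simp add: weakly_tendsto_def)
  then show ?thesis using subseq_diagseq unfolding Y_def by blast
qed

lemma weakly_tendsto_subseq:
  assumes "weakly_tendsto X a" and "strict_mono r"
  shows "weakly_tendsto (X \<circ> r) a"
  unfolding weakly_tendsto_def
proof
  fix y
  have "(\<lambda>k. inner (X k) y) \<longlonglongrightarrow> inner a y"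
    using assms(1) by (simp add: weakly_tendsto_def)
  from LIMSEQ_subseq_LIMSEQ[OF this assms(2)]
  show "(\<lambda>k. inner ((X \<circ> r) k) y) \<longlonglongrightarrow> inner a y"
    by (simp add: o_def)
qed

lemma Bseq_compose: "Bseq X \<Longrightarrow> Bseq (X \<circ> r)" for X :: "nat \<Rightarrow> 'a::real_normed_vector" and r :: "nat \<Rightarrow> nat"
  by (auto simp: Bseq_def)

lemma common_weakly_convergent_subsequence:
  fixes X :: "'i \<Rightarrow> nat \<Rightarrow> 'h::{real_inner, complete_space}"
  assumes "finite I" and "\<And>i. i \<in> I \<Longrightarrow> Bseq (X i)"
  shows "\<exists>r a. strict_mono (r :: nat \<Rightarrow> nat) \<and> (\<forall>i\<in>I. weakly_tendsto (X i \<circ> r) (a i))"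
  using assms
proof (induction I)
  case empty
  show ?case by (rule exI[of _ id]) (simp add: strict_mono_def)
next
  case (insert i I)
  then have "\<exists>r a. strict_mono (r :: nat \<Rightarrow> nat) \<and> (\<forall>i\<in>I. weakly_tendsto (X i \<circ> r) (a i))"
    by blast
  then obtain r a where r: "strict_mono (r :: nat \<Rightarrow> nat)" "\<And>j. j \<in> I \<Longrightarrow> weakly_tendsto (X j \<circ> r) (a j)"
    by blast
  obtain s b where s: "strict_mono (s :: nat \<Rightarrow> nat)" "weakly_tendsto (X i \<circ> r \<circ> s) b"
    using bounded_weakly_convergent_subsequence[OF Bseq_compose[of "X i" r]] insert.prems by auto
  have "weakly_tendsto (X j \<circ> (r \<circ> s)) ((a(i := b)) j)" if "j \<in> insert i I" for j
  proof (cases "j = i")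
    case True
    then show ?thesis using s(2) by (simp add: comp_assoc)
  next
    case False
    then show ?thesis using that weakly_tendsto_subseq[OF r(2) s(1), of j] by (simp add: comp_assoc)
  qed
  then show ?case
    by (intro exI[of _ "r \<circ> s"] exI[of _ "a(i := b)"] conjI ballI strict_mono_o r s)
qed

lemma weakly_tendsto_unique:
  assumes "weakly_tendsto X a" and "weakly_tendsto X b"
  shows "a = b"
proof -
  have "inner a (a - b) = inner b (a - b)"
    using assms LIMSEQ_unique[of "\<lambda>k. inner (X k) (a - b)"] unfolding weakly_tendsto_def by auto
  then have "inner (a - b) (a - b) = 0" by (simp add: inner_diff_left)
  then show ?thesis by simp
qed

lemma weakly_tendsto_subseq_criterion:
  assumes "\<And>r. strict_mono (r :: nat \<Rightarrow> nat) \<Longrightarrow> \<exists>s. strict_mono (s :: nat \<Rightarrow> nat) \<and> weakly_tendsto (X \<circ> r \<circ> s) a"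
  shows "weakly_tendsto X a"
  unfolding weakly_tendsto_def
proof (intro allI, rule ccontr)
  fix y assume "\<not> (\<lambda>k. inner (X k) y) \<longlonglongrightarrow> inner a y"
  then have "\<exists>e>0. \<exists>\<^sub>F k in sequentially. \<not> dist (inner (X k) y) (inner a y) < e"
    unfolding tendsto_iff not_all not_imp not_eventually .
  then obtain e where "0 < e" and "\<exists>\<^sub>F k in sequentially. \<not> dist (inner (X k) y) (inner a y) < e"
    by (elim exE conjE)
  then have inf: "infinite {k. \<not> dist (inner (X k) y) (inner a y) < e}"
    unfolding cofinite_eq_sequentially[symmetric] frequently_cofinite by blast
  define r where "r = enumerate {k. \<not> dist (inner (X k) y) (inner a y) < e}"
  have r: "strict_mono r" "\<And>k. \<not> dist (inner (X (r k)) y) (inner a y) < e"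
    using strict_mono_enumerate[OF inf] enumerate_in_set[OF inf] by (auto simp: r_def)
  obtain s where "weakly_tendsto (X \<circ> r \<circ> s) a" using assms[OF r(1)] by (elim exE conjE)
  then have "(\<lambda>k. inner (X (r (s k))) y) \<longlonglongrightarrow> inner a y"
    by (simp add: weakly_tendsto_def)
  then obtain k where "dist (inner (X (r (s k))) y) (inner a y) < e"
    using \<open>0 < e\<close> metric_LIMSEQ_D by blast
  then show False using r(2) by blast
qed

lemma weakly_tendsto_diff_null:
  assumes "weakly_tendsto X a" and "(\<lambda>k. Y k - X k) \<longlonglongrightarrow> 0"
  shows "weakly_tendsto Y a"
  unfolding weakly_tendsto_def
proof
  fix y
  have "(\<lambda>k. inner (X k) y) \<longlonglongrightarrow> inner a y" "(\<lambda>k. inner (Y k - X k) y) \<longlonglongrightarrow> inner 0 y"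
    using assms(1) tendsto_inner[OF assms(2) tendsto_const] unfolding weakly_tendsto_def by auto
  from tendsto_add[OF this]
  show "(\<lambda>k. inner (Y k) y) \<longlonglongrightarrow> inner a y"
    by (simp add: inner_diff_left)
qed

lemma tendsto_inner_bounded_null:
  assumes "Bseq X" and "Y \<longlonglongrightarrow> 0"
  shows "(\<lambda>k. inner (X k) (Y k)) \<longlonglongrightarrow> 0"
proof -
  obtain K where K: "\<And>k. norm (X k) \<le> K" using assms(1) by (auto simp: Bseq_def)
  have "norm (inner (X k) (Y k)) \<le> norm (Y k) * K" for k
    using Cauchy_Schwarz_ineq2[of "X k" "Y k"] mult_right_mono[OF K[of k] norm_ge_zero[of "Y k"]]
    unfolding real_norm_def by (simp add: mult.commute)
  then show ?thesis
    by (intro tendsto_0_le[OF assms(2), of _ K] always_eventually allI)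
qed

lemma weakly_tendsto_add:
  "weakly_tendsto X a \<Longrightarrow> weakly_tendsto Y b \<Longrightarrow> weakly_tendsto (\<lambda>k. X k + Y k) (a + b)"
  unfolding weakly_tendsto_def inner_add_left by (intro allI tendsto_add) simp_all

lemma weakly_tendsto_diff:
  "weakly_tendsto X a \<Longrightarrow> weakly_tendsto Y b \<Longrightarrow> weakly_tendsto (\<lambda>k. X k - Y k) (a - b)"
  unfolding weakly_tendsto_def inner_diff_left by (intro allI tendsto_diff) simp_all

lemma weakly_tendsto_scaleR:
  "weakly_tendsto X a \<Longrightarrow> weakly_tendsto (\<lambda>k. c *\<^sub>R X k) (c *\<^sub>R a)"
  unfolding weakly_tendsto_def inner_scaleR_left by (intro allI tendsto_mult_left) simp

lemma weakly_tendsto_sum: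
  "(\<And>i. i \<in> I \<Longrightarrow> weakly_tendsto (X i) (a i)) \<Longrightarrow> weakly_tendsto (\<lambda>k. \<Sum>i\<in>I. X i k) (\<Sum>i\<in>I. a i)"
  unfolding weakly_tendsto_def inner_sum_left by (intro allI tendsto_sum) simp

lemma tendsto_imp_weakly_tendsto: "X \<longlonglongrightarrow> a \<Longrightarrow> weakly_tendsto X a"
  unfolding weakly_tendsto_def by (intro allI tendsto_inner tendsto_const)

lemma weakly_tendstoD: "weakly_tendsto X a \<Longrightarrow> (\<lambda>k. inner (X k) y) \<longlonglongrightarrow> inner a y"
  by (simp add: weakly_tendsto_def)

lemma null_of_norm_sq_le:
  fixes X :: "nat \<Rightarrow> 'a::real_normed_vector"
  assumes "\<And>k. (norm (X k))\<^sup>2 \<le> K * a k" and "a \<longlonglongrightarrow> 0"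
  shows "X \<longlonglongrightarrow> 0"
proof -
  have "norm ((norm (X k))\<^sup>2) \<le> norm (a k) * \<bar>K\<bar>" for k
  proof -
    have "(norm (X k))\<^sup>2 \<le> \<bar>K * a k\<bar>" using assms(1)[of k] by linarith
    then show ?thesis by (simp add: abs_mult mult.commute)
  qed
  then have "(\<lambda>k. (norm (X k))\<^sup>2) \<longlonglongrightarrow> 0"
    by (intro tendsto_0_le[OF assms(2), of _ "\<bar>K\<bar>"] always_eventually allI)
  then have "(\<lambda>k. norm (X k)) \<longlonglongrightarrow> 0"
    using tendsto_real_sqrt by fastforce
  then show ?thesis by (rule tendsto_norm_zero_cancel)
qed

lemma Bseq_add_seq: "Bseq X \<Longrightarrow> Bseq Y \<Longrightarrow> Bseq (\<lambda>k. X k + Y k)" for X Y :: "nat \<Rightarrow> 'a::real_normed_vector"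
  unfolding Bseq_def
proof (elim exE conjE)
  fix K K' assume K: "0 < K" "\<forall>n. norm (X n) \<le> K" and K': "0 < K'" "\<forall>n. norm (Y n) \<le> K'"
  then have "\<forall>n. norm (X n + Y n) \<le> K + K'" by (blast intro: norm_triangle_mono)
  then show "\<exists>K>0. \<forall>n. norm (X n + Y n) \<le> K" using K(1) K'(1) by (intro exI[of _ "K + K'"]) simp
qed

lemma Bseq_of_tendsto: "X \<longlonglongrightarrow> a \<Longrightarrow> Bseq X" for X :: "nat \<Rightarrow> 'a::real_normed_vector"
  by (rule convergent_imp_Bseq[OF convergentI])

lemma Bseq_scaleR_const: "Bseq X \<Longrightarrow> Bseq (\<lambda>k. c *\<^sub>R X k)" for X :: "nat \<Rightarrow> 'a::real_normed_vector"
  unfolding Bseq_def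
proof (elim exE conjE)
  fix K assume "0 < K" "\<forall>n. norm (X n) \<le> K"
  then have "\<forall>n. norm (c *\<^sub>R X n) \<le> \<bar>c\<bar> * K + 1"
    by (auto intro: order_trans[OF mult_left_mono])
  moreover have "0 < \<bar>c\<bar> * K + 1" using \<open>0 < K\<close> by (simp add: add_nonneg_pos)
  ultimately show "\<exists>K>0. \<forall>n. norm (c *\<^sub>R X n) \<le> K" by blast
qed

lemma Bseq_sum: "finite I \<Longrightarrow> (\<And>i. i \<in> I \<Longrightarrow> Bseq (X i)) \<Longrightarrow> Bseq (\<lambda>k. \<Sum>i\<in>I. X i k)"
  for X :: "'i \<Rightarrow> nat \<Rightarrow> 'a::real_normed_vector"
proof (induction I rule: finite_induct)
  case empty
  then show ?case by (simp add: Bseq_of_tendsto[OF tendsto_const])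
next
  case (insert i I)
  then show ?case using Bseq_add_seq[of "X i" "\<lambda>k. \<Sum>i\<in>I. X i k"] by simp
qed

section \<open>Quadratic forms evaluated at vectors of a Hilbert space\<close>

text \<open>
  Completing the square in the last variable; what remains is the form of the Schur complement.
\<close>

lemma quadratic_form_schur_split:
  fixes P :: "nat \<Rightarrow> nat \<Rightarrow> real" and x :: "nat \<Rightarrow> 'a::real_inner"
  assumes sym: "\<And>i. i < n \<Longrightarrow> P n i = P i n" and "P n n \<noteq> 0"
  shows "(\<Sum>i<Suc n. \<Sum>j<Suc n. P i j * inner (x i) (x j)) =
      (\<Sum>i<n. \<Sum>j<n. (P i j - P i n * P j n / P n n) * inner (x i) (x j))
      + P n n * (norm (x n + (1 / P n n) *\<^sub>R (\<Sum>i<n. P i n *\<^sub>R x i)))\<^sup>2"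
proof -
  let ?y = "\<Sum>i<n. P i n *\<^sub>R x i"
  have y: "inner (x n) ?y = (\<Sum>i<n. P i n * inner (x i) (x n))"
    "(\<Sum>i<n. P n i * inner (x n) (x i)) = (\<Sum>i<n. P i n * inner (x i) (x n))"
    by (simp_all add: inner_sum_right inner_commute sym)
  have yy: "inner ?y ?y = (\<Sum>i<n. \<Sum>j<n. P i n * P j n * inner (x i) (x j))"
    by (subst inner_sum_left) (simp add: inner_sum_right sum_distrib_left mult_ac)
  have sq: "P n n * (norm (x n + (1 / P n n) *\<^sub>R ?y))\<^sup>2
      = P n n * inner (x n) (x n) + 2 * inner (x n) ?y + inner ?y ?y / P n n"
    using \<open>P n n \<noteq> 0\<close> unfolding power2_norm_eq_inner
    by (simp add: inner_add_left inner_add_right inner_commute field_simps power2_eq_square)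
  have split: "(\<Sum>i<n. \<Sum>j<n. (P i j - P i n * P j n / P n n) * inner (x i) (x j))
      = (\<Sum>i<n. \<Sum>j<n. P i j * inner (x i) (x j))
        - (\<Sum>i<n. \<Sum>j<n. P i n * P j n * inner (x i) (x j)) / P n n"
    by (simp only: left_diff_distrib sum_subtractf sum_divide_distrib times_divide_eq_left)
  show ?thesis
    unfolding sq yy y(1) split by (simp add: sum.distrib y(2))
qed

lemma form_at_unit_vectors:
  fixes P :: "nat \<Rightarrow> nat \<Rightarrow> real"
  assumes "i < n" and "j < n"
  shows "(\<Sum>a<n. \<Sum>b<n. P a b * ((if a = i then s else 0) * (if b = j then t else 0))) = P i j * s * t"
proof -
  have "(\<Sum>b<n. P a b * ((if a = i then s else 0) * (if b = j then t else 0)))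
      = (if a = i then P i j * s * t else 0)" for a
  proof -
    have "(\<Sum>b<n. P a b * ((if a = i then s else 0) * (if b = j then t else 0)))
        = (\<Sum>b<n. if b = j then (if a = i then P i j * s * t else 0) else 0)"
      by (intro sum.cong refl) auto
    also have "\<dots> = (if a = i then P i j * s * t else 0)"
      using \<open>j < n\<close> by (subst sum.delta) auto
    finally show ?thesis .
  qed
  then show ?thesis using \<open>i < n\<close> by simp
qed

text \<open>
  Positive semidefiniteness is assumed for real vectors only and is needed for vectors of Hilbert
  space elements. The induction splits off the last variable: if its diagonal entry is positive, the
  Schur complement is again positive semidefinite; if it is zero, the whole last row is zero.
\<close>

lemma psd_form_inner_nonneg:
  fixes P :: "nat \<Rightarrow> nat \<Rightarrow> real" and x :: "nat \<Rightarrow> 'a::real_inner"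
  assumes "\<And>i j. i < n \<Longrightarrow> j < n \<Longrightarrow> P i j = P j i"
    and "\<And>w :: nat \<Rightarrow> real. 0 \<le> (\<Sum>i<n. \<Sum>j<n. P i j * (w i * w j))"
  shows "0 \<le> (\<Sum>i<n. \<Sum>j<n. P i j * inner (x i) (x j))"
  using assms
proof (induction n arbitrary: P)
  case (Suc n)
  note sym = Suc.prems(1) and psd = Suc.prems(2)
  have nn: "0 \<le> P n n"
    using psd[of "\<lambda>i. if i = n then 1 else 0"] form_at_unit_vectors[of n "Suc n" n P 1 1] by simp
  show ?case
  proof (cases "P n n = 0")
    case True
    have "P i n = 0" if "i < n" for i
    proof -
      have "- P i i / 2 \<le> s * P i n" for s
      proof -
        have i: "i < Suc n" "n < Suc n" using that by auto
        let ?d = "\<lambda>k t a. if a = k then t else (0 :: real)"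
        have "0 \<le> (\<Sum>a<Suc n. \<Sum>b<Suc n. P a b * ((?d i 1 a + ?d n s a) * (?d i 1 b + ?d n s b)))"
          by (rule psd)
        also have "\<dots> = (\<Sum>a<Suc n. \<Sum>b<Suc n. P a b * (?d i 1 a * ?d i 1 b))
            + (\<Sum>a<Suc n. \<Sum>b<Suc n. P a b * (?d i 1 a * ?d n s b))
            + (\<Sum>a<Suc n. \<Sum>b<Suc n. P a b * (?d n s a * ?d i 1 b))
            + (\<Sum>a<Suc n. \<Sum>b<Suc n. P a b * (?d n s a * ?d n s b))"
          unfolding sum.distrib[symmetric] by (intro sum.cong refl) (simp only: algebra_simps)
        also have "\<dots> = P i i + P i n * s + P n i * s + P n n * s * s"
          unfolding form_at_unit_vectors[OF i(1) i(1)] form_at_unit_vectors[OF i(1) i(2)]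
            form_at_unit_vectors[OF i(2) i(1)] form_at_unit_vectors[OF i(2) i(2)] by simp
        finally show ?thesis using True sym[of n i] that by simp
      qed
      from real_multiples_bounded_below[OF this] show ?thesis .
    qed
    then have z: "P i n = 0" "P n i = 0" if "i < n" for i
      using sym[of n i] that by auto
    have "0 \<le> (\<Sum>i<n. \<Sum>j<n. P i j * inner (x i) (x j))"
    proof (rule Suc.IH)
      fix w :: "nat \<Rightarrow> real"
      show "0 \<le> (\<Sum>i<n. \<Sum>j<n. P i j * (w i * w j))"
        using psd[of w] by (simp add: z True sum.distrib)
    qed (use sym in auto)
    then show ?thesis by (simp add: z True sum.distrib)
  next
    case False
    then have pos: "0 < P n n" using nn by simp
    have sym': "P n i = P i n" if "i < n" for i using sym[of n i] that by simp
    have "0 \<le> (\<Sum>i<n. \<Sum>j<n. (P i j - P i n * P j n / P n n) * inner (x i) (x j))"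
    proof (rule Suc.IH)
      fix w :: "nat \<Rightarrow> real"
      \<comment> \<open>The last component that makes the completed square vanish.\<close>
      define w' where "w' = w(n := - (\<Sum>i<n. P i n * w i) / P n n)"
      have "0 \<le> (\<Sum>i<Suc n. \<Sum>j<Suc n. P i j * inner (w' i) (w' j))"
        using psd[of w'] by simp
      also have "\<dots> = (\<Sum>i<n. \<Sum>j<n. (P i j - P i n * P j n / P n n) * inner (w' i) (w' j))
          + P n n * (norm (w' n + (1 / P n n) *\<^sub>R (\<Sum>i<n. P i n *\<^sub>R w' i)))\<^sup>2"
        by (rule quadratic_form_schur_split[of n P, OF sym' False])
      also have "w' n + (1 / P n n) *\<^sub>R (\<Sum>i<n. P i n *\<^sub>R w' i) = 0"
        by (simp add: w'_def)
      also have "(\<Sum>i<n. \<Sum>j<n. (P i j - P i n * P j n / P n n) * inner (w' i) (w' j))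
          = (\<Sum>i<n. \<Sum>j<n. (P i j - P i n * P j n / P n n) * (w i * w j))"
        by (intro sum.cong) (auto simp: w'_def)
      finally show "0 \<le> (\<Sum>i<n. \<Sum>j<n. (P i j - P i n * P j n / P n n) * (w i * w j))"
        by simp
    qed (use sym in \<open>auto simp: mult.commute\<close>)
    then show ?thesis
      using pos by (subst quadratic_form_schur_split[of n P, OF sym' False]) simp_all
  qed
qed simp

lemma sum_weighted_norm_sq_eq_form:
  fixes x :: "nat \<Rightarrow> 'a::real_inner" and N :: "nat \<Rightarrow> nat \<Rightarrow> real"
  shows "(\<Sum>j<q. a j * (norm (\<Sum>i<n. N i j *\<^sub>R x i))\<^sup>2) =
    (\<Sum>i<n. \<Sum>h<n. (\<Sum>j<q. a j * (N i j * N h j)) * inner (x i) (x h))"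
proof -
  have "(norm (\<Sum>i<n. N i j *\<^sub>R x i))\<^sup>2 = (\<Sum>i<n. \<Sum>h<n. N i j * N h j * inner (x i) (x h))" for j
    unfolding power2_norm_eq_inner
    by (subst inner_sum_left) (simp add: inner_sum_right sum_distrib_left mult_ac)
  then have "(\<Sum>j<q. a j * (norm (\<Sum>i<n. N i j *\<^sub>R x i))\<^sup>2)
      = (\<Sum>j<q. \<Sum>i<n. \<Sum>h<n. a j * (N i j * N h j) * inner (x i) (x h))"
    by (simp add: sum_distrib_left mult.assoc)
  also have "\<dots> = (\<Sum>i<n. \<Sum>h<n. \<Sum>j<q. a j * (N i j * N h j) * inner (x i) (x h))"
    by (rule trans[OF sum.swap]) (rule sum.cong[OF refl], rule sum.swap)
  finally show ?thesis by (simp add: sum_distrib_right)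
qed

lemma psd_bound_lift:
  fixes x :: "nat \<Rightarrow> 'a::real_inner" and S M K :: "nat \<Rightarrow> nat \<Rightarrow> real"
  assumes sym: "\<And>i j. i < n \<Longrightarrow> j < n \<Longrightarrow> S i j = S j i"
    and bound: "\<And>w :: nat \<Rightarrow> real. (\<Sum>j<p. (\<Sum>i<n. M i j * w i)\<^sup>2) + (\<Sum>j<q. a j * (\<Sum>i<n. K i j * w i)\<^sup>2)
      \<le> (\<Sum>i<n. \<Sum>j<n. S i j * (w i * w j))"
  shows "(\<Sum>j<p. (norm (\<Sum>i<n. M i j *\<^sub>R x i))\<^sup>2) + (\<Sum>j<q. a j * (norm (\<Sum>i<n. K i j *\<^sub>R x i))\<^sup>2)
      \<le> (\<Sum>i<n. \<Sum>j<n. S i j * inner (x i) (x j))"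
proof -
  define P where "P i h = S i h - (\<Sum>j<p. 1 * (M i j * M h j)) - (\<Sum>j<q. a j * (K i j * K h j))" for i h
  have P: "(\<Sum>i<n. \<Sum>j<n. P i j * inner (y i) (y j)) = (\<Sum>i<n. \<Sum>j<n. S i j * inner (y i) (y j))
      - (\<Sum>j<p. 1 * (norm (\<Sum>i<n. M i j *\<^sub>R y i))\<^sup>2) - (\<Sum>j<q. a j * (norm (\<Sum>i<n. K i j *\<^sub>R y i))\<^sup>2)"
    for y :: "nat \<Rightarrow> 'b::real_inner"
    unfolding sum_weighted_norm_sq_eq_form P_def left_diff_distrib sum_subtractf ..
  have "0 \<le> (\<Sum>i<n. \<Sum>j<n. P i j * inner (x i) (x j))"
  proof (rule psd_form_inner_nonneg)
    fix w :: "nat \<Rightarrow> real"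
    show "0 \<le> (\<Sum>i<n. \<Sum>j<n. P i j * (w i * w j))"
      using P[of w] bound[of w] by simp
  qed (simp add: P_def sym mult.commute)
  then show ?thesis using P[of x] by simp
qed

text \<open>
  For a symmetric matrix the strictly lower triangle together with half of the diagonal carries half
  of the total.
\<close>

lemma sum_lower_triangle_symmetric:
  fixes f :: "nat \<Rightarrow> nat \<Rightarrow> real"
  assumes "\<And>i j. i < n \<Longrightarrow> j < n \<Longrightarrow> f i j = f j i"
  shows "(\<Sum>i<n. (\<Sum>j<i. f i j) + f i i / 2) = (\<Sum>i<n. \<Sum>j<n. f i j) / 2"
  using assms
proof (induction n)
  case (Suc n)
  have "(\<Sum>i<n. f i n) = (\<Sum>i<n. f n i)"
    using Suc.prems by (intro sum.cong) auto
  then show ?case using Suc by (simp add: sum.distrib field_simps)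
qed simp

text \<open>
  This is the expanded form of \<open>0 \<le> \<parallel>a + \<theta> b\<parallel>\<^sup>2 / \<theta>\<close>.
\<close>

lemma norm_sq_diff_le_weighted:
  fixes a b :: "'a::real_inner"
  assumes "0 < \<theta>"
  shows "(norm (a - b))\<^sup>2 \<le> (1 + 1 / \<theta>) * (norm a)\<^sup>2 + (1 + \<theta>) * (norm b)\<^sup>2"
proof -
  have "0 \<le> (1 / \<theta>) * (norm (a + \<theta> *\<^sub>R b))\<^sup>2" using assms by simp
  also have "\<dots> = (1 / \<theta>) * (norm a)\<^sup>2 + 2 * inner a b + \<theta> * (norm b)\<^sup>2"
    using assms unfolding power2_norm_eq_inner
    by (simp add: inner_add_left inner_add_right inner_commute field_simps power2_eq_square)
  finally show ?thesis
    unfolding power2_norm_eq_inner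
    by (simp add: inner_diff_left inner_diff_right inner_commute algebra_simps)
qed

lemma inner_ge_neg_weighted_norm_sq:
  fixes a b :: "'a::real_inner"
  assumes "0 < c"
  shows "- inner a b \<le> (1 / c) * (norm a)\<^sup>2 + (c / 4) * (norm b)\<^sup>2"
proof -
  have "0 \<le> (1 / c) * (norm (a + (c / 2) *\<^sub>R b))\<^sup>2" using assms by simp
  also have "\<dots> = (1 / c) * (norm a)\<^sup>2 + inner a b + (c / 4) * (norm b)\<^sup>2"
    using assms unfolding power2_norm_eq_inner
    by (simp add: inner_add_left inner_add_right inner_commute field_simps power2_eq_square)
  finally show ?thesis by simp
qed

section \<open>Matrices whose adjoint has the constants as kernel\<close>

text \<open>
  The range of \<open>M\<close> is the orthogonal complement of the constants, made explicit by a right inverse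
  for the projection \<open>I - e e\<^sup>T / n\<close>. The matrix \<open>G = M M\<^sup>T + e e\<^sup>T\<close> is nonsingular, because
  \<open>w\<^sup>T G w\<close> is a sum of squares that vanishes only if \<open>w\<close> is constant with sum zero. If \<open>W\<close> is its
  inverse, then \<open>R = M\<^sup>T W\<close> works: multiplying \<open>G W = I\<close> by \<open>e\<^sup>T\<close> shows \<open>e\<^sup>T W = e\<^sup>T / n\<close>.
\<close>

lemma ones_complement_right_inverse:
  fixes M :: "nat \<Rightarrow> nat \<Rightarrow> real"
  assumes "0 < n"
    and ker: "\<And>w :: nat \<Rightarrow> real. (\<And>j. j < p \<Longrightarrow> (\<Sum>i<n. M i j * w i) = 0) \<Longrightarrow> \<exists>c. \<forall>i<n. w i = c"
    and col: "\<And>j. j < p \<Longrightarrow> (\<Sum>i<n. M i j) = 0"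
  obtains R where "\<And>i h. i < n \<Longrightarrow> h < n \<Longrightarrow>
      (\<Sum>j<p. M i j * R j h) = (if i = h then 1 else 0) - 1 / real n"
proof -
  define G where "G = Matrix.mat n n (\<lambda>(i, h). (\<Sum>j<p. M i j * M h j) + 1)"
  have G: "G \<in> carrier_mat n n" by (simp add: G_def)
  have "det G \<noteq> 0"
  proof
    assume "det G = 0"
    then obtain y where y: "y \<in> carrier_vec n" "y \<noteq> 0\<^sub>v n" "G *\<^sub>v y = 0\<^sub>v n"
      using det_0_iff_vec_prod_zero_field[OF G] by blast
    define w where "w i = y $ i" for i
    have row: "(\<Sum>h<n. ((\<Sum>j<p. M i j * M h j) + 1) * w h) = 0" if "i < n" for i
    proof -
      have "(G *\<^sub>v y) $ i = (\<Sum>h<n. ((\<Sum>j<p. M i j * M h j) + 1) * w h)"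
        using that y(1) by (simp add: G_def w_def scalar_prod_def lessThan_atLeast0)
      then show ?thesis using y(3) that by simp
    qed
    have "(\<Sum>j<p. (\<Sum>i<n. M i j * w i)\<^sup>2) + (\<Sum>i<n. w i)\<^sup>2
        = (\<Sum>i<n. \<Sum>h<n. ((\<Sum>j<p. 1 * (M i j * M h j)) + 1) * inner (w i) (w h))"
      using sum_weighted_norm_sq_eq_form[of "\<lambda>_. 1" M w n p]
      by (simp add: distrib_right sum.distrib power2_eq_square sum_product)
    also have "\<dots> = (\<Sum>i<n. w i * (\<Sum>h<n. ((\<Sum>j<p. M i j * M h j) + 1) * w h))"
      by (simp add: sum_distrib_left mult_ac)
    also have "\<dots> = 0" by (simp add: row)
    finally have z: "(\<Sum>j<p. (\<Sum>i<n. M i j * w i)\<^sup>2) + (\<Sum>i<n. w i)\<^sup>2 = 0" .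
    have "0 \<le> (\<Sum>j<p. (\<Sum>i<n. M i j * w i)\<^sup>2)" by (intro sum_nonneg) simp
    with z have "(\<Sum>j<p. (\<Sum>i<n. M i j * w i)\<^sup>2) = 0" "(\<Sum>i<n. w i) = 0"
      by (smt (verit) zero_le_power2 zero_eq_power2)+
    then have "\<And>j. j < p \<Longrightarrow> (\<Sum>i<n. M i j * w i) = 0"
      by (subst (asm) sum_nonneg_eq_0_iff) auto
    then obtain c where c: "\<And>i. i < n \<Longrightarrow> w i = c" using ker[of w] by blast
    then have "real n * c = 0" using \<open>(\<Sum>i<n. w i) = 0\<close> by simp
    then have "c = 0" using \<open>0 < n\<close> by simp
    then have "y = 0\<^sub>v n" using y(1) c by (intro eq_vecI) (auto simp: w_def)
    with y(2) show False ..
  qed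
  then have "G \<in> Units (ring_mat TYPE(real) n ())"
    by (rule det_non_zero_imp_unit[OF G])
  then obtain W where W: "W \<in> carrier_mat n n" "G * W = 1\<^sub>m n"
    unfolding Units_def ring_mat_def by auto
  have inv: "(\<Sum>k<n. ((\<Sum>j<p. M i j * M k j) + 1) * W $$ (k, h)) = (if i = h then 1 else 0)"
    if "i < n" "h < n" for i h
  proof -
    have "(G * W) $$ (i, h) = (\<Sum>k<n. ((\<Sum>j<p. M i j * M k j) + 1) * W $$ (k, h))"
      using that W(1) by (simp add: G_def scalar_prod_def lessThan_atLeast0)
    then show ?thesis using W(2) that by simp
  qed
  define R where "R j h = (\<Sum>k<n. M k j * W $$ (k, h))" for j h
  have inv': "(\<Sum>j<p. M i j * R j h) + (\<Sum>k<n. W $$ (k, h)) = (if i = h then 1 else 0)"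
    if "i < n" "h < n" for i h
  proof -
    have "(\<Sum>j<p. M i j * R j h) = (\<Sum>j<p. \<Sum>k<n. M i j * M k j * W $$ (k, h))"
      by (simp add: R_def sum_distrib_left mult.assoc)
    also have "\<dots> = (\<Sum>k<n. (\<Sum>j<p. M i j * M k j) * W $$ (k, h))"
      by (subst sum.swap) (simp add: sum_distrib_right)
    finally show ?thesis using inv[OF that] by (simp add: distrib_right sum.distrib)
  qed
  have "(\<Sum>k<n. W $$ (k, h)) = 1 / real n" if "h < n" for h
  proof -
    have "(\<Sum>i<n. (\<Sum>j<p. M i j * R j h) + (\<Sum>k<n. W $$ (k, h))) = (\<Sum>i<n. if i = h then 1 else 0)"
      by (intro sum.cong) (auto simp: inv' that)
    moreover have "(\<Sum>i<n. \<Sum>j<p. M i j * R j h) = (\<Sum>j<p. (\<Sum>i<n. M i j) * R j h)"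
      by (subst sum.swap) (simp add: sum_distrib_right)
    ultimately have "real n * (\<Sum>k<n. W $$ (k, h)) = 1"
      using that col by (simp add: sum.distrib)
    then show ?thesis using \<open>0 < n\<close> by (simp add: field_simps)
  qed
  then have "(\<Sum>j<p. M i j * R j h) = (if i = h then 1 else 0) - 1 / real n"
    if "i < n" "h < n" for i h
    using inv'[OF that] that by simp
  then show thesis by (rule that)
qed

section \<open>Quasi-Fejer sequences and forward substitution\<close>

text \<open>
  The potential \<open>a k + e k\<close> decreases by at least \<open>\<epsilon> l k\<close> in each step, since the next error uses up
  only the fraction \<open>1 - \<epsilon>\<close> of the decrease \<open>l k\<close>.
\<close>

lemma quasi_fejer_summable_convergent:
  fixes a l e :: "nat \<Rightarrow> real"
  assumes "0 < \<epsilon>" and a: "\<And>k. 0 \<le> a k" and l: "\<And>k. 0 \<le> l k" and e: "\<And>k. 0 \<le> e k"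
    and descent: "\<And>k. a (Suc k) \<le> a k - l k + e k"
    and budget: "\<And>k. e (Suc k) \<le> (1 - \<epsilon>) * l k"
  shows "summable l \<and> e \<longlonglongrightarrow> 0 \<and> convergent a"
proof -
  have drop: "a (Suc k) + e (Suc k) \<le> (a k + e k) - \<epsilon> * l k" for k
    using descent[of k] budget[of k] by (simp add: algebra_simps)
  have "decseq (\<lambda>k. a k + e k)"
    by (rule decseq_SucI) (use drop l \<open>0 < \<epsilon>\<close> in \<open>smt (verit) mult_nonneg_nonneg\<close>)
  then obtain c where c: "(\<lambda>k. a k + e k) \<longlonglongrightarrow> c"
    using decseq_convergent[of "\<lambda>k. a k + e k" 0] a e by (metis add_nonneg_nonneg)
  have partial: "\<epsilon> * (\<Sum>k<N. l k) \<le> (a 0 + e 0) - (a N + e N)" for N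
  proof (induction N)
    case (Suc N)
    then show ?case using drop[of N] by (simp add: algebra_simps)
  qed simp
  have "(\<Sum>k<N. l k) \<le> (a 0 + e 0) / \<epsilon>" for N
    using partial[of N] a[of N] e[of N] \<open>0 < \<epsilon>\<close> by (simp add: field_simps)
  then have sum: "summable l"
    by (intro summableI_nonneg_bounded[of l "(a 0 + e 0) / \<epsilon>"] l)
  have l0: "(\<lambda>k. (1 - \<epsilon>) * l k) \<longlonglongrightarrow> 0"
    using tendsto_mult_left[OF summable_LIMSEQ_zero[OF sum], of "1 - \<epsilon>"] by simp
  have "(\<lambda>k. e (Suc k)) \<longlonglongrightarrow> 0"
    by (rule tendsto_sandwich[OF _ _ tendsto_const l0]) (auto intro!: always_eventually e budget)
  then have e0: "e \<longlonglongrightarrow> 0"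
    by (rule LIMSEQ_imp_Suc)
  have "a \<longlonglongrightarrow> c"
    using tendsto_diff[OF c e0] by simp
  then show ?thesis unfolding convergent_def by (intro conjI exI[of _ c] sum e0)
qed

lemma forward_substitution_exists:
  fixes \<Phi> :: "nat \<Rightarrow> (nat \<Rightarrow> 'a) \<Rightarrow> 'a"
  assumes \<Phi>: "\<And>i f g. (\<And>j. j < i \<Longrightarrow> f j = g j) \<Longrightarrow> \<Phi> i f = \<Phi> i g"
  shows "\<exists>f. \<forall>i. f i = \<Phi> i f"
proof (rule dependent_wellorder_choice[where P = "\<lambda>f i r. r = \<Phi> i f"])
  fix r :: 'a and f g :: "nat \<Rightarrow> 'a" and i :: nat assume "\<And>j. j < i \<Longrightarrow> f j = g j"
  then show "(r = \<Phi> i f) = (r = \<Phi> i g)" using \<Phi>[of i f g] by simp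
qed blast

lemma forward_substitution_unique:
  fixes \<Phi> :: "nat \<Rightarrow> (nat \<Rightarrow> 'a) \<Rightarrow> 'a"
  assumes \<Phi>: "\<And>i f g. (\<And>j. j < i \<Longrightarrow> f j = g j) \<Longrightarrow> \<Phi> i f = \<Phi> i g"
    and "\<And>i. i < n \<Longrightarrow> f i = \<Phi> i f" and "\<And>i. i < n \<Longrightarrow> g i = \<Phi> i g" and "i < n"
  shows "f i = g i"
  using \<open>i < n\<close>
proof (induction i rule: less_induct)
  case (less i)
  then have "\<Phi> i f = \<Phi> i g" by (intro \<Phi>) auto
  then show ?case using assms(2,3) less.prems by simp
qed

section \<open>The splitting scheme and its stationary points\<close>

text \<open>
  The data of the scheme in components, with \<open>M\<close> having \<open>p\<close> columns. The assumption \<open>S_bound\<close> is the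
  positive semidefiniteness condition spelled out as an inequality between quadratic forms, and
  \<open>causal\<close> is what causality is used for: whenever \<open>B\<^sub>j\<close> enters row \<open>i\<close>, its argument depends on
  the components before \<open>i\<close> only.
\<close>

locale causal_splitting =
  fixes n p m :: nat
    and F :: "nat \<Rightarrow> 'h::{real_inner, complete_space} \<Rightarrow> 'h set"
    and B :: "nat \<Rightarrow> 'h \<Rightarrow> 'h"
    and L :: "nat \<Rightarrow> real" and \<theta> :: real
    and M S C Q :: "nat \<Rightarrow> nat \<Rightarrow> real"
  assumes n_pos: "0 < n"
    and F_max: "\<And>i. i < n \<Longrightarrow> maximally_monotone (F i)"
    and L_pos: "\<And>j. j < m \<Longrightarrow> 0 < L j"
    and B_cocoercive: "\<And>j. j < m \<Longrightarrow> cocoercive (1 / L j) (B j)"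
    and theta_pos: "0 < \<theta>"
    and M_ker: "\<And>w :: nat \<Rightarrow> real. (\<And>j. j < p \<Longrightarrow> (\<Sum>i<n. M i j * w i) = 0) \<Longrightarrow> \<exists>c. \<forall>i<n. w i = c"
    and S_sym: "\<And>i j. i < n \<Longrightarrow> j < n \<Longrightarrow> S i j = S j i"
    and S_diag: "\<And>i. i < n \<Longrightarrow> S i i \<noteq> 0"
    and S_sum: "(\<Sum>i<n. \<Sum>j<n. S i j) = 0"
    and S_bound: "\<And>w :: nat \<Rightarrow> real. (\<Sum>j<p. (\<Sum>i<n. M i j * w i)\<^sup>2)
        + (\<Sum>j<m. ((1 + 1 / \<theta>) / 2 * L j) * (\<Sum>i<n. (C i j - Q j i) * w i)\<^sup>2)
      \<le> (\<Sum>i<n. \<Sum>j<n. S i j * (w i * w j))"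
    and C_sum: "\<And>j. j < m \<Longrightarrow> (\<Sum>i<n. C i j) = 1"
    and Q_sum: "\<And>j. j < m \<Longrightarrow> (\<Sum>i<n. Q j i) = 1"
    and causal: "\<And>i j h. i < n \<Longrightarrow> j < m \<Longrightarrow> h < n \<Longrightarrow> i \<le> h \<Longrightarrow> C i j \<noteq> 0 \<Longrightarrow> Q j h = 0"
begin

definition M_adj :: "(nat \<Rightarrow> 'h) \<Rightarrow> nat \<Rightarrow> 'h" where
  "M_adj x j = (\<Sum>i<n. M i j *\<^sub>R x i)"

definition CQ_gap :: "(nat \<Rightarrow> 'h) \<Rightarrow> nat \<Rightarrow> 'h" where
  "CQ_gap x j = (\<Sum>i<n. (C i j - Q j i) *\<^sub>R x i)"

definition B_point :: "(nat \<Rightarrow> 'h) \<Rightarrow> (nat \<Rightarrow> 'h) \<Rightarrow> nat \<Rightarrow> 'h" where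
  "B_point u x j = (\<Sum>h<n. Q j h *\<^sub>R x h) + u j"

text \<open>
  The element of \<open>F\<^sub>i (x\<^sub>i)\<close> that the resolvent step exhibits, when \<open>b\<close> holds the values of the
  operators \<open>B\<^sub>j\<close>. It is linear in \<open>(\<zeta>, b, x)\<close>, which allows comparing two solutions by
  applying the identities below to their difference.
\<close>

definition F_value :: "(nat \<Rightarrow> 'h) \<Rightarrow> (nat \<Rightarrow> 'h) \<Rightarrow> (nat \<Rightarrow> 'h) \<Rightarrow> nat \<Rightarrow> 'h" where
  "F_value \<zeta> b x i = (\<Sum>j<p. M i j *\<^sub>R \<zeta> j) - ((\<Sum>j<i. S i j *\<^sub>R x j) + (S i i / 2) *\<^sub>R x i)
     - (\<Sum>j<m. C i j *\<^sub>R b j)"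

text \<open>
  The system of inclusions that one step solves for \<open>x\<close>, freed from resolvents and from the order of
  computation. The argument \<open>\<zeta>\<close> stands for \<open>z + v\<close>.
\<close>

definition solves :: "(nat \<Rightarrow> 'h) \<Rightarrow> (nat \<Rightarrow> 'h) \<Rightarrow> (nat \<Rightarrow> 'h) \<Rightarrow> bool" where
  "solves \<zeta> u x \<longleftrightarrow> (\<forall>i<n. F_value \<zeta> (\<lambda>j. B j (B_point u x j)) x i \<in> F i (x i))"

definition stationary :: "(nat \<Rightarrow> 'h) \<Rightarrow> 'h \<Rightarrow> bool" where
  "stationary w c \<longleftrightarrow> solves w (\<lambda>_. 0) (\<lambda>_. c)"

lemma S_pos: assumes "i < n" shows "0 < S i i"
proof -
  have "0 \<le> (\<Sum>j<p. (\<Sum>h<n. M h j * (if h = i then 1 else 0))\<^sup>2)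
      + (\<Sum>j<m. ((1 + 1 / \<theta>) / 2 * L j) * (\<Sum>h<n. (C h j - Q j h) * (if h = i then 1 else 0))\<^sup>2)"
    using theta_pos L_pos by (intro add_nonneg_nonneg sum_nonneg mult_nonneg_nonneg) (auto simp: less_imp_le)
  also have "\<dots> \<le> (\<Sum>h<n. \<Sum>j<n. S h j * ((if h = i then 1 else 0) * (if j = i then 1 else 0)))"
    by (rule S_bound)
  also have "\<dots> = S i i"
    using form_at_unit_vectors[OF assms assms, of S 1 1] by simp
  finally show ?thesis using S_diag[OF assms] by simp
qed

text \<open>
  Evaluating the semidefiniteness condition at the constant vector, where \<open>S\<close> and \<open>C\<^sup>T - Q\<close>
  contribute nothing.
\<close>

lemma M_col_sum: assumes "j < p" shows "(\<Sum>i<n. M i j) = 0"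
proof -
  have "(\<Sum>j<p. (\<Sum>i<n. M i j)\<^sup>2) \<le> 0"
    using S_bound[of "\<lambda>_. 1"] S_sum by (simp add: sum_subtractf C_sum Q_sum)
  then have "(\<Sum>j<p. (\<Sum>i<n. M i j)\<^sup>2) = 0"
    by (intro antisym sum_nonneg) auto
  then show ?thesis using assms by (subst (asm) sum_nonneg_eq_0_iff) auto
qed

text \<open>
  By causality a nonzero entry in the first row would force a whole row of \<open>Q\<close> to vanish, although
  that row sums to one.
\<close>

lemma C_first_row: assumes "j < m" shows "C 0 j = 0"
proof (rule ccontr)
  assume "C 0 j \<noteq> 0"
  then have "(\<Sum>i<n. Q j i) = 0" using causal[of 0 j] n_pos assms by simp
  then show False using Q_sum[OF assms] by simp
qed

lemma M_range:
  fixes r :: "nat \<Rightarrow> 'b::real_vector"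
  assumes "(\<Sum>i<n. r i) = 0"
  shows "\<exists>\<zeta>. \<forall>i<n. (\<Sum>j<p. M i j *\<^sub>R \<zeta> j) = r i"
proof -
  obtain R where R: "\<And>i h. i < n \<Longrightarrow> h < n \<Longrightarrow>
      (\<Sum>j<p. M i j * R j h) = (if i = h then 1 else 0) - 1 / real n"
  proof (rule ones_complement_right_inverse[OF n_pos, where p = p and M = M], goal_cases)
    case (1 w)
    from this(2) show ?case by (rule M_ker)
  next
    case (2 j)
    from this(2) show ?case by (rule M_col_sum)
  next
    case (3 R)
    from this(2) show ?case by (rule 3(1))
  qed
  have "(\<Sum>j<p. M i j *\<^sub>R (\<Sum>h<n. R j h *\<^sub>R r h)) = r i" if "i < n" for i
  proof -
    have "(\<Sum>j<p. M i j *\<^sub>R (\<Sum>h<n. R j h *\<^sub>R r h)) = (\<Sum>h<n. (\<Sum>j<p. M i j * R j h) *\<^sub>R r h)"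
      by (simp add: scaleR_sum_right scaleR_sum_left) (rule sum.swap)
    also have "\<dots> = (\<Sum>h<n. (if h = i then r h else 0) - (1 / real n) *\<^sub>R r h)"
      using R[OF that] by (intro sum.cong refl) (simp add: scaleR_diff_left)
    also have "\<dots> = r i"
      unfolding sum_subtractf scaleR_sum_right[symmetric] assms using that by simp
    finally show ?thesis .
  qed
  then show ?thesis by (intro exI[of _ "\<lambda>j. \<Sum>h<n. R j h *\<^sub>R r h"]) simp
qed

lemma M_adj_const: "j < p \<Longrightarrow> M_adj (\<lambda>_. c) j = 0"
  unfolding M_adj_def scaleR_sum_left[symmetric] by (simp add: M_col_sum)

lemma CQ_gap_const: "j < m \<Longrightarrow> CQ_gap (\<lambda>_. c) j = 0"
  unfolding CQ_gap_def scaleR_sum_left[symmetric] sum_subtractf by (simp add: C_sum Q_sum)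

lemma B_point_const: "j < m \<Longrightarrow> B_point (\<lambda>_. 0) (\<lambda>_. c) j = c"
  unfolding B_point_def scaleR_sum_left[symmetric] by (simp add: Q_sum)

lemma M_adj_diff: "M_adj (\<lambda>i. x i - y i) j = M_adj x j - M_adj y j"
  by (simp add: M_adj_def scaleR_diff_right sum_subtractf)

lemma CQ_gap_diff: "CQ_gap (\<lambda>i. x i - y i) j = CQ_gap x j - CQ_gap y j"
  by (simp add: CQ_gap_def scaleR_diff_right sum_subtractf)

lemma B_point_diff: "B_point (\<lambda>j. u j - u' j) (\<lambda>i. x i - y i) j = B_point u x j - B_point u' y j"
  by (simp add: B_point_def scaleR_diff_right sum_subtractf)

lemma F_value_diff:
  "F_value (\<lambda>j. \<zeta> j - \<zeta>' j) (\<lambda>j. b j - b' j) (\<lambda>i. x i - y i) i = F_value \<zeta> b x i - F_value \<zeta>' b' y i"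
  by (simp add: F_value_def scaleR_diff_right sum_subtractf)

lemma F_value_first: "F_value \<zeta> b x 0 = (\<Sum>j<p. M 0 j *\<^sub>R \<zeta> j) - (S 0 0 / 2) *\<^sub>R x 0"
  by (simp add: F_value_def C_first_row)

text \<open>
  At a constant vector the contributions of \<open>M\<close> and of \<open>S\<close> cancel in the sum over the rows, so the
  inclusions add up to the statement that the constant is a zero of the sum of all operators.
\<close>

lemma sum_F_value_const: "(\<Sum>i<n. F_value \<zeta> b (\<lambda>_. c) i) = - (\<Sum>j<m. b j)"
proof -
  have "(\<Sum>i<n. \<Sum>j<p. M i j *\<^sub>R \<zeta> j) = (\<Sum>j<p. (\<Sum>i<n. M i j) *\<^sub>R \<zeta> j)"
    by (subst sum.swap) (simp add: scaleR_sum_left)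
  then have 1: "(\<Sum>i<n. \<Sum>j<p. M i j *\<^sub>R \<zeta> j) = 0" by (simp add: M_col_sum)
  have half: "(\<Sum>i<n. (\<Sum>j<i. S i j) + S i i / 2) = 0"
    by (subst sum_lower_triangle_symmetric) (auto simp: S_sym S_sum)
  have "(\<Sum>i<n. (\<Sum>j<i. S i j *\<^sub>R c) + (S i i / 2) *\<^sub>R c) = (\<Sum>i<n. (\<Sum>j<i. S i j) + S i i / 2) *\<^sub>R c"
    by (simp add: scaleR_sum_left scaleR_add_left sum.distrib)
  then have 2: "(\<Sum>i<n. (\<Sum>j<i. S i j *\<^sub>R c) + (S i i / 2) *\<^sub>R c) = 0"
    unfolding half by simp
  have "(\<Sum>i<n. \<Sum>j<m. C i j *\<^sub>R b j) = (\<Sum>j<m. (\<Sum>i<n. C i j) *\<^sub>R b j)"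
    by (subst sum.swap) (simp add: scaleR_sum_left)
  then have 3: "(\<Sum>i<n. \<Sum>j<m. C i j *\<^sub>R b j) = (\<Sum>j<m. b j)" by (simp add: C_sum)
  show ?thesis
    unfolding F_value_def sum_subtractf 1 2 3 by simp
qed

text \<open>
  The left side pairs each operator value with the point it is taken at; up to the quadratic form of
  \<open>S\<close> only terms with \<open>M\<^sup>T x\<close>, \<open>(C\<^sup>T - Q) x\<close> and \<open>u\<close> remain. It serves twice: for the difference of a
  step and a stationary point it yields the Fejer inequality, and along the iteration it shows that
  the left side tends to zero.
\<close>

lemma energy_identity:
  "(\<Sum>i<n. inner (F_value \<zeta> b x i) (x i)) + (\<Sum>j<m. inner (b j) (B_point u x j))
   = (\<Sum>j<p. inner (\<zeta> j) (M_adj x j)) - (\<Sum>i<n. \<Sum>j<n. S i j * inner (x i) (x j)) / 2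
     - (\<Sum>j<m. inner (b j) (CQ_gap x j - u j))"
proof -
  have 1: "(\<Sum>i<n. inner (\<Sum>j<p. M i j *\<^sub>R \<zeta> j) (x i)) = (\<Sum>j<p. inner (\<zeta> j) (M_adj x j))"
    by (simp add: M_adj_def inner_sum_left inner_sum_right) (rule sum.swap)
  have "(\<Sum>i<n. inner ((\<Sum>j<i. S i j *\<^sub>R x j) + (S i i / 2) *\<^sub>R x i) (x i))
      = (\<Sum>i<n. (\<Sum>j<i. S i j * inner (x j) (x i)) + (S i i * inner (x i) (x i)) / 2)"
    by (simp add: inner_add_left inner_sum_left)
  also have "\<dots> = (\<Sum>i<n. \<Sum>j<n. S i j * inner (x j) (x i)) / 2"
    by (rule sum_lower_triangle_symmetric) (simp add: S_sym inner_commute)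
  also have "\<dots> = (\<Sum>i<n. \<Sum>j<n. S i j * inner (x i) (x j)) / 2"
    by (simp add: inner_commute)
  finally have 2: "(\<Sum>i<n. inner ((\<Sum>j<i. S i j *\<^sub>R x j) + (S i i / 2) *\<^sub>R x i) (x i))
      = (\<Sum>i<n. \<Sum>j<n. S i j * inner (x i) (x j)) / 2" .
  have 3: "(\<Sum>i<n. inner (\<Sum>j<m. C i j *\<^sub>R b j) (x i)) = (\<Sum>j<m. inner (b j) (\<Sum>i<n. C i j *\<^sub>R x i))"
    by (simp add: inner_sum_left inner_sum_right) (rule sum.swap)
  have 4: "inner (b j) (\<Sum>i<n. C i j *\<^sub>R x i) - inner (b j) (B_point u x j) = inner (b j) (CQ_gap x j - u j)" for j
    by (simp add: CQ_gap_def B_point_def scaleR_diff_left sum_subtractf inner_diff_right inner_add_right)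
  have "(\<Sum>i<n. inner (F_value \<zeta> b x i) (x i)) = (\<Sum>j<p. inner (\<zeta> j) (M_adj x j))
      - (\<Sum>i<n. \<Sum>j<n. S i j * inner (x i) (x j)) / 2 - (\<Sum>j<m. inner (b j) (\<Sum>i<n. C i j *\<^sub>R x i))"
    unfolding F_value_def inner_diff_left sum_subtractf 1 2 3 ..
  then show ?thesis by (simp add: 4[symmetric] sum_subtractf)
qed

lemma solvesD: "solves \<zeta> u x \<Longrightarrow> i < n \<Longrightarrow> F_value \<zeta> (\<lambda>j. B j (B_point u x j)) x i \<in> F i (x i)"
  by (simp add: solves_def)

lemma F_monotone: "i < n \<Longrightarrow> a \<in> F i x \<Longrightarrow> b \<in> F i y \<Longrightarrow> 0 \<le> inner (a - b) (x - y)"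
  using F_max maximally_monotone_monotoneD by blast

lemma B_cocoerciveD:
  "j < m \<Longrightarrow> (1 / L j) * (norm (B j x - B j y))\<^sup>2 \<le> inner (B j x - B j y) (x - y)"
  using B_cocoercive by (simp add: cocoercive_def)

lemma B_lipschitz: assumes "j < m" shows "norm (B j x - B j y) \<le> L j * norm (x - y)"
proof (cases "B j x = B j y")
  case False
  have "(1 / L j) * (norm (B j x - B j y))\<^sup>2 \<le> norm (B j x - B j y) * norm (x - y)"
    using B_cocoerciveD[OF assms, of x y] norm_cauchy_schwarz[of "B j x - B j y" "x - y"] by linarith
  then show ?thesis
    using False L_pos[OF assms] by (simp add: power2_eq_square field_simps)
qed (use L_pos[OF assms] in simp)

lemma stationary_F_value:
  assumes "stationary w c" and "i < n"
  shows "F_value w (\<lambda>j. B j c) (\<lambda>_. c) i \<in> F i c"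
proof -
  have "F_value w (\<lambda>j. B j (B_point (\<lambda>_. 0) (\<lambda>_. c) j)) (\<lambda>_. c) i = F_value w (\<lambda>j. B j c) (\<lambda>_. c) i"
    by (simp add: F_value_def B_point_const)
  then show ?thesis using solvesD[OF assms(1)[unfolded stationary_def] assms(2)] by simp
qed

text \<open>
  The basic estimate, from the energy identity for the difference of \<open>x\<close> and the constant \<open>c\<close>.
  Monotonicity makes the first sum there nonnegative, cocoercivity bounds the second one from below,
  and the cross term with \<open>C\<^sup>T - Q\<close> is absorbed by Young's inequality: one part by the cocoercivity
  bound, the other by the part of \<open>S\<close> that the semidefiniteness condition reserves for it.
\<close>

lemma M_adj_bound:
  assumes x: "solves \<zeta> u x" and w: "stationary w c"
  shows "(\<Sum>j<p. (norm (M_adj x j))\<^sup>2)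
    \<le> 2 * (\<Sum>j<p. inner (\<zeta> j - w j) (M_adj x j)) + (1 + \<theta>) / 2 * (\<Sum>j<m. L j * (norm (u j))\<^sup>2)"
proof -
  define b where "b = (\<lambda>j. B j (B_point u x j) - B j c)"
  define y where "y = (\<lambda>i. x i - c)"
  have My: "M_adj y j = M_adj x j" if "j < p" for j
    using that unfolding y_def by (simp add: M_adj_diff M_adj_const)
  have f: "F_value (\<lambda>j. \<zeta> j - w j) b y i
      = F_value \<zeta> (\<lambda>j. B j (B_point u x j)) x i - F_value w (\<lambda>j. B j c) (\<lambda>_. c) i" for i
    unfolding b_def y_def by (rule F_value_diff)
  have mono: "0 \<le> (\<Sum>i<n. inner (F_value (\<lambda>j. \<zeta> j - w j) b y i) (y i))"
    unfolding f unfolding y_def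
    by (intro sum_nonneg F_monotone[OF _ solvesD[OF x] stationary_F_value[OF w]]) auto
  have Bp: "B_point u y j = B_point u x j - c" if "j < m" for j
    using B_point_diff[of u "\<lambda>_. 0" x "\<lambda>_. c" j] B_point_const[OF that] by (simp add: y_def)
  have "(\<Sum>j<m. (1 / L j) * (norm (b j))\<^sup>2) \<le> (\<Sum>j<m. inner (b j) (B_point u y j))"
    by (intro sum_mono) (simp add: Bp b_def B_cocoerciveD del: times_divide_eq_left mult_1_left)
  moreover have "- (\<Sum>j<m. inner (b j) (CQ_gap y j - u j)) \<le> (\<Sum>j<m. (1 / L j) * (norm (b j))\<^sup>2)
      + (\<Sum>j<m. ((1 + 1 / \<theta>) / 2 * L j) * (norm (CQ_gap y j))\<^sup>2) / 2
      + (1 + \<theta>) / 4 * (\<Sum>j<m. L j * (norm (u j))\<^sup>2)"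
  proof -
    have "- inner (b j) (CQ_gap y j - u j) \<le> (1 / L j) * (norm (b j))\<^sup>2
        + ((1 + 1 / \<theta>) / 2 * L j) * (norm (CQ_gap y j))\<^sup>2 / 2 + (1 + \<theta>) / 4 * (L j * (norm (u j))\<^sup>2)"
      if "j < m" for j
    proof -
      have "L j / 4 * (norm (CQ_gap y j - u j))\<^sup>2
          \<le> L j / 4 * ((1 + 1 / \<theta>) * (norm (CQ_gap y j))\<^sup>2 + (1 + \<theta>) * (norm (u j))\<^sup>2)"
        using L_pos[OF that] theta_pos by (intro mult_left_mono norm_sq_diff_le_weighted) auto
      also have "\<dots> = ((1 + 1 / \<theta>) / 2 * L j) * (norm (CQ_gap y j))\<^sup>2 / 2 + (1 + \<theta>) / 4 * (L j * (norm (u j))\<^sup>2)"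
        by (simp add: algebra_simps add_divide_distrib)
      finally show ?thesis
        using inner_ge_neg_weighted_norm_sq[OF L_pos[OF that], of "b j" "CQ_gap y j - u j"] by linarith
    qed
    then have "(\<Sum>j<m. - inner (b j) (CQ_gap y j - u j)) \<le> (\<Sum>j<m. (1 / L j) * (norm (b j))\<^sup>2
        + ((1 + 1 / \<theta>) / 2 * L j) * (norm (CQ_gap y j))\<^sup>2 / 2 + (1 + \<theta>) / 4 * (L j * (norm (u j))\<^sup>2))"
      by (intro sum_mono) auto
    then show ?thesis
      by (simp only: sum_negf sum.distrib sum_divide_distrib sum_distrib_left)
  qed
  moreover have "(\<Sum>j<p. (norm (M_adj y j))\<^sup>2)
      + (\<Sum>j<m. ((1 + 1 / \<theta>) / 2 * L j) * (norm (CQ_gap y j))\<^sup>2)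
      \<le> (\<Sum>i<n. \<Sum>j<n. S i j * inner (y i) (y j))"
    unfolding M_adj_def CQ_gap_def by (rule psd_bound_lift[OF S_sym S_bound])
  ultimately have "(\<Sum>j<p. (norm (M_adj y j))\<^sup>2) \<le> 2 * (\<Sum>j<p. inner (\<zeta> j - w j) (M_adj y j))
      + 2 * ((1 + \<theta>) / 4 * (\<Sum>j<m. L j * (norm (u j))\<^sup>2))"
    using energy_identity[of "\<lambda>j. \<zeta> j - w j" b y u] mono by linarith
  then show ?thesis by (simp add: My cong: sum.cong_simp)
qed

text \<open>
  The first row contains no \<open>B\<^sub>j\<close> and no earlier component, so monotonicity of \<open>F\<^sub>0\<close> alone bounds
  \<open>x\<^sub>0\<close> in terms of \<open>\<zeta>\<close>. This gives the boundedness of the iterates and shows that a stationary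
  point determines its zero.
\<close>

lemma first_component_bound:
  assumes x: "solves \<zeta> u x" and w: "stationary w c"
  shows "S 0 0 / 2 * norm (x 0 - c) \<le> norm (\<Sum>j<p. M 0 j *\<^sub>R (\<zeta> j - w j))"
proof -
  let ?r = "\<Sum>j<p. M 0 j *\<^sub>R (\<zeta> j - w j)"
  have "0 \<le> inner (F_value \<zeta> (\<lambda>j. B j (B_point u x j)) x 0 - F_value w (\<lambda>j. B j c) (\<lambda>_. c) 0) (x 0 - c)"
    by (intro F_monotone[OF n_pos] solvesD[OF x] stationary_F_value[OF w] n_pos)
  also have "F_value \<zeta> (\<lambda>j. B j (B_point u x j)) x 0 - F_value w (\<lambda>j. B j c) (\<lambda>_. c) 0
      = ?r - (S 0 0 / 2) *\<^sub>R (x 0 - c)"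
    by (simp add: F_value_first scaleR_diff_right sum_subtractf)
  finally have "S 0 0 / 2 * (norm (x 0 - c))\<^sup>2 \<le> inner ?r (x 0 - c)"
    by (simp add: inner_diff_left power2_norm_eq_inner)
  also have "\<dots> \<le> norm ?r * norm (x 0 - c)" by (rule norm_cauchy_schwarz)
  finally have "S 0 0 / 2 * norm (x 0 - c) * norm (x 0 - c) \<le> norm ?r * norm (x 0 - c)"
    by (simp add: power2_eq_square mult.assoc)
  then show ?thesis
    by (cases "x 0 = c") (auto simp: mult_le_cancel_right)
qed

lemma stationary_determines_zero:
  assumes "stationary w c" and "stationary w' c'" and "\<And>j. j < p \<Longrightarrow> w j = w' j"
  shows "c = c'"
  using first_component_bound[OF assms(1)[unfolded stationary_def] assms(2)] S_pos[OF n_pos] assms(3)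
  by (simp add: mult_le_0_iff)

lemma zer_operator_sum_iff:
  "c \<in> zer (operator_sum n F m B) \<longleftrightarrow>
     (\<exists>f. (\<forall>i<n. f i \<in> F i c) \<and> (\<Sum>i<n. f i) = - (\<Sum>j<m. B j c))"
proof -
  have F: "(\<Sum>i<n. F i c) = {\<Sum>i<n. f i | f. \<forall>i<n. f i \<in> F i c}"
    by (subst set_sum_alt) auto
  have B: "(\<Sum>j<m. {B j c}) = {\<Sum>j<m. B j c}"
    by (induction m) (auto simp: set_plus_def)
  have "c \<in> zer (operator_sum n F m B) \<longleftrightarrow>
      (\<exists>f. (\<forall>i<n. f i \<in> F i c) \<and> 0 = (\<Sum>i<n. f i) + (\<Sum>j<m. B j c))"
    unfolding zer_def operator_sum_def mem_Collect_eq F B by (auto simp: set_plus_def)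
  then show ?thesis by (simp add: eq_neg_iff_add_eq_0 eq_commute[of 0])
qed

lemma stationary_imp_zer:
  assumes "stationary w c"
  shows "c \<in> zer (operator_sum n F m B)"
  unfolding zer_operator_sum_iff
  using stationary_F_value[OF assms] sum_F_value_const by blast

text \<open>
  The values \<open>f\<^sub>i \<in> F\<^sub>i c\<close> that balance the \<open>B\<^sub>j c\<close> differ from the required ones by a vector with
  sum zero, hence by a vector in the range of \<open>M\<close>.
\<close>

lemma zer_imp_stationary:
  assumes "c \<in> zer (operator_sum n F m B)"
  shows "\<exists>w. stationary w c"
proof -
  obtain f where f: "\<And>i. i < n \<Longrightarrow> f i \<in> F i c" and sum: "(\<Sum>i<n. f i) = - (\<Sum>j<m. B j c)"
    using assms unfolding zer_operator_sum_iff by blast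
  let ?g = "\<lambda>w. F_value w (\<lambda>j. B j c) (\<lambda>_. c)"
  have "(\<Sum>i<n. f i - ?g (\<lambda>_. 0) i) = 0"
    by (simp add: sum_subtractf sum sum_F_value_const)
  then obtain w where w: "\<And>i. i < n \<Longrightarrow> (\<Sum>j<p. M i j *\<^sub>R w j) = f i - ?g (\<lambda>_. 0) i"
    using M_range by blast
  have "?g w i = f i" if "i < n" for i
    using w[OF that] by (simp add: F_value_def algebra_simps)
  then have "stationary w c"
    unfolding stationary_def solves_def
    using f by (simp add: F_value_def B_point_const)
  then show ?thesis by blast
qed

text \<open>
  The kernel condition concerns real vectors; it is applied to the inner products of the components
  with \<open>x\<^sub>i - x\<^sub>0\<close>.
\<close>

lemma M_adj_zero_imp_const:
  assumes "\<And>j. j < p \<Longrightarrow> M_adj x j = 0" and "i < n"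
  shows "x i = x 0"
proof -
  let ?y = "x i - x 0"
  have "(\<Sum>h<n. M h j * inner (x h) ?y) = 0" if "j < p" for j
    using arg_cong[OF assms(1)[OF that], of "\<lambda>a. inner a ?y"]
    by (simp add: M_adj_def inner_sum_left)
  from M_ker[OF this] obtain c where "\<And>h. h < n \<Longrightarrow> inner (x h) ?y = c" by blast
  then have "inner ?y ?y = 0" using assms(2) n_pos by (simp add: inner_diff_left)
  then show ?thesis by simp
qed

text \<open>
  The right-hand side of the algorithm, which reads only the components of \<open>x\<close> before \<open>i\<close>.
\<close>

definition resolvent_update :: "(nat \<Rightarrow> 'h) \<Rightarrow> (nat \<Rightarrow> 'h) \<Rightarrow> nat \<Rightarrow> (nat \<Rightarrow> 'h) \<Rightarrow> 'h" where
  "resolvent_update \<zeta> u i x = resolvent (2 / S i i) (F i)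
     (- ((2 / S i i) *\<^sub>R (\<Sum>j<i. S i j *\<^sub>R x j)) + (2 / S i i) *\<^sub>R (\<Sum>j<p. M i j *\<^sub>R \<zeta> j)
      - (2 / S i i) *\<^sub>R (\<Sum>j<m. C i j *\<^sub>R B j ((\<Sum>h<i. Q j h *\<^sub>R x h) + u j)))"

lemma causal_B_point:
  assumes "i < n" and "j < m"
  shows "C i j *\<^sub>R B j ((\<Sum>h<i. Q j h *\<^sub>R x h) + u j) = C i j *\<^sub>R B j (B_point u x j)"
proof (cases "C i j = 0")
  case False
  have "(\<Sum>h<n. Q j h *\<^sub>R x h) = (\<Sum>h<i. Q j h *\<^sub>R x h)"
    using assms causal[OF assms _ _ False] by (intro sum.mono_neutral_right) auto
  then show ?thesis by (simp add: B_point_def)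
qed simp

lemma solves_iff_resolvent_update:
  "solves \<zeta> u x \<longleftrightarrow> (\<forall>i<n. x i = resolvent_update \<zeta> u i x)"
proof -
  have "F_value \<zeta> (\<lambda>j. B j (B_point u x j)) x i \<in> F i (x i) \<longleftrightarrow> x i = resolvent_update \<zeta> u i x"
    if "i < n" for i
  proof -
    let ?s = "- (\<Sum>j<i. S i j *\<^sub>R x j) + (\<Sum>j<p. M i j *\<^sub>R \<zeta> j)
        - (\<Sum>j<m. C i j *\<^sub>R B j ((\<Sum>h<i. Q j h *\<^sub>R x h) + u j))"
    have d: "0 < 2 / S i i" using S_pos[OF that] by simp
    have "(\<Sum>j<m. C i j *\<^sub>R B j ((\<Sum>h<i. Q j h *\<^sub>R x h) + u j)) = (\<Sum>j<m. C i j *\<^sub>R B j (B_point u x j))"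
      by (intro sum.cong) (auto simp: causal_B_point[OF that])
    then have "F_value \<zeta> (\<lambda>j. B j (B_point u x j)) x i = ?s - (S i i / 2) *\<^sub>R x i"
      by (simp add: F_value_def)
    also have "\<dots> = (1 / (2 / S i i)) *\<^sub>R ((2 / S i i) *\<^sub>R ?s - x i)"
      using S_pos[OF that] by (simp add: scaleR_diff_right)
    also have "(2 / S i i) *\<^sub>R ?s = - ((2 / S i i) *\<^sub>R (\<Sum>j<i. S i j *\<^sub>R x j)) + (2 / S i i) *\<^sub>R (\<Sum>j<p. M i j *\<^sub>R \<zeta> j)
      - (2 / S i i) *\<^sub>R (\<Sum>j<m. C i j *\<^sub>R B j ((\<Sum>h<i. Q j h *\<^sub>R x h) + u j))"
      by (simp add: scaleR_diff_right scaleR_add_right)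
    finally show ?thesis
      unfolding resolvent_update_def
      by (simp only: resolvent_eq_iff[OF F_max[OF that] d, symmetric] eq_commute)
  qed
  then show ?thesis by (simp add: solves_def)
qed

lemma solves_cong:
  assumes "\<And>i. i < n \<Longrightarrow> x i = y i"
  shows "solves \<zeta> u x \<longleftrightarrow> solves \<zeta> u y"
proof -
  have "B_point u x = B_point u y" by (auto simp: B_point_def fun_eq_iff assms)
  moreover have "F_value \<zeta> b x i = F_value \<zeta> b y i" if "i < n" for b i
    using that by (simp add: F_value_def assms)
  ultimately show ?thesis by (simp add: solves_def assms)
qed

lemma resolvent_update_cong:
  "(\<And>j. j < i \<Longrightarrow> x j = y j) \<Longrightarrow> resolvent_update \<zeta> u i x = resolvent_update \<zeta> u i y"
  by (simp add: resolvent_update_def)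

lemma solves_exists: "\<exists>x. solves \<zeta> u x"
  using forward_substitution_exists[of "resolvent_update \<zeta> u", OF resolvent_update_cong]
  by (auto simp: solves_iff_resolvent_update)

lemma solves_unique: "solves \<zeta> u x \<Longrightarrow> solves \<zeta> u y \<Longrightarrow> i < n \<Longrightarrow> x i = y i"
  using forward_substitution_unique[of "resolvent_update \<zeta> u" n x y i, OF resolvent_update_cong]
  by (auto simp: solves_iff_resolvent_update)

text \<open>
  A demiclosedness principle. Let \<open>f'\<close> and \<open>\<beta>\<close> be the weak limits of the values of the \<open>F\<^sub>i\<close> and the
  \<open>B\<^sub>j\<close>. The step is compared with test points: \<open>c\<close> for every \<open>B\<^sub>j\<close>, and for \<open>F\<^sub>i\<close> the point
  \<open>a\<^sub>i\<close> with \<open>c + f'\<^sub>i - a\<^sub>i \<in> F\<^sub>i a\<^sub>i\<close> given by Minty's theorem. The sum \<open>E\<close> of the inner products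
  bounded from below by monotonicity and cocoercivity has a limit, because by the energy identity the
  part of \<open>E\<close> that is quadratic in the iterates is a null sequence. For this choice of \<open>a\<close> the
  limit is \<open>- \<Sum>\<parallel>a\<^sub>i - c\<parallel>\<^sup>2\<close>, and it is nonnegative. Hence \<open>a\<^sub>i = c\<close>, that is \<open>f'\<^sub>i \<in> F\<^sub>i c\<close>;
  and then \<open>E\<close> tends to zero, so the values of the \<open>B\<^sub>j\<close> converge in norm to \<open>B\<^sub>j c\<close>.
\<close>

lemma weak_limit_stationary:
  assumes sol: "\<And>k. solves (\<zeta> k) (u k) (x k)"
    and \<zeta>: "\<And>j. j < p \<Longrightarrow> weakly_tendsto (\<lambda>k. \<zeta> k j) (w j)" "\<And>j. j < p \<Longrightarrow> Bseq (\<lambda>k. \<zeta> k j)"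
    and x: "\<And>i. i < n \<Longrightarrow> weakly_tendsto (\<lambda>k. x k i) c" "\<And>i. i < n \<Longrightarrow> Bseq (\<lambda>k. x k i)"
    and consensus: "\<And>i. i < n \<Longrightarrow> (\<lambda>k. x k i - x k 0) \<longlonglongrightarrow> 0"
    and u: "\<And>j. j < m \<Longrightarrow> (\<lambda>k. u k j) \<longlonglongrightarrow> 0"
    and Mx: "\<And>j. j < p \<Longrightarrow> (\<lambda>k. M_adj (x k) j) \<longlonglongrightarrow> 0"
    and b: "\<And>j. j < m \<Longrightarrow> weakly_tendsto (\<lambda>k. B j (B_point (u k) (x k) j)) (\<beta> j)"
      "\<And>j. j < m \<Longrightarrow> Bseq (\<lambda>k. B j (B_point (u k) (x k) j))"
  shows "stationary w c"
proof -
  let ?b = "\<lambda>k j. B j (B_point (u k) (x k) j)"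
  let ?f = "\<lambda>k. F_value (\<zeta> k) (?b k) (x k)"
  let ?f' = "F_value w \<beta> (\<lambda>_. c)"
  have f: "weakly_tendsto (\<lambda>k. ?f k i) (?f' i)" if "i < n" for i
    unfolding F_value_def using that
    by (intro weakly_tendsto_add weakly_tendsto_diff weakly_tendsto_sum weakly_tendsto_scaleR \<zeta> x b) auto
  have q: "weakly_tendsto (\<lambda>k. B_point (u k) (x k) j) c" if "j < m" for j
  proof -
    have "weakly_tendsto (\<lambda>k. B_point (u k) (x k) j) (B_point (\<lambda>_. 0) (\<lambda>_. c) j)"
      unfolding B_point_def using that
      by (intro weakly_tendsto_add weakly_tendsto_sum weakly_tendsto_scaleR x tendsto_imp_weakly_tendsto u) auto
    then show ?thesis by (simp add: B_point_const that)
  qed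
  have "\<exists>a. (1 / 1) *\<^sub>R ((c + ?f' i) - a) \<in> F i a" if "i < n" for i
    using minty[OF F_max[OF that], of 1 "c + ?f' i"] by auto
  then obtain a where a: "\<And>i. i < n \<Longrightarrow> c + ?f' i - a i \<in> F i (a i)"
    by simp metis
  define \<phi> where "\<phi> i = c + ?f' i - a i" for i
  \<comment> \<open>The sum of all the monotonicity expressions with the test points.\<close>
  define E where "E k = (\<Sum>i<n. inner (?f k i - \<phi> i) (x k i - a i))
      + (\<Sum>j<m. inner (?b k j - B j c) (B_point (u k) (x k) j - c))" for k
  have E_ge: "(\<Sum>j<m. (1 / L j) * (norm (?b k j - B j c))\<^sup>2) \<le> E k" for k
  proof -
    have "0 \<le> (\<Sum>i<n. inner (?f k i - \<phi> i) (x k i - a i))"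
      unfolding \<phi>_def by (intro sum_nonneg F_monotone[OF _ solvesD[OF sol] a]) auto
    moreover have "(\<Sum>j<m. (1 / L j) * (norm (?b k j - B j c))\<^sup>2)
        \<le> (\<Sum>j<m. inner (?b k j - B j c) (B_point (u k) (x k) j - c))"
      by (intro sum_mono B_cocoerciveD) simp
    ultimately show ?thesis by (simp add: E_def)
  qed
  have "(\<lambda>k. inner (x k i) (x k j) - inner (x k 0) (x k 0)) \<longlonglongrightarrow> 0" if "i < n" "j < n" for i j
  proof -
    have "(\<lambda>k. inner (x k i) (x k j - x k 0) + inner (x k 0) (x k i - x k 0)) \<longlonglongrightarrow> 0 + 0"
      by (intro tendsto_add tendsto_inner_bounded_null x consensus that n_pos)
    then show ?thesis
      by (simp add: inner_diff_right inner_commute)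
  qed
  then have "(\<lambda>k. \<Sum>i<n. \<Sum>j<n. S i j * (inner (x k i) (x k j) - inner (x k 0) (x k 0)))
      \<longlonglongrightarrow> (\<Sum>i<n. \<Sum>j<n. S i j * 0)"
    by (intro tendsto_sum tendsto_mult_left) auto
  moreover have "(\<Sum>i<n. \<Sum>j<n. S i j * (inner (x k i) (x k j) - inner (x k 0) (x k 0)))
      = (\<Sum>i<n. \<Sum>j<n. S i j * inner (x k i) (x k j))" for k
    by (simp add: right_diff_distrib sum_subtractf S_sum flip: sum_distrib_right)
  ultimately have S0: "(\<lambda>k. \<Sum>i<n. \<Sum>j<n. S i j * inner (x k i) (x k j)) \<longlonglongrightarrow> 0"
    by simp
  have CQ0: "(\<lambda>k. CQ_gap (x k) j) \<longlonglongrightarrow> 0" if "j < m" for j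
  proof -
    have "(\<lambda>k. CQ_gap (\<lambda>i. x k i - x k 0) j) \<longlonglongrightarrow> (\<Sum>i<n. (C i j - Q j i) *\<^sub>R 0)"
      unfolding CQ_gap_def by (intro tendsto_sum tendsto_scaleR tendsto_const consensus) simp
    then show ?thesis
      unfolding CQ_gap_diff CQ_gap_const[OF that] by simp
  qed
  have gap0: "(\<lambda>k. CQ_gap (x k) j - u k j) \<longlonglongrightarrow> 0" if "j < m" for j
    using tendsto_diff[OF CQ0 u] that by fastforce
  have z0: "(\<lambda>k. \<Sum>j<p. inner (\<zeta> k j) (M_adj (x k) j)) \<longlonglongrightarrow> (\<Sum>j<p. 0)"
    by (intro tendsto_sum tendsto_inner_bounded_null \<zeta> Mx) auto
  have b0: "(\<lambda>k. \<Sum>j<m. inner (?b k j) (CQ_gap (x k) j - u k j)) \<longlonglongrightarrow> (\<Sum>j<m. 0)"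
    by (intro tendsto_sum tendsto_inner_bounded_null b gap0) auto
  have "(\<lambda>k. (\<Sum>j<p. inner (\<zeta> k j) (M_adj (x k) j)) - (\<Sum>i<n. \<Sum>j<n. S i j * inner (x k i) (x k j)) / 2
     - (\<Sum>j<m. inner (?b k j) (CQ_gap (x k) j - u k j))) \<longlonglongrightarrow> (\<Sum>j<p. 0) - 0 / 2 - (\<Sum>j<m. 0)"
    by (intro tendsto_diff z0 b0 tendsto_divide S0 tendsto_const) simp
  then have G: "(\<lambda>k. (\<Sum>i<n. inner (?f k i) (x k i)) + (\<Sum>j<m. inner (?b k j) (B_point (u k) (x k) j))) \<longlonglongrightarrow> 0"
    unfolding energy_identity by simp
  \<comment> \<open>The first parenthesis tends to zero; everything else is affine in weakly convergent sequences.\<close>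
  have E_eq: "E k = ((\<Sum>i<n. inner (?f k i) (x k i)) + (\<Sum>j<m. inner (?b k j) (B_point (u k) (x k) j)))
      - (\<Sum>i<n. inner (?f k i) (a i) + inner (x k i) (\<phi> i) - inner (\<phi> i) (a i))
      - (\<Sum>j<m. inner (?b k j) c + inner (B_point (u k) (x k) j) (B j c) - inner (B j c) c)" for k
    unfolding E_def
    by (simp add: inner_diff_left inner_diff_right sum_subtractf sum.distrib inner_commute)
  have "E \<longlonglongrightarrow> 0 - (\<Sum>i<n. inner (?f' i) (a i) + inner c (\<phi> i) - inner (\<phi> i) (a i))
      - (\<Sum>j<m. inner (\<beta> j) c + inner c (B j c) - inner (B j c) c)"
    unfolding E_eq
    by (intro tendsto_diff tendsto_sum tendsto_add tendsto_const G weakly_tendstoD f x b q) auto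
  moreover have "0 - (\<Sum>i<n. inner (?f' i) (a i) + inner c (\<phi> i) - inner (\<phi> i) (a i))
      - (\<Sum>j<m. inner (\<beta> j) c + inner c (B j c) - inner (B j c) c) = - (\<Sum>i<n. (norm (a i - c))\<^sup>2)"
  proof -
    have "(\<Sum>j<m. inner (\<beta> j) c + inner c (B j c) - inner (B j c) c) = - (\<Sum>i<n. inner (?f' i) c)"
      using arg_cong[OF sum_F_value_const[of w \<beta> c], of "inner c"]
      by (simp add: inner_sum_right inner_commute[of _ c])
    moreover have "inner (?f' i) c - (inner (?f' i) (a i) + inner c (\<phi> i) - inner (\<phi> i) (a i))
        = - (norm (a i - c))\<^sup>2" for i
      unfolding \<phi>_def power2_norm_eq_inner
      by (simp add: inner_diff_left inner_diff_right inner_add_left inner_add_right inner_commute)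
    ultimately show ?thesis
      by (simp add: sum_negf flip: sum_subtractf)
  qed
  ultimately have E: "E \<longlonglongrightarrow> - (\<Sum>i<n. (norm (a i - c))\<^sup>2)" by simp
  have E_nonneg: "0 \<le> E k" for k
    by (rule order_trans[OF _ E_ge]) (intro sum_nonneg mult_nonneg_nonneg, auto simp: L_pos less_imp_le)
  then have "(\<Sum>i<n. (norm (a i - c))\<^sup>2) \<le> 0"
    using LIMSEQ_le_const[OF E, of 0] by auto
  then have sum0: "(\<Sum>i<n. (norm (a i - c))\<^sup>2) = 0"
    by (intro antisym sum_nonneg) auto
  then have ac: "a i = c" if "i < n" for i
    using that by (subst (asm) sum_nonneg_eq_0_iff) auto
  have b_eq: "\<beta> j = B j c" if "j < m" for j
  proof -
    have "(norm (?b k j - B j c))\<^sup>2 \<le> L j * E k" for k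
    proof -
      have "(1 / L j) * (norm (?b k j - B j c))\<^sup>2 \<le> (\<Sum>j<m. (1 / L j) * (norm (?b k j - B j c))\<^sup>2)"
        using that by (intro member_le_sum) (auto simp: L_pos less_imp_le)
      then have "(1 / L j) * (norm (?b k j - B j c))\<^sup>2 \<le> E k" using E_ge[of k] by linarith
      then show ?thesis using L_pos[OF that] by (simp add: field_simps)
    qed
    moreover have "E \<longlonglongrightarrow> 0"
      using E unfolding sum0 by simp
    ultimately have "(\<lambda>k. ?b k j - B j c) \<longlonglongrightarrow> 0"
      by (rule null_of_norm_sq_le)
    then have "(\<lambda>k. ?b k j) \<longlonglongrightarrow> B j c"
      by (rule LIM_zero_cancel)
    from weakly_tendsto_unique[OF b(1)[OF that] tendsto_imp_weakly_tendsto[OF this]] show ?thesis .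
  qed
  have "F_value w (\<lambda>j. B j (B_point (\<lambda>_. 0) (\<lambda>_. c) j)) (\<lambda>_. c) i = ?f' i" for i
    by (simp add: F_value_def B_point_const b_eq)
  then show ?thesis
    unfolding stationary_def solves_def using a ac by simp
qed

end

section \<open>Convergence of the deviation algorithm\<close>

locale deviation_run = causal_splitting n p m F B L \<theta> M S C Q
  for n p m and F :: "nat \<Rightarrow> 'h::{real_inner, complete_space} \<Rightarrow> 'h set" and B L \<theta> M S C Q +
  fixes x z u v :: "nat \<Rightarrow> nat \<Rightarrow> 'h" and \<gamma> \<xi> l2 :: "nat \<Rightarrow> real" and \<epsilon> :: real
  assumes zer_nonempty: "zer (operator_sum n F m B) \<noteq> {}"
    and eps_pos: "0 < \<epsilon>"
    and gamma: "\<And>k. \<epsilon> \<le> \<gamma> k" "\<And>k. \<gamma> k \<le> 1 - \<epsilon>"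
    and xi: "\<And>k. \<xi> k \<le> 1 - \<epsilon>"
    and x_step: "\<And>k. solves (\<lambda>j. z k j + v k j) (u k) (x k)"
    and z_step: "\<And>k j. j < p \<Longrightarrow> z (Suc k) j = z k j - \<gamma> k *\<^sub>R M_adj (x k) j"
    and l2_eq: "\<And>k. l2 k = (1 - \<gamma> k) / \<gamma> k *
          (\<Sum>j<p. (norm (z (Suc k) j - z k j + (\<gamma> k / (1 - \<gamma> k)) *\<^sub>R v k j))\<^sup>2)"
    and deviation: "\<And>k. \<gamma> (Suc k) / (1 - \<gamma> (Suc k)) * (\<Sum>j<p. (norm (v (Suc k) j))\<^sup>2)
          + \<gamma> (Suc k) * (1 + \<theta>) / 2 * (\<Sum>j<m. L j * (norm (u (Suc k) j))\<^sup>2) \<le> \<xi> k * l2 k"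
begin

text \<open>
  The weighted size of the deviations used in step \<open>k\<close>, which is the left side of the deviation
  inequality that admitted them.
\<close>

definition spent :: "nat \<Rightarrow> real" where
  "spent k = \<gamma> k / (1 - \<gamma> k) * (\<Sum>j<p. (norm (v k j))\<^sup>2)
     + \<gamma> k * (1 + \<theta>) / 2 * (\<Sum>j<m. L j * (norm (u k j))\<^sup>2)"

lemma gamma_bounds: "0 < \<gamma> k" "\<gamma> k < 1" "\<epsilon> \<le> \<gamma> k / (1 - \<gamma> k)" "\<gamma> k / (1 - \<gamma> k) \<le> 1 / \<epsilon>"
    "\<epsilon> \<le> (1 - \<gamma> k) / \<gamma> k" "1 / \<gamma> k \<le> 1 / \<epsilon>"
proof -
  show g: "0 < \<gamma> k" "\<gamma> k < 1" using gamma[of k] eps_pos by linarith+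
  have "\<epsilon> * (1 - \<gamma> k) \<le> \<gamma> k * 1" "\<epsilon> * \<gamma> k \<le> (1 - \<gamma> k) * 1"
    using g gamma[of k] eps_pos by (intro mult_mono; linarith)+
  then show "\<epsilon> \<le> \<gamma> k / (1 - \<gamma> k)" "\<epsilon> \<le> (1 - \<gamma> k) / \<gamma> k"
    using g by (simp_all add: pos_le_divide_eq)
  show "\<gamma> k / (1 - \<gamma> k) \<le> 1 / \<epsilon>" "1 / \<gamma> k \<le> 1 / \<epsilon>"
    using g gamma[of k] eps_pos by (intro frac_le; linarith)+
qed

lemma l2_nonneg: "0 \<le> l2 k"
  unfolding l2_eq using gamma_bounds(1,2)[of k] by (intro mult_nonneg_nonneg sum_nonneg) auto

lemma sum_L_nonneg: "0 \<le> (\<Sum>j<m. L j * (norm (u k j))\<^sup>2)"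
  using L_pos by (intro sum_nonneg mult_nonneg_nonneg) (auto intro: less_imp_le)

lemma spent_nonneg: "0 \<le> spent k"
  unfolding spent_def using gamma_bounds(1,2)[of k] theta_pos
  by (intro add_nonneg_nonneg mult_nonneg_nonneg sum_L_nonneg sum_nonneg) auto

lemma spent_Suc_le: "spent (Suc k) \<le> (1 - \<epsilon>) * l2 k"
  using deviation[of k] mult_right_mono[OF xi[of k] l2_nonneg[of k]] by (simp add: spent_def)

text \<open>
  Substituting \<open>z\<^sup>k\<^sup>+\<^sup>1 = z\<^sup>k - \<gamma>\<^sub>k q\<close> with \<open>q = M\<^sup>T x\<^sup>k\<close>, the difference of the two sides becomes
  \<open>\<gamma>\<^sub>k\<close> times the difference of the two sides of \<open>M_adj_bound\<close>; the quantity \<open>l\<^sub>k\<^sup>2\<close> is the completed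
  square of the terms in \<open>q\<close> and \<open>v\<^sup>k\<close>.
\<close>

lemma fejer_step:
  assumes w: "stationary w c"
  shows "(\<Sum>j<p. (norm (z (Suc k) j - w j))\<^sup>2) \<le> (\<Sum>j<p. (norm (z k j - w j))\<^sup>2) - l2 k + spent k"
proof -
  define g where "g = \<gamma> k"
  define q where "q = M_adj (x k)"
  have g: "0 < g" "g < 1" using gamma_bounds by (simp_all add: g_def)
  have step: "(norm (z (Suc k) j - w j))\<^sup>2 = (norm (z k j - w j))\<^sup>2 - 2 * g * inner (z k j - w j) (q j)
      + g\<^sup>2 * (norm (q j))\<^sup>2" if "j < p" for j
    unfolding z_step[OF that] power2_norm_eq_inner g_def[symmetric] q_def[symmetric]
    by (simp add: inner_diff_left inner_diff_right inner_commute algebra_simps power2_eq_square)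
  have l2': "(1 - g) / g * (norm (z (Suc k) j - z k j + (g / (1 - g)) *\<^sub>R v k j))\<^sup>2
      = g * (1 - g) * (norm (q j))\<^sup>2 - 2 * g * inner (v k j) (q j) + g / (1 - g) * (norm (v k j))\<^sup>2"
    if "j < p" for j
  proof -
    have "z (Suc k) j - z k j + (g / (1 - g)) *\<^sub>R v k j = (g / (1 - g)) *\<^sub>R v k j - g *\<^sub>R q j"
      unfolding z_step[OF that] g_def q_def by simp
    then have "(norm (z (Suc k) j - z k j + (g / (1 - g)) *\<^sub>R v k j))\<^sup>2
        = (g / (1 - g))\<^sup>2 * (norm (v k j))\<^sup>2 - 2 * (g / (1 - g)) * g * inner (v k j) (q j) + g\<^sup>2 * (norm (q j))\<^sup>2"
      unfolding power2_norm_eq_inner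
      by (simp add: inner_diff_left inner_diff_right inner_commute power2_eq_square)
    then show ?thesis
      using g by (simp add: divide_simps power2_eq_square) (simp add: algebra_simps)
  qed
  have A: "(\<Sum>j<p. (norm (z (Suc k) j - w j))\<^sup>2) = (\<Sum>j<p. (norm (z k j - w j))\<^sup>2)
      - 2 * g * (\<Sum>j<p. inner (z k j - w j) (q j)) + g\<^sup>2 * (\<Sum>j<p. (norm (q j))\<^sup>2)"
    by (simp add: step sum.distrib sum_subtractf sum_distrib_left)
  have Bl: "l2 k = g * (1 - g) * (\<Sum>j<p. (norm (q j))\<^sup>2) - 2 * g * (\<Sum>j<p. inner (v k j) (q j))
      + g / (1 - g) * (\<Sum>j<p. (norm (v k j))\<^sup>2)"
  proof -
    have "l2 k = (\<Sum>j<p. (1 - g) / g * (norm (z (Suc k) j - z k j + (g / (1 - g)) *\<^sub>R v k j))\<^sup>2)"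
      unfolding l2_eq g_def[symmetric] by (rule sum_distrib_left)
    also have "\<dots> = (\<Sum>j<p. g * (1 - g) * (norm (q j))\<^sup>2 - 2 * g * inner (v k j) (q j)
        + g / (1 - g) * (norm (v k j))\<^sup>2)"
      by (rule sum.cong[OF refl]) (rule l2', simp)
    finally show ?thesis
      by (simp only: sum.distrib sum_subtractf sum_distrib_left)
  qed
  have split: "(\<Sum>j<p. inner (z k j + v k j - w j) (q j))
      = (\<Sum>j<p. inner (z k j - w j) (q j)) + (\<Sum>j<p. inner (v k j) (q j))"
    by (simp add: inner_diff_left inner_add_left sum.distrib sum_subtractf)
  have "(\<Sum>j<p. (norm (q j))\<^sup>2) \<le> 2 * (\<Sum>j<p. inner (z k j + v k j - w j) (q j))
      + (1 + \<theta>) / 2 * (\<Sum>j<m. L j * (norm (u k j))\<^sup>2)"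
    unfolding q_def by (rule M_adj_bound[OF x_step w])
  then have "g * (\<Sum>j<p. (norm (q j))\<^sup>2) \<le> g * (2 * (\<Sum>j<p. inner (z k j + v k j - w j) (q j))
      + (1 + \<theta>) / 2 * (\<Sum>j<m. L j * (norm (u k j))\<^sup>2))"
    using g by (intro mult_left_mono) auto
  then show ?thesis
    unfolding A Bl spent_def g_def[symmetric] split
    by (simp add: algebra_simps power2_eq_square)
qed

lemma exists_stationary: "\<exists>w c. stationary w c"
  using zer_nonempty zer_imp_stationary by blast

lemma summable_l2: "summable l2"
  and spent_tendsto: "spent \<longlonglongrightarrow> 0"
proof -
  obtain w c where w: "stationary w c" using exists_stationary by blast
  have "summable l2 \<and> spent \<longlonglongrightarrow> 0 \<and> convergent (\<lambda>k. \<Sum>j<p. (norm (z k j - w j))\<^sup>2)"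
    by (rule quasi_fejer_summable_convergent[OF eps_pos])
      (auto intro: sum_nonneg l2_nonneg spent_nonneg fejer_step[OF w] spent_Suc_le)
  then show "summable l2" "spent \<longlonglongrightarrow> 0" by auto
qed

lemma distance_convergent:
  assumes w: "stationary w c"
  shows "convergent (\<lambda>k. \<Sum>j<p. (norm (z k j - w j))\<^sup>2)"
proof -
  have "summable l2 \<and> spent \<longlonglongrightarrow> 0 \<and> convergent (\<lambda>k. \<Sum>j<p. (norm (z k j - w j))\<^sup>2)"
    by (rule quasi_fejer_summable_convergent[OF eps_pos])
      (auto intro: sum_nonneg l2_nonneg spent_nonneg fejer_step[OF w] spent_Suc_le)
  then show ?thesis by simp
qed

lemma v_tendsto: assumes "j < p" shows "(\<lambda>k. v k j) \<longlonglongrightarrow> 0"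
proof (rule null_of_norm_sq_le[OF _ spent_tendsto])
  fix k
  have "\<epsilon> * (norm (v k j))\<^sup>2 \<le> \<gamma> k / (1 - \<gamma> k) * (\<Sum>j<p. (norm (v k j))\<^sup>2)"
    using assms eps_pos gamma_bounds[of k] by (intro mult_mono member_le_sum) auto
  also have "\<dots> \<le> spent k"
    unfolding spent_def using gamma_bounds(1)[of k] theta_pos sum_L_nonneg[of k] by simp
  finally show "(norm (v k j))\<^sup>2 \<le> (1 / \<epsilon>) * spent k"
    using eps_pos by (simp add: field_simps)
qed

lemma u_tendsto: assumes "j < m" shows "(\<lambda>k. u k j) \<longlonglongrightarrow> 0"
proof (rule null_of_norm_sq_le[OF _ spent_tendsto])
  fix k
  have "\<epsilon> / 2 * (L j * (norm (u k j))\<^sup>2) \<le> \<gamma> k * (1 + \<theta>) / 2 * (\<Sum>j<m. L j * (norm (u k j))\<^sup>2)"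
  proof (intro mult_mono)
    have "\<epsilon> * 1 \<le> \<gamma> k * (1 + \<theta>)"
      using gamma(1)[of k] eps_pos theta_pos by (intro mult_mono) auto
    then show "\<epsilon> / 2 \<le> \<gamma> k * (1 + \<theta>) / 2" by simp
    show "L j * (norm (u k j))\<^sup>2 \<le> (\<Sum>j<m. L j * (norm (u k j))\<^sup>2)"
      using assms L_pos by (intro member_le_sum) (auto intro!: mult_nonneg_nonneg intro: less_imp_le)
  qed (use assms L_pos gamma_bounds(1)[of k] theta_pos in
      \<open>auto intro!: mult_nonneg_nonneg intro: less_imp_le\<close>)
  also have "\<dots> \<le> spent k"
    unfolding spent_def using gamma_bounds(1,2)[of k] by (simp add: sum_nonneg)
  finally show "(norm (u k j))\<^sup>2 \<le> (2 / (\<epsilon> * L j)) * spent k"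
    using eps_pos L_pos[OF assms] by (simp add: field_simps)
qed

lemma z_diff_tendsto: assumes "j < p" shows "(\<lambda>k. z (Suc k) j - z k j) \<longlonglongrightarrow> 0"
proof -
  let ?t = "\<lambda>k. \<gamma> k / (1 - \<gamma> k)"
  have "(\<lambda>k. z (Suc k) j - z k j + ?t k *\<^sub>R v k j) \<longlonglongrightarrow> 0"
  proof (rule null_of_norm_sq_le[OF _ summable_LIMSEQ_zero[OF summable_l2]])
    fix k
    have "\<epsilon> * (norm (z (Suc k) j - z k j + ?t k *\<^sub>R v k j))\<^sup>2 \<le> l2 k"
      unfolding l2_eq using assms eps_pos gamma_bounds[of k] by (intro mult_mono member_le_sum) auto
    then show "(norm (z (Suc k) j - z k j + ?t k *\<^sub>R v k j))\<^sup>2 \<le> (1 / \<epsilon>) * l2 k"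
      using eps_pos by (simp add: field_simps)
  qed
  moreover have "(\<lambda>k. ?t k *\<^sub>R v k j) \<longlonglongrightarrow> 0"
  proof (rule tendsto_0_le[OF v_tendsto[OF assms], of _ "1 / \<epsilon>"], intro always_eventually allI)
    fix k
    have "norm (v k j) * ?t k \<le> norm (v k j) * (1 / \<epsilon>)"
      using gamma_bounds(4)[of k] by (intro mult_left_mono) auto
    then show "norm (?t k *\<^sub>R v k j) \<le> norm (v k j) * (1 / \<epsilon>)"
      using gamma_bounds(1,2)[of k] by (simp add: mult.commute)
  qed
  ultimately show ?thesis
    using tendsto_diff by fastforce
qed

lemma M_adj_x_tendsto: assumes "j < p" shows "(\<lambda>k. M_adj (x k) j) \<longlonglongrightarrow> 0"
proof (rule tendsto_0_le[OF z_diff_tendsto[OF assms], of _ "1 / \<epsilon>"], intro always_eventually allI)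
  fix k
  have "M_adj (x k) j = (1 / \<gamma> k) *\<^sub>R (z k j - z (Suc k) j)"
    using gamma_bounds(1)[of k] by (simp add: z_step[OF assms])
  then have "norm (M_adj (x k) j) = norm (z (Suc k) j - z k j) * (1 / \<gamma> k)"
    using gamma_bounds(1)[of k] by (simp add: norm_minus_commute)
  also have "\<dots> \<le> norm (z (Suc k) j - z k j) * (1 / \<epsilon>)"
    using gamma_bounds(6)[of k] by (intro mult_left_mono) auto
  finally show "norm (M_adj (x k) j) \<le> norm (z (Suc k) j - z k j) * (1 / \<epsilon>)" .
qed

text \<open>
  A coefficient vector with sum zero lies in the range of \<open>M\<close>, so the combination is one of the
  components of \<open>M\<^sup>T x\<^sup>k\<close>.
\<close>

lemma balanced_combination_tendsto:
  fixes s :: "nat \<Rightarrow> real"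
  assumes "(\<Sum>i<n. s i) = 0"
  shows "(\<lambda>k. \<Sum>i<n. s i *\<^sub>R x k i) \<longlonglongrightarrow> 0"
proof -
  obtain t where t: "\<And>i. i < n \<Longrightarrow> (\<Sum>j<p. M i j *\<^sub>R t j) = s i"
    using M_range[OF assms] by blast
  have "(\<Sum>i<n. s i *\<^sub>R x k i) = (\<Sum>j<p. t j *\<^sub>R M_adj (x k) j)" for k
  proof -
    have "(\<Sum>i<n. s i *\<^sub>R x k i) = (\<Sum>i<n. \<Sum>j<p. (M i j * t j) *\<^sub>R x k i)"
      by (intro sum.cong) (auto simp: t[symmetric] scaleR_sum_left)
    also have "\<dots> = (\<Sum>j<p. \<Sum>i<n. (M i j * t j) *\<^sub>R x k i)" by (rule sum.swap)
    finally show ?thesis by (simp add: M_adj_def scaleR_sum_right mult.commute)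
  qed
  moreover have "(\<lambda>k. \<Sum>j<p. t j *\<^sub>R M_adj (x k) j) \<longlonglongrightarrow> (\<Sum>j<p. t j *\<^sub>R 0)"
    by (intro tendsto_sum tendsto_scaleR tendsto_const M_adj_x_tendsto) simp
  ultimately show ?thesis by simp
qed

lemma consensus_tendsto: assumes "i < n" shows "(\<lambda>k. x k i - x k 0) \<longlonglongrightarrow> 0"
proof -
  let ?s = "\<lambda>h. (if h = i then 1 else 0) - (if h = 0 then 1 else 0) :: real"
  have "(\<Sum>h<n. ?s h) = 0"
    using assms n_pos by (simp add: sum_subtractf)
  from balanced_combination_tendsto[OF this]
  have "(\<lambda>k. \<Sum>h<n. ?s h *\<^sub>R x k h) \<longlonglongrightarrow> 0" .
  moreover have "(\<Sum>h<n. ?s h *\<^sub>R x k h) = x k i - x k 0" for k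
  proof -
    have "(\<Sum>h<n. ?s h *\<^sub>R x k h) = (\<Sum>h<n. (if h = i then x k h else 0) - (if h = 0 then x k h else 0))"
      by (intro sum.cong) auto
    then show ?thesis using assms n_pos by (simp add: sum_subtractf)
  qed
  ultimately show ?thesis by simp
qed

lemma Bseq_z: assumes "j < p" shows "Bseq (\<lambda>k. z k j)"
proof -
  obtain w c where w: "stationary w c" using exists_stationary by blast
  have "Bseq (\<lambda>k. \<Sum>j<p. (norm (z k j - w j))\<^sup>2)"
    using distance_convergent[OF w] by (rule convergent_imp_Bseq)
  then obtain K where K: "\<And>k. norm (\<Sum>j<p. (norm (z k j - w j))\<^sup>2) \<le> K"
    by (auto simp: Bseq_def)
  have "norm (z k j) \<le> norm (w j) + sqrt K" for k
  proof -
    have "(norm (z k j - w j))\<^sup>2 \<le> (\<Sum>j<p. (norm (z k j - w j))\<^sup>2)"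
      using assms by (intro member_le_sum) auto
    also have "\<dots> \<le> K" using K[of k] by simp
    finally have "norm (z k j - w j) \<le> sqrt K" by (rule real_le_rsqrt)
    then show ?thesis using norm_triangle_sub[of "z k j" "w j"] by linarith
  qed
  then show ?thesis by (rule BseqI')
qed

text \<open>
  The first component is bounded by comparison with a stationary point; the others differ from it by
  null sequences.
\<close>

lemma Bseq_x: assumes "i < n" shows "Bseq (\<lambda>k. x k i)"
proof -
  obtain w c where w: "stationary w c" using exists_stationary by blast
  have "Bseq (\<lambda>k. \<Sum>j<p. M 0 j *\<^sub>R (z k j + v k j + - w j))"
    by (intro Bseq_sum Bseq_scaleR_const Bseq_add_seq Bseq_z Bseq_of_tendsto[OF tendsto_const]
        Bseq_of_tendsto[OF v_tendsto]) auto
  then obtain K where K: "\<And>k. norm (\<Sum>j<p. M 0 j *\<^sub>R (z k j + v k j + - w j)) \<le> K"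
    by (auto simp: Bseq_def)
  have "norm (x k 0) \<le> norm c + K / (S 0 0 / 2)" for k
  proof -
    have "S 0 0 / 2 * norm (x k 0 - c) \<le> K"
      using first_component_bound[OF x_step w, of k] K[of k] by simp
    then have "norm (x k 0 - c) \<le> K / (S 0 0 / 2)"
      using S_pos[OF n_pos] by (simp add: field_simps)
    then show ?thesis using norm_triangle_sub[of "x k 0" c] by linarith
  qed
  then have "Bseq (\<lambda>k. x k 0)" by (rule BseqI')
  from Bseq_add_seq[OF this Bseq_of_tendsto[OF consensus_tendsto[OF assms]]]
  show ?thesis by simp
qed

lemma Bseq_B: assumes "j < m" shows "Bseq (\<lambda>k. B j (B_point (u k) (x k) j))"
proof -
  have "Bseq (\<lambda>k. B_point (u k) (x k) j)"
    unfolding B_point_def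
    by (intro Bseq_add_seq Bseq_sum Bseq_scaleR_const Bseq_x Bseq_of_tendsto[OF u_tendsto[OF assms]]) auto
  then obtain K where K: "\<And>k. norm (B_point (u k) (x k) j) \<le> K" by (auto simp: Bseq_def)
  have "norm (B j (B_point (u k) (x k) j)) \<le> norm (B j 0) + L j * K" for k
  proof -
    have "norm (B j (B_point (u k) (x k) j) - B j 0) \<le> L j * norm (B_point (u k) (x k) j - 0)"
      by (rule B_lipschitz[OF assms])
    also have "\<dots> \<le> L j * K" using K[of k] L_pos[OF assms] by (intro mult_left_mono) auto
    finally show ?thesis
      using norm_triangle_sub[of "B j (B_point (u k) (x k) j)" "B j 0"] by linarith
  qed
  then show ?thesis by (rule BseqI')
qed

text \<open>
  One subsequence makes the components of \<open>z\<close>, the first component of \<open>x\<close> and the values of the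
  operators \<open>B\<^sub>j\<close> converge weakly at the same time.
\<close>

lemma weak_cluster_point:
  assumes r: "strict_mono (r :: nat \<Rightarrow> nat)"
  shows "\<exists>s w c. strict_mono (s :: nat \<Rightarrow> nat) \<and> stationary w c
    \<and> (\<forall>j<p. weakly_tendsto (\<lambda>k. z (r (s k)) j) (w j)) \<and> (\<forall>i<n. weakly_tendsto (\<lambda>k. x (r (s k)) i) c)"
proof -
  define X where "X = (\<lambda>(t :: nat, j) k. if t = 0 then z (r k) j else if t = 1 then x (r k) 0
      else B j (B_point (u (r k)) (x (r k)) j))"
  define I where "I = {0} \<times> {..<p} \<union> {(1, 0)} \<union> {2 :: nat} \<times> {..<m}"
  have sub: "Bseq Y \<Longrightarrow> Bseq (\<lambda>k. Y (r k))" for Y :: "nat \<Rightarrow> 'h"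
    using Bseq_compose[of Y r] by (simp add: o_def)
  have "Bseq (X i)" if "i \<in> I" for i
    using that n_pos by (auto simp: X_def I_def intro: sub[OF Bseq_z] sub[OF Bseq_x] sub[OF Bseq_B])
  moreover have "finite I" by (simp add: I_def)
  ultimately obtain s a where s: "strict_mono (s :: nat \<Rightarrow> nat)"
    and a: "\<forall>i\<in>I. weakly_tendsto (X i \<circ> s) (a i)"
    using common_weakly_convergent_subsequence[of I X] by blast
  have rs: "strict_mono (r \<circ> s)" by (rule strict_mono_o[OF r s])
  have sub2: "Y \<longlonglongrightarrow> l \<Longrightarrow> (\<lambda>k. Y (r (s k))) \<longlonglongrightarrow> l" for Y :: "nat \<Rightarrow> 'h" and l
    using LIMSEQ_subseq_LIMSEQ[OF _ rs, of Y l] by (simp add: o_def)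
  have sub3: "Bseq Y \<Longrightarrow> Bseq (\<lambda>k. Y (r (s k)))" for Y :: "nat \<Rightarrow> 'h"
    using Bseq_compose[of Y "r \<circ> s"] by (simp add: o_def)
  have z_lim: "weakly_tendsto (\<lambda>k. z (r (s k)) j) (a (0, j))" if "j < p" for j
    using bspec[OF a, of "(0, j)"] that by (simp add: I_def X_def o_def)
  have x0_lim: "weakly_tendsto (\<lambda>k. x (r (s k)) 0) (a (1, 0))"
    using bspec[OF a, of "(1, 0)"] by (simp add: I_def X_def o_def)
  have b_lim: "weakly_tendsto (\<lambda>k. B j (B_point (u (r (s k))) (x (r (s k))) j)) (a (2, j))" if "j < m" for j
    using bspec[OF a, of "(2, j)"] that by (simp add: I_def X_def o_def)
  have x_lim: "weakly_tendsto (\<lambda>k. x (r (s k)) i) (a (1, 0))" if "i < n" for i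
    by (rule weakly_tendsto_diff_null[OF x0_lim sub2[OF consensus_tendsto[OF that]]])
  have "stationary (\<lambda>j. a (0, j)) (a (1, 0))"
  proof (rule weak_limit_stationary[where \<zeta> = "\<lambda>k j. z (r (s k)) j + v (r (s k)) j"
        and u = "\<lambda>k. u (r (s k))" and x = "\<lambda>k. x (r (s k))" and \<beta> = "\<lambda>j. a (2, j)"])
    show "weakly_tendsto (\<lambda>k. z (r (s k)) j + v (r (s k)) j) (a (0, j))" if "j < p" for j
      by (rule weakly_tendsto_diff_null[OF z_lim[OF that]]) (use sub2[OF v_tendsto[OF that]] in simp)
    show "Bseq (\<lambda>k. z (r (s k)) j + v (r (s k)) j)" if "j < p" for j
      by (rule sub3[OF Bseq_add_seq[OF Bseq_z[OF that] Bseq_of_tendsto[OF v_tendsto[OF that]]]])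
  qed (use x_lim b_lim in \<open>auto intro: x_step sub3[OF Bseq_x] sub3[OF Bseq_B]
      sub2[OF consensus_tendsto] sub2[OF u_tendsto] sub2[OF M_adj_x_tendsto]\<close>)
  then show ?thesis using s z_lim x_lim by blast
qed

text \<open>
  Opial's argument. The distances to \<open>w\<close> and to \<open>w'\<close> both converge, hence so does
  \<open>\<langle>z\<^sup>k, w - w'\<rangle>\<close>; its limits along the two subsequences are \<open>\<langle>w, w - w'\<rangle>\<close> and \<open>\<langle>w', w - w'\<rangle>\<close>.
\<close>

lemma weak_cluster_points_agree:
  assumes w: "stationary w c" and w': "stationary w' c'"
    and r: "strict_mono (r :: nat \<Rightarrow> nat)" "\<And>j. j < p \<Longrightarrow> weakly_tendsto (\<lambda>k. z (r k) j) (w j)"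
    and r': "strict_mono (r' :: nat \<Rightarrow> nat)" "\<And>j. j < p \<Longrightarrow> weakly_tendsto (\<lambda>k. z (r' k) j) (w' j)"
    and "j < p"
  shows "w j = w' j"
proof -
  define H where "H k = (\<Sum>j<p. inner (z k j) (w j - w' j))" for k
  have H_eq: "H k = ((\<Sum>j<p. (norm (z k j - w' j))\<^sup>2) - (\<Sum>j<p. (norm (z k j - w j))\<^sup>2)
      + (\<Sum>j<p. (norm (w j))\<^sup>2 - (norm (w' j))\<^sup>2)) / 2" for k
    unfolding H_def sum_subtractf[symmetric] sum.distrib[symmetric] sum_divide_distrib power2_norm_eq_inner
    by (intro sum.cong) (simp_all add: inner_diff_left inner_diff_right inner_commute field_simps)
  have "convergent (\<lambda>k. ((\<Sum>j<p. (norm (z k j - w' j))\<^sup>2) - (\<Sum>j<p. (norm (z k j - w j))\<^sup>2)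
      + (\<Sum>j<p. (norm (w j))\<^sup>2 - (norm (w' j))\<^sup>2)) / 2)"
  proof -
    obtain \<alpha> \<alpha>' where lim: "(\<lambda>k. \<Sum>j<p. (norm (z k j - w j))\<^sup>2) \<longlonglongrightarrow> \<alpha>"
      and lim': "(\<lambda>k. \<Sum>j<p. (norm (z k j - w' j))\<^sup>2) \<longlonglongrightarrow> \<alpha>'"
      using distance_convergent[OF w] distance_convergent[OF w'] unfolding convergent_def by blast
    show ?thesis
      by (rule convergentI, rule tendsto_divide[OF tendsto_add[OF tendsto_diff[OF lim' lim] tendsto_const] tendsto_const]) simp
  qed
  then have "convergent H" unfolding H_eq[symmetric] .
  then obtain h where h: "H \<longlonglongrightarrow> h" by (auto simp: convergent_def)
  have "(\<Sum>j<p. inner (w j) (w j - w' j)) = h"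
  proof (rule LIMSEQ_unique)
    show "(\<lambda>k. H (r k)) \<longlonglongrightarrow> (\<Sum>j<p. inner (w j) (w j - w' j))"
      unfolding H_def by (intro tendsto_sum weakly_tendstoD r(2)) simp
    show "(\<lambda>k. H (r k)) \<longlonglongrightarrow> h"
      using LIMSEQ_subseq_LIMSEQ[OF h r(1)] by (simp add: o_def)
  qed
  moreover have "(\<Sum>j<p. inner (w' j) (w j - w' j)) = h"
  proof (rule LIMSEQ_unique)
    show "(\<lambda>k. H (r' k)) \<longlonglongrightarrow> (\<Sum>j<p. inner (w' j) (w j - w' j))"
      unfolding H_def by (intro tendsto_sum weakly_tendstoD r'(2)) simp
    show "(\<lambda>k. H (r' k)) \<longlonglongrightarrow> h"
      using LIMSEQ_subseq_LIMSEQ[OF h r'(1)] by (simp add: o_def)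
  qed
  ultimately have "(\<Sum>j<p. inner (w j - w' j) (w j - w' j)) = 0"
    by (simp add: inner_diff_left[of _ _ "_ - _"] sum_subtractf)
  then have "inner (w j - w' j) (w j - w' j) = 0"
    using \<open>j < p\<close> by (subst (asm) sum_nonneg_eq_0_iff) auto
  then show ?thesis by simp
qed

lemma weak_convergence:
  "\<exists>w c. stationary w c \<and> (\<forall>j<p. weakly_tendsto (\<lambda>k. z k j) (w j)) \<and> (\<forall>i<n. weakly_tendsto (\<lambda>k. x k i) c)"
proof -
  obtain s w c where s: "strict_mono (s :: nat \<Rightarrow> nat)" and w: "stationary w c"
    and z_s: "\<And>j. j < p \<Longrightarrow> weakly_tendsto (\<lambda>k. z (s k) j) (w j)"
    using weak_cluster_point[of "\<lambda>k. k"] by (auto simp: strict_mono_def)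
  have agree: "(\<forall>j<p. w' j = w j) \<and> c' = c"
    if r: "strict_mono (r :: nat \<Rightarrow> nat)" and w': "stationary w' c'"
      and z_r: "\<And>j. j < p \<Longrightarrow> weakly_tendsto (\<lambda>k. z (r k) j) (w' j)" for r w' c'
  proof -
    have "\<And>j. j < p \<Longrightarrow> w' j = w j"
      by (rule weak_cluster_points_agree[OF w' w r z_r s z_s])
    then show ?thesis using stationary_determines_zero[OF w' w] by blast
  qed
  have sub: "\<exists>s. strict_mono (s :: nat \<Rightarrow> nat) \<and> (\<forall>j<p. weakly_tendsto (\<lambda>k. z (r (s k)) j) (w j))
      \<and> (\<forall>i<n. weakly_tendsto (\<lambda>k. x (r (s k)) i) c)" if r: "strict_mono (r :: nat \<Rightarrow> nat)" for r
  proof -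
    obtain s w' c' where s: "strict_mono (s :: nat \<Rightarrow> nat)" and w': "stationary w' c'"
      and lim: "\<And>j. j < p \<Longrightarrow> weakly_tendsto (\<lambda>k. z (r (s k)) j) (w' j)"
        "\<And>i. i < n \<Longrightarrow> weakly_tendsto (\<lambda>k. x (r (s k)) i) c'"
      using weak_cluster_point[OF r] by blast
    have "strict_mono (\<lambda>k. r (s k))" using strict_mono_o[OF r s] by (simp add: o_def)
    then have "(\<forall>j<p. w' j = w j) \<and> c' = c" by (rule agree[OF _ w' lim(1)])
    then show ?thesis using s lim by auto
  qed
  have "weakly_tendsto (\<lambda>k. z k j) (w j)" if "j < p" for j
    by (rule weakly_tendsto_subseq_criterion) (use sub that in \<open>fastforce simp: o_def\<close>)
  moreover have "weakly_tendsto (\<lambda>k. x k i) c" if "i < n" for i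
    by (rule weakly_tendsto_subseq_criterion) (use sub that in \<open>fastforce simp: o_def\<close>)
  ultimately show ?thesis using w by blast
qed

end

section \<open>From matrices and vectors to components\<close>

lemma mult_mat_vec_index_sum:
  assumes "A \<in> carrier_mat r c" and "i < r"
  shows "(A *\<^sub>v vec c w) $ i = (\<Sum>j<c. A $$ (i, j) * w j)"
  using assms by (simp add: scalar_prod_def lessThan_atLeast0)

lemma quadratic_form_eq_sum:
  fixes A :: "real mat"
  assumes "A \<in> carrier_mat n n"
  shows "scalar_prod (vec n w) (A *\<^sub>v vec n w) = (\<Sum>i<n. \<Sum>j<n. A $$ (i, j) * (w i * w j))"
proof -
  have "scalar_prod (vec n w) (A *\<^sub>v vec n w) = (\<Sum>i<n. w i * (A *\<^sub>v vec n w) $ i)"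
    using assms by (simp add: scalar_prod_def lessThan_atLeast0)
  also have "\<dots> = (\<Sum>i<n. \<Sum>j<n. A $$ (i, j) * (w i * w j))"
    using assms
    by (intro sum.cong refl) (simp add: mult_mat_vec_index_sum[OF assms] sum_distrib_left mult_ac del: index_mult_mat_vec)
  finally show ?thesis .
qed

lemma causal_splitting_of_matrix_conditions:
  fixes F :: "nat \<Rightarrow> 'h::{real_inner, complete_space} \<Rightarrow> 'h set"
  assumes n: "1 \<le> n"
    and F: "\<And>i. i < n \<Longrightarrow> maximally_monotone (F i)"
    and B: "\<And>j. j < m \<Longrightarrow> 0 < L j \<and> cocoercive (1 / L j) (B j)"
    and \<theta>: "0 < \<theta>"
    and mc: "matrix_conditions n m \<theta> L M S C Q"
    and S_diag: "\<And>i. i < n \<Longrightarrow> S $$ (i, i) \<noteq> 0"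
  shows "causal_splitting n (n - 1) m F B L \<theta> (\<lambda>i j. M $$ (i, j)) (\<lambda>i j. S $$ (i, j))
    (\<lambda>i j. C $$ (i, j)) (\<lambda>i j. Q $$ (i, j))"
proof -
  have M: "M \<in> carrier_mat n (n - 1)" and S: "S \<in> carrier_mat n n" and C: "C \<in> carrier_mat n m"
    and Q: "Q \<in> carrier_mat m n" and ker: "mat_kernel (M\<^sup>T) \<subseteq> {c \<cdot>\<^sub>v ones_vec n | c. True}"
    and causal: "causal_pair n m C (Q\<^sup>T)"
    and C1: "C\<^sup>T *\<^sub>v ones_vec n = ones_vec m" and Q1: "Q *\<^sub>v ones_vec n = ones_vec m"
    and St: "S\<^sup>T = S" and S1: "scalar_prod (ones_vec n) (S *\<^sub>v ones_vec n) = 0"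
    and psd: "pos_semidef (S - M * M\<^sup>T
       - (1 / 2 * (1 + 1 / \<theta>)) \<cdot>\<^sub>m ((C\<^sup>T - Q)\<^sup>T * mat_diag m L * (C\<^sup>T - Q)))"
    using mc unfolding matrix_conditions_def by blast+
  let ?K = "C\<^sup>T - Q"
  let ?P = "S - M * M\<^sup>T - (1 / 2 * (1 + 1 / \<theta>)) \<cdot>\<^sub>m (?K\<^sup>T * mat_diag m L * ?K)"
  have K: "?K \<in> carrier_mat m n" by (rule minus_carrier_mat[OF Q])
  have Kt: "?K\<^sup>T \<in> carrier_mat n m" by (rule transpose_carrier_mat[THEN iffD2, OF K])
  define G where "G = ?K\<^sup>T * mat_diag m L * ?K"
  have G: "G \<in> carrier_mat n n"
    unfolding G_def by (rule mult_carrier_mat[OF mult_carrier_mat[OF Kt mat_diag_dim] K])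
  have P: "?P \<in> carrier_mat n n"
    unfolding G_def[symmetric] by (rule minus_carrier_mat, rule smult_carrier_mat, rule G)
  have P_entry: "?P $$ (i, h) = S $$ (i, h) - (\<Sum>j<n - 1. 1 * (M $$ (i, j) * M $$ (h, j)))
      - (\<Sum>j<m. ((1 + 1 / \<theta>) / 2 * L j) * ((C $$ (i, j) - Q $$ (j, i)) * (C $$ (h, j) - Q $$ (j, h))))"
    if "i < n" "h < n" for i h
  proof -
    have "(M * M\<^sup>T) $$ (i, h) = (\<Sum>j<n - 1. M $$ (i, j) * M $$ (h, j))"
      using M that by (simp add: scalar_prod_def lessThan_atLeast0)
    moreover have "?K\<^sup>T * mat_diag m L = mat n m (\<lambda>(i, j). ?K\<^sup>T $$ (i, j) * L j)"
      using K by (intro mat_diag_mult_right) simp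
    then have "G $$ (i, h) = (\<Sum>j<m. (C $$ (i, j) - Q $$ (j, i)) * L j * (C $$ (h, j) - Q $$ (j, h)))"
      using K C Q that by (simp add: G_def scalar_prod_def lessThan_atLeast0)
    moreover have "?P $$ (i, h) = S $$ (i, h) - (M * M\<^sup>T) $$ (i, h) - 1 / 2 * (1 + 1 / \<theta>) * G $$ (i, h)"
      unfolding G_def[symmetric] using S M G that by simp
    ultimately show ?thesis
      by (simp add: sum_distrib_left mult_ac)
  qed
  show ?thesis
  proof
    show "0 < n" using n by simp
    show "\<And>i. i < n \<Longrightarrow> maximally_monotone (F i)" by (rule F)
    show "\<And>j. j < m \<Longrightarrow> 0 < L j" using B by blast
    show "\<And>j. j < m \<Longrightarrow> cocoercive (1 / L j) (B j)" using B by blast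
    show "0 < \<theta>" by (rule \<theta>)
    show "S $$ (i, j) = S $$ (j, i)" if "i < n" "j < n" for i j
      using arg_cong[OF St, of "\<lambda>A. A $$ (i, j)"] S that by simp
    show "\<And>i. i < n \<Longrightarrow> S $$ (i, i) \<noteq> 0" by (rule S_diag)
    show "(\<Sum>i<n. \<Sum>j<n. S $$ (i, j)) = 0"
      using S1 quadratic_form_eq_sum[OF S, of "\<lambda>_. 1"] by (simp add: ones_vec_def)
    show "(\<Sum>i<n. C $$ (i, j)) = 1" if "j < m" for j
      using arg_cong[OF C1, of "\<lambda>y. y $ j"] mult_mat_vec_index_sum[of "C\<^sup>T" m n j "\<lambda>_. 1"] C that
      by (simp add: ones_vec_def)
    show "(\<Sum>i<n. Q $$ (j, i)) = 1" if "j < m" for j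
      using arg_cong[OF Q1, of "\<lambda>y. y $ j"] mult_mat_vec_index_sum[of Q m n j "\<lambda>_. 1"] Q that
      by (simp add: ones_vec_def)
    show "\<exists>c. \<forall>i<n. w i = c" if w: "\<And>j. j < n - 1 \<Longrightarrow> (\<Sum>i<n. M $$ (i, j) * w i) = 0" for w :: "nat \<Rightarrow> real"
    proof -
      have Mt: "M\<^sup>T \<in> carrier_mat (n - 1) n" using M by simp
      have "(M\<^sup>T *\<^sub>v vec n w) $ j = 0" if "j < n - 1" for j
        unfolding mult_mat_vec_index_sum[OF Mt that] using w[OF that] M that by simp
      then have "M\<^sup>T *\<^sub>v vec n w = 0\<^sub>v (n - 1)"
        using M by (intro eq_vecI) auto
      then have "vec n w \<in> mat_kernel (M\<^sup>T)"
        by (intro mat_kernelI[OF Mt]) auto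
      then obtain c where c: "vec n w = c \<cdot>\<^sub>v ones_vec n" using ker by blast
      have "w i = c" if "i < n" for i
        using arg_cong[OF c, of "\<lambda>y. y $ i"] that by (simp add: ones_vec_def)
      then show ?thesis by blast
    qed
    show "(\<Sum>j<n - 1. (\<Sum>i<n. M $$ (i, j) * w i)\<^sup>2)
        + (\<Sum>j<m. ((1 + 1 / \<theta>) / 2 * L j) * (\<Sum>i<n. (C $$ (i, j) - Q $$ (j, i)) * w i)\<^sup>2)
      \<le> (\<Sum>i<n. \<Sum>j<n. S $$ (i, j) * (w i * w j))" for w :: "nat \<Rightarrow> real"
    proof -
      have "0 \<le> scalar_prod (vec n w) (?P *\<^sub>v vec n w)"
        using psd P unfolding pos_semidef_def by auto
      also have "\<dots> = (\<Sum>i<n. \<Sum>h<n. ?P $$ (i, h) * inner (w i) (w h))"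
        unfolding quadratic_form_eq_sum[OF P] by simp
      also have "\<dots> = (\<Sum>i<n. \<Sum>h<n. (S $$ (i, h) - (\<Sum>j<n - 1. 1 * (M $$ (i, j) * M $$ (h, j)))
          - (\<Sum>j<m. ((1 + 1 / \<theta>) / 2 * L j) * ((C $$ (i, j) - Q $$ (j, i)) * (C $$ (h, j) - Q $$ (j, h)))))
          * inner (w i) (w h))"
        by (intro sum.cong refl) (simp only: P_entry lessThan_iff)
      also have "\<dots> = (\<Sum>i<n. \<Sum>h<n. S $$ (i, h) * inner (w i) (w h))
          - (\<Sum>j<n - 1. 1 * (norm (\<Sum>i<n. M $$ (i, j) *\<^sub>R w i))\<^sup>2)
          - (\<Sum>j<m. ((1 + 1 / \<theta>) / 2 * L j) * (norm (\<Sum>i<n. (C $$ (i, j) - Q $$ (j, i)) *\<^sub>R w i))\<^sup>2)"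
        unfolding sum_weighted_norm_sq_eq_form left_diff_distrib[of _ _ "inner _ _"] sum_subtractf ..
      finally show ?thesis by simp
    qed
    show "Q $$ (j, h) = 0" if "i < n" "j < m" "h < n" "i \<le> h" "C $$ (i, j) \<noteq> 0" for i j h
    proof -
      obtain A where A: "nondecreasing_vector m n A"
        and CA: "\<And>i j. i < n \<Longrightarrow> j < m \<Longrightarrow> A i \<le> j \<Longrightarrow> C $$ (i, j) = 0"
        and QA: "\<And>i j. i < n \<Longrightarrow> j < m \<Longrightarrow> j < A i \<Longrightarrow> Q\<^sup>T $$ (i, j) = 0"
        using causal unfolding causal_pair_def by blast
      have "A i \<le> A h" using \<open>i \<le> h\<close> \<open>h < n\<close>
      proof (induction h rule: dec_induct)
        case (step h)
        then have "A h \<le> A (Suc h)" using A unfolding nondecreasing_vector_def by simp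
        then show ?case using step by simp
      qed simp
      moreover have "j < A i" using CA[OF that(1,2)] that(5) by fastforce
      ultimately have "Q\<^sup>T $$ (h, j) = 0" using QA that by simp
      then show ?thesis using Q that by simp
    qed
  qed
qed

lemma lift_mat_index:
  "A \<in> carrier_mat r c \<Longrightarrow> i < r \<Longrightarrow> lift_mat A x $ i = (\<Sum>j<c. A $$ (i, j) *\<^sub>R x $ j)"
  by (auto simp: lift_mat_def)

lemma dim_lift_mat: "A \<in> carrier_mat r c \<Longrightarrow> dim_vec (lift_mat A x) = r"
  by (auto simp: lift_mat_def)

lemma lift_mat_diag_index:
  assumes "i < n"
  shows "lift_mat (mat_diag n d) x $ i = d i *\<^sub>R x $ i"
proof -
  have "lift_mat (mat_diag n d) x $ i = (\<Sum>j<n. mat_diag n d $$ (i, j) *\<^sub>R x $ j)"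
    by (rule lift_mat_index[OF mat_diag_dim assms])
  also have "\<dots> = (\<Sum>j<n. if j = i then d i *\<^sub>R x $ i else 0)"
    using assms by (intro sum.cong) (auto simp: mat_diag_def)
  finally show ?thesis using assms by simp
qed

lemma lift_mat_strict_lower_index:
  assumes "S \<in> carrier_mat n n" and "i < n"
  shows "lift_mat (- strict_lower S) x $ i = - (\<Sum>j<i. S $$ (i, j) *\<^sub>R x $ j)"
proof -
  have "- strict_lower S \<in> carrier_mat n n" using assms by (simp add: strict_lower_def)
  then have "lift_mat (- strict_lower S) x $ i = (\<Sum>j<n. (- strict_lower S) $$ (i, j) *\<^sub>R x $ j)"
    using assms(2) by (rule lift_mat_index)
  also have "\<dots> = (\<Sum>j<i. - (S $$ (i, j) *\<^sub>R x $ j))"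
    using assms by (intro sum.mono_neutral_cong_right) (auto simp: strict_lower_def)
  finally show ?thesis by (simp add: sum_negf)
qed

lemma prod_norm_sq: "(prod_norm y)\<^sup>2 = (\<Sum>i<dim_vec y. (norm (y $ i))\<^sup>2)"
  by (simp add: prod_norm_def prod_inner_def power2_norm_eq_inner sum_nonneg)

lemma prod_norm_tendsto_zero:
  fixes y :: "nat \<Rightarrow> 'a::real_inner vec"
  assumes "\<And>k. dim_vec (y k) = q" and "\<And>j. j < q \<Longrightarrow> (\<lambda>k. y k $ j) \<longlonglongrightarrow> 0"
  shows "(\<lambda>k. prod_norm (y k)) \<longlonglongrightarrow> 0"
proof -
  have "(\<lambda>k. \<Sum>j<q. inner (y k $ j) (y k $ j)) \<longlonglongrightarrow> (\<Sum>j<q. inner (0 :: 'a) 0)"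
    by (intro tendsto_sum tendsto_inner assms) simp_all
  from tendsto_real_sqrt[OF this] show ?thesis
    by (simp add: prod_norm_def prod_inner_def assms(1))
qed

lemma weakly_converges_componentwise:
  assumes "a \<in> carrier_vec q" and "\<And>k. y k \<in> carrier_vec q"
    and "\<And>j. j < q \<Longrightarrow> weakly_tendsto (\<lambda>k. y k $ j) (a $ j)"
  shows "weakly_converges q y a"
proof -
  have dims: "dim_vec a = q" "dim_vec (y k) = q" for k
    using assms(1) assms(2)[of k] by auto
  show ?thesis
    unfolding weakly_converges_def prod_inner_def dims
    by (intro conjI assms ballI tendsto_sum weakly_tendstoD) simp
qed

text \<open>
  The vector inside \<open>T z\<close> is the unique solution of the inclusions for \<open>u = 0\<close>. The point \<open>z\<close> is
  fixed iff \<open>M\<^sup>T\<close> annihilates it, which by the kernel condition means that it is constant.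
\<close>

lemma fixed_points_T_op:
  fixes F :: "nat \<Rightarrow> 'h::{real_inner, complete_space} \<Rightarrow> 'h set"
  assumes cs: "causal_splitting n (n - 1) m F B L \<theta> (\<lambda>i j. M $$ (i, j)) (\<lambda>i j. S $$ (i, j))
    (\<lambda>i j. C $$ (i, j)) (\<lambda>i j. Q $$ (i, j))"
    and M: "M \<in> carrier_mat n (n - 1)" and S: "S \<in> carrier_mat n n" and C: "C \<in> carrier_mat n m"
    and Q: "Q \<in> carrier_mat m n" and "g \<noteq> 0" and z: "z \<in> carrier_vec (n - 1)"
  shows "z \<in> fixed_points (n - 1) (T_op F B M S C Q g) \<longleftrightarrow>
    (\<exists>c. causal_splitting.stationary n (n - 1) m F B (\<lambda>i j. M $$ (i, j)) (\<lambda>i j. S $$ (i, j))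
      (\<lambda>i j. C $$ (i, j)) (\<lambda>i j. Q $$ (i, j)) (\<lambda>j. z $ j) c)"
proof -
  interpret causal_splitting n "n - 1" m F B L \<theta> "\<lambda>i j. M $$ (i, j)" "\<lambda>i j. S $$ (i, j)"
    "\<lambda>i j. C $$ (i, j)" "\<lambda>i j. Q $$ (i, j)" by (rule cs)
  let ?D = "mat_diag n (stepsize S)"
  let ?rhs = "\<lambda>x. lift_mat ?D (lift_mat (- strict_lower S) x) + lift_mat ?D (lift_mat M z)
               - lift_mat ?D (lift_mat C (diag_apply B (lift_mat Q x)))"
  have dim_rhs: "dim_vec (?rhs x) = n" for x
    by (simp add: dim_lift_mat[OF mat_diag_dim])
  have B_index: "diag_apply B (lift_mat Q x) $ j = B j (B_point (\<lambda>_. 0) (\<lambda>i. x $ i) j)" if "j < m" for x j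
    using that by (simp add: diag_apply_def dim_lift_mat[OF Q] lift_mat_index[OF Q] B_point_def)
  have rhs: "resolvent (stepsize S i) (F i) (?rhs x $ i) = resolvent_update (\<lambda>j. z $ j) (\<lambda>_. 0) i (\<lambda>i. x $ i)"
    if "i < n" for x i
  proof -
    have "(\<Sum>j<m. C $$ (i, j) *\<^sub>R B j ((\<Sum>h<i. Q $$ (j, h) *\<^sub>R x $ h) + 0))
        = (\<Sum>j<m. C $$ (i, j) *\<^sub>R diag_apply B (lift_mat Q x) $ j)"
      using causal_B_point[OF that, of _ "\<lambda>i. x $ i" "\<lambda>_. 0"] by (intro sum.cong) (auto simp: B_index)
    then show ?thesis
      using that unfolding resolvent_update_def stepsize_def
      by (simp add: dim_lift_mat[OF mat_diag_dim] lift_mat_diag_index lift_mat_strict_lower_index[OF S]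
          lift_mat_index[OF M] lift_mat_index[OF C])
  qed
  have eq_iff: "x = diag_resolvent (stepsize S) F (?rhs x) \<longleftrightarrow> solves (\<lambda>j. z $ j) (\<lambda>_. 0) (\<lambda>i. x $ i)"
    if "x \<in> carrier_vec n" for x
  proof -
    have "x = diag_resolvent (stepsize S) F (?rhs x)
        \<longleftrightarrow> (\<forall>i<n. x $ i = resolvent (stepsize S i) (F i) (?rhs x $ i))"
      using that unfolding diag_resolvent_def dim_rhs by (auto simp: vec_eq_iff)
    then show ?thesis by (simp only: rhs solves_iff_resolvent_update cong: all_cong)
  qed
  obtain f where f: "solves (\<lambda>j. z $ j) (\<lambda>_. 0) f" using solves_exists by blast
  have "T_inner F B M S C Q z = (THE x. x \<in> carrier_vec n \<and> x = diag_resolvent (stepsize S) F (?rhs x))"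
    using S by (simp add: T_inner_def Let_def)
  also have "\<dots> = vec n f"
  proof (rule the_equality)
    have "solves (\<lambda>j. z $ j) (\<lambda>_. 0) (\<lambda>i. vec n f $ i)"
      using f solves_cong[of f "\<lambda>i. vec n f $ i"] by simp
    then show "vec n f \<in> carrier_vec n \<and> vec n f = diag_resolvent (stepsize S) F (?rhs (vec n f))"
      using eq_iff[of "vec n f"] by simp
    fix x assume x: "x \<in> carrier_vec n \<and> x = diag_resolvent (stepsize S) F (?rhs x)"
    then have "solves (\<lambda>j. z $ j) (\<lambda>_. 0) (\<lambda>i. x $ i)" using eq_iff[of x] by simp
    from solves_unique[OF this f] show "x = vec n f" using x by (intro eq_vecI) auto
  qed
  finally have inner: "T_inner F B M S C Q z = vec n f" .
  have Mt: "M\<^sup>T \<in> carrier_mat (n - 1) n" using M by simp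
  have "lift_mat (M\<^sup>T) (vec n f) $ j = M_adj f j" if "j < n - 1" for j
    using that M by (simp add: lift_mat_index[OF Mt] M_adj_def)
  then have "T_op F B M S C Q g z $ j = z $ j - g *\<^sub>R M_adj f j" if "j < n - 1" for j
    using that z unfolding T_op_def inner by (simp add: scale_vec_def dim_lift_mat[OF Mt])
  moreover have "dim_vec (T_op F B M S C Q g z) = n - 1"
    unfolding T_op_def by (simp add: scale_vec_def dim_lift_mat[OF Mt])
  ultimately have "T_op F B M S C Q g z = z \<longleftrightarrow> (\<forall>j<n - 1. M_adj f j = 0)"
    using z \<open>g \<noteq> 0\<close> by (auto simp: vec_eq_iff)
  also have "\<dots> \<longleftrightarrow> (\<exists>c. stationary (\<lambda>j. z $ j) c)"
  proof
    assume "\<forall>j<n - 1. M_adj f j = 0"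
    then have "f i = f 0" if "i < n" for i using M_adj_zero_imp_const that by blast
    then show "\<exists>c. stationary (\<lambda>j. z $ j) c"
      using f solves_cong[of f "\<lambda>_. f 0"] unfolding stationary_def by blast
  next
    assume "\<exists>c. stationary (\<lambda>j. z $ j) c"
    then obtain c where "solves (\<lambda>j. z $ j) (\<lambda>_. 0) (\<lambda>_. c)"
      unfolding stationary_def by blast
    from solves_unique[OF f this] have "M_adj f j = M_adj (\<lambda>_. c) j" for j
      by (simp add: M_adj_def)
    then show "\<forall>j<n - 1. M_adj f j = 0" by (simp add: M_adj_const)
  qed
  finally show ?thesis using z by (simp add: fixed_points_def)
qed

section \<open>The convergence theorem\<close>

theorem theorem3p1:
  fixes F :: "nat \<Rightarrow> 'h::{real_inner, complete_space} \<Rightarrow> 'h set"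
    and B :: "nat \<Rightarrow> 'h \<Rightarrow> 'h"
    and L :: "nat \<Rightarrow> real"
    and n m :: nat
    and M S C Q :: "real mat"
    and \<theta> \<epsilon> g :: real
    and \<gamma> \<xi> l2 :: "nat \<Rightarrow> real"
    and x z u v :: "nat \<Rightarrow> 'h Matrix.vec"
  assumes "1 \<le> n"
    and "\<And>i. i < n \<Longrightarrow> maximally_monotone (F i)"
    and "\<And>j. j < m \<Longrightarrow> 0 < L j \<and> cocoercive (1 / L j) (B j)"
    and "zer (operator_sum n F m B) \<noteq> {}"
    and "0 < \<epsilon>" and "0 < \<theta>"
    and "\<And>k. \<epsilon> \<le> \<gamma> k \<and> \<gamma> k \<le> 1 - \<epsilon>"
    and "\<And>k. 0 \<le> \<xi> k \<and> \<xi> k \<le> 1 - \<epsilon>"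
    and "matrix_conditions n m \<theta> L M S C Q"
    and "\<And>i. i < n \<Longrightarrow> S $$ (i, i) \<noteq> 0"
    and "deviation_algorithm n m F B M S C Q \<gamma> x z u v"
    and "\<And>k. l2 k = (1 - \<gamma> k) / \<gamma> k *
           (prod_norm (z (Suc k) - z k + scale_vec (\<gamma> k / (1 - \<gamma> k)) (v k)))\<^sup>2"
    and "\<And>k. \<gamma> (Suc k) / (1 - \<gamma> (Suc k)) * (prod_norm (v (Suc k)))\<^sup>2
           + \<gamma> (Suc k) * (1 + \<theta>) / 2 * weighted_norm_sq L (u (Suc k)) \<le> \<xi> k * l2 k"
    and "0 < g" and "g < 1"
  shows "(summable l2 \<and> (\<lambda>k. prod_norm (u k)) \<longlonglongrightarrow> 0 \<and> (\<lambda>k. prod_norm (v k)) \<longlonglongrightarrow> 0)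
    \<and> (\<forall>w \<in> fixed_points (n - 1) (T_op F B M S C Q g). convergent (\<lambda>k. prod_norm (z k - w)))
    \<and> ((\<lambda>k. prod_norm (z (Suc k) - z k)) \<longlonglongrightarrow> 0 \<and>
       (\<forall>s :: nat \<Rightarrow> real. (\<Sum>i<n. s i) = 0 \<longrightarrow> (\<lambda>k. \<Sum>i<n. s i *\<^sub>R (x k $ i)) \<longlonglongrightarrow> 0))
    \<and> (\<exists>w \<in> fixed_points (n - 1) (T_op F B M S C Q g). weakly_converges (n - 1) z w)
    \<and> (\<exists>xbar \<in> zer (operator_sum n F m B). weakly_converges n x (Matrix.vec n (\<lambda>_. xbar)))"
proof -
  have M: "M \<in> carrier_mat n (n - 1)" and S: "S \<in> carrier_mat n n" and C: "C \<in> carrier_mat n m"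
    and Q: "Q \<in> carrier_mat m n"
    using assms(9) unfolding matrix_conditions_def by blast+
  have cs: "causal_splitting n (n - 1) m F B L \<theta> (\<lambda>i j. M $$ (i, j)) (\<lambda>i j. S $$ (i, j))
    (\<lambda>i j. C $$ (i, j)) (\<lambda>i j. Q $$ (i, j))"
    using assms by (intro causal_splitting_of_matrix_conditions) auto
  interpret causal_splitting n "n - 1" m F B L \<theta> "\<lambda>i j. M $$ (i, j)" "\<lambda>i j. S $$ (i, j)"
    "\<lambda>i j. C $$ (i, j)" "\<lambda>i j. Q $$ (i, j)" by (rule cs)
  have carrier: "x k \<in> carrier_vec n" "z k \<in> carrier_vec (n - 1)" "u k \<in> carrier_vec m"
    "v k \<in> carrier_vec (n - 1)" for k
    using assms(11) unfolding deviation_algorithm_def by blast+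
  then have dims: "dim_vec (x k) = n" "dim_vec (z k) = n - 1" "dim_vec (u k) = m" "dim_vec (v k) = n - 1" for k
    by auto
  have x_update: "x k $ i = resolvent_update (\<lambda>j. z k $ j + v k $ j) (\<lambda>j. u k $ j) i (\<lambda>i. x k $ i)"
    if "i < n" for k i
    using assms(11) that unfolding deviation_algorithm_def resolvent_update_def stepsize_def by blast
  interpret run: deviation_run n "n - 1" m F B L \<theta> "\<lambda>i j. M $$ (i, j)" "\<lambda>i j. S $$ (i, j)"
    "\<lambda>i j. C $$ (i, j)" "\<lambda>i j. Q $$ (i, j)" "\<lambda>k i. x k $ i" "\<lambda>k j. z k $ j" "\<lambda>k j. u k $ j"
    "\<lambda>k j. v k $ j" \<gamma> \<xi> l2 \<epsilon>
  proof
    show "solves (\<lambda>j. z k $ j + v k $ j) (\<lambda>j. u k $ j) (\<lambda>i. x k $ i)" for k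
      using x_update unfolding solves_iff_resolvent_update by blast
    show "z (Suc k) $ j = z k $ j - \<gamma> k *\<^sub>R M_adj (\<lambda>i. x k $ i) j" if "j < n - 1" for k j
      using assms(11) that unfolding deviation_algorithm_def M_adj_def by blast
    show "l2 k = (1 - \<gamma> k) / \<gamma> k *
        (\<Sum>j<n - 1. (norm (z (Suc k) $ j - z k $ j + (\<gamma> k / (1 - \<gamma> k)) *\<^sub>R v k $ j))\<^sup>2)" for k
      unfolding assms(12) prod_norm_sq by (simp add: dims scale_vec_def)
    show "\<gamma> (Suc k) / (1 - \<gamma> (Suc k)) * (\<Sum>j<n - 1. (norm (v (Suc k) $ j))\<^sup>2)
        + \<gamma> (Suc k) * (1 + \<theta>) / 2 * (\<Sum>j<m. L j * (norm (u (Suc k) $ j))\<^sup>2) \<le> \<xi> k * l2 k" for k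
      using assms(13)[of k] unfolding prod_norm_sq weighted_norm_sq_def dims .
  qed (use assms in auto)
  have fix_iff: "w \<in> fixed_points (n - 1) (T_op F B M S C Q g) \<longleftrightarrow> (\<exists>c. stationary (\<lambda>j. w $ j) c)"
    if "w \<in> carrier_vec (n - 1)" for w
    using fixed_points_T_op[OF cs M S C Q _ that] \<open>0 < g\<close> by auto
  have u: "(\<lambda>k. prod_norm (u k)) \<longlonglongrightarrow> 0"
    by (rule prod_norm_tendsto_zero[OF dims(3) run.u_tendsto])
  have v: "(\<lambda>k. prod_norm (v k)) \<longlonglongrightarrow> 0"
    by (rule prod_norm_tendsto_zero[OF dims(4) run.v_tendsto])
  have dist: "convergent (\<lambda>k. prod_norm (z k - w))"
    if w: "w \<in> fixed_points (n - 1) (T_op F B M S C Q g)" for w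
  proof -
    have wc: "w \<in> carrier_vec (n - 1)" using w by (simp add: fixed_points_def)
    then obtain c where "stationary (\<lambda>j. w $ j) c" using w fix_iff by blast
    from run.distance_convergent[OF this] obtain l
      where "(\<lambda>k. \<Sum>j<n - 1. (norm (z k $ j - w $ j))\<^sup>2) \<longlonglongrightarrow> l" by (auto simp: convergent_def)
    from tendsto_real_sqrt[OF this] have "(\<lambda>k. prod_norm (z k - w)) \<longlonglongrightarrow> sqrt l"
      using wc by (simp add: prod_norm_def prod_inner_def power2_norm_eq_inner)
    then show ?thesis by (rule convergentI)
  qed
  have z: "(\<lambda>k. prod_norm (z (Suc k) - z k)) \<longlonglongrightarrow> 0"
  proof (rule prod_norm_tendsto_zero[where q = "n - 1"])
    show "(\<lambda>k. (z (Suc k) - z k) $ j) \<longlonglongrightarrow> 0" if "j < n - 1" for j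
      using run.z_diff_tendsto[OF that] that by (simp add: dims)
  qed (simp add: dims)
  obtain w c where w: "stationary w c"
    and z_lim: "\<And>j. j < n - 1 \<Longrightarrow> weakly_tendsto (\<lambda>k. z k $ j) (w j)"
    and x_lim: "\<And>i. i < n \<Longrightarrow> weakly_tendsto (\<lambda>k. x k $ i) c"
    using run.weak_convergence by blast
  have "stationary (\<lambda>j. vec (n - 1) w $ j) c"
    using w unfolding stationary_def solves_def F_value_def by simp
  then have "vec (n - 1) w \<in> fixed_points (n - 1) (T_op F B M S C Q g)"
    using fix_iff by auto
  moreover have "weakly_converges (n - 1) z (vec (n - 1) w)"
    by (rule weakly_converges_componentwise) (use carrier z_lim in auto)
  moreover have "weakly_converges n x (vec n (\<lambda>_. c))"
    by (rule weakly_converges_componentwise) (use carrier x_lim in auto)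
  moreover have "c \<in> zer (operator_sum n F m B)" by (rule stationary_imp_zer[OF w])
  ultimately show ?thesis
    using run.summable_l2 u v dist z run.balanced_combination_tendsto by blast
qed

end
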